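(* Let $k\geqslant 2$ be a fixed integer and $\rho=\mathrm{e}^{2\pi\mathrm{i}/3}$. The symmetry group and the extended symmetry group of $(\mathbb{X}^{(k)}_{\mathrm{E}},\mathbb{Z}[\rho])$, the shift generated by the $k$-free Eisenstein integers, are given by $\mathcal{S}=\mathbb{Z}[\rho]\simeq\mathbb{Z}^2$ and $\mathcal{R}=\mathcal{S}\rtimes D_6$, respectively, where $D_6=C_6\rtimes C_2$ is the symmetry group of the regular hexagon, and as such isomorphic to a maximal finite subgroup of $\mathrm{GL}(2,\mathbb{Z})$. In particular, $C_6=\mathbb{Z}[\rho]^{\times}$, while $C_2$ is the group of field automorphisms of $\mathbb{Q}(\rho)$, generated by complex conjugation.
   Context: $\mathbb{Z}[\rho]$ is the ring of Eisenstein integers, a lattice in $\mathbb{C}\simeq\mathbb{R}^2$. $V^{(k)}_{\mathrm{E}}$ is the set of Eisenstein integers that are not divisible by the $k$-th power of any Eisenstein prime. Subsets of $\mathbb{Z}[\rho]$ are identified with elements of $\{0,1\}^{\mathbb{Z}[\rho]}$ (product topology), and $\mathbb{X}^{(k)}_{\mathrm{E}}=\overline{\mathbb{Z}[\rho]+V^{(k)}_{\mathrm{E}}}$ is the closure of $\{t+V^{(k)}_{\mathrm{E}} : t\in\mathbb{Z}[\rho]\}$, with the shift action $T_t(U)=U-t$ of $\mathbb{Z}[\rho]$. For a subshift $\mathbb{X}$, $\mathrm{Aut}(\mathbb{X})$ is the group of all homeomorphisms of $\mathbb{X}$, $\mathcal{G}=\{T_t|_{\mathbb{X}} : t\in\mathbb{Z}[\rho]\}$,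 the symmetry group $\mathcal{S}$ is the centraliser and the extended symmetry group $\mathcal{R}$ the normaliser of $\mathcal{G}$ in $\mathrm{Aut}(\mathbb{X})$. $\mathcal{S}=\mathbb{Z}[\rho]$ means $\mathcal{S}=\mathcal{G}\simeq\mathbb{Z}[\rho]$. The group $D_6=C_6\rtimes C_2$ (dihedral of order $12$) consists of the maps $A(x)=\epsilon\,\sigma(x)$ of $\mathbb{Z}[\rho]$ with $\epsilon\in\mathbb{Z}[\rho]^{\times}=\{(-\rho)^m : 0\leqslant m\leqslant 5\}$ and $\sigma\in\{\mathrm{id},\overline{\,\cdot\,}\}$, acting on subsets by $U\mapsto A(U)$; the semi-direct product $\mathcal{S}\rtimes D_6$ is understood with respect to this action. *)

theory Defs
  imports "HOL-Analysis.Analysis" "HOL-Algebra.Algebra"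
begin

definition complex_ring :: "complex ring" where
  "complex_ring = \<lparr>carrier = UNIV, monoid.mult = (*), one = 1, ring.zero = 0, ring.add = (+)\<rparr>"

definition eis_rho :: complex where
  "eis_rho = exp (2 * of_real pi * \<i> / 3)"

definition eis_ints :: "complex set" where
  "eis_ints = {of_int a + of_int b * eis_rho | a b. True}"

definition eis_ring :: "complex ring" where
  "eis_ring = complex_ring\<lparr>carrier := eis_ints\<rparr>"

definition kfree_eis :: "nat \<Rightarrow> complex set" where
  "kfree_eis k = {x \<in> eis_ints.
     \<forall>p \<in> eis_ints. ring_prime\<^bsub>eis_ring\<^esub> p \<longrightarrow> \<not> (p [^]\<^bsub>eis_ring\<^esub> k) divides\<^bsub>eis_ring\<^esub> x}"

text \<open>Subsets of \<open>L\<close> are identified with their characteristic functions; the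
  topology on the power set of \<open>L\<close> is the one transported from \<open>{0,1}\<^sup>L\<close>.\<close>

definition config_topology :: "'a set \<Rightarrow> 'a set topology" where
  "config_topology L =
     pullback_topology (Pow L) (\<lambda>U. \<lambda>x\<in>L. x \<in> U)
       (product_topology (\<lambda>_. discrete_topology (UNIV :: bool set)) L)"

definition orbit_closure :: "'a::ab_group_add set \<Rightarrow> 'a set \<Rightarrow> 'a set topology" where
  "orbit_closure L V =
     subtopology (config_topology L) (config_topology L closure_of {(\<lambda>v. t + v) ` V | t. t \<in> L})"

definition shift_map :: "'a::ab_group_add set topology \<Rightarrow> 'a \<Rightarrow> 'a set \<Rightarrow> 'a set" where
  "shift_map Y t = (\<lambda>U\<in>topspace Y. (\<lambda>u. u - t) ` U)"

definition homeo_group :: "'a topology \<Rightarrow> ('a \<Rightarrow> 'a) monoid" where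
  "homeo_group Y =
     BijGroup (topspace Y)\<lparr>carrier := {f \<in> Bij (topspace Y). homeomorphic_map Y Y f}\<rparr>"

definition centraliser :: "('a, 'b) monoid_scheme \<Rightarrow> 'a set \<Rightarrow> 'a set" where
  "centraliser G H = {g \<in> carrier G. \<forall>h \<in> H. g \<otimes>\<^bsub>G\<^esub> h = h \<otimes>\<^bsub>G\<^esub> g}"

definition symmetries :: "'a::ab_group_add set \<Rightarrow> 'a set topology \<Rightarrow> ('a set \<Rightarrow> 'a set) set" where
  "symmetries L Y = centraliser (homeo_group Y) (shift_map Y ` L)"

definition extended_symmetries ::
    "'a::ab_group_add set \<Rightarrow> 'a set topology \<Rightarrow> ('a set \<Rightarrow> 'a set) set" where
  "extended_symmetries L Y = normalizer (homeo_group Y) (shift_map Y ` L)"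

definition symmetry_group ::
    "'a::ab_group_add set \<Rightarrow> 'a set topology \<Rightarrow> ('a set \<Rightarrow> 'a set) monoid" where
  "symmetry_group L Y = homeo_group Y\<lparr>carrier := symmetries L Y\<rparr>"

definition extended_symmetry_group ::
    "'a::ab_group_add set \<Rightarrow> 'a set topology \<Rightarrow> ('a set \<Rightarrow> 'a set) monoid" where
  "extended_symmetry_group L Y = homeo_group Y\<lparr>carrier := extended_symmetries L Y\<rparr>"

definition induced_map :: "'a set topology \<Rightarrow> ('a \<Rightarrow> 'a) \<Rightarrow> 'a set \<Rightarrow> 'a set" where
  "induced_map Y A = (\<lambda>U\<in>topspace Y. A ` U)"

definition eis_shift :: "nat \<Rightarrow> complex set topology" where
  "eis_shift k = orbit_closure eis_ints (kfree_eis k)"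

text \<open>\<open>G\<close> is the internal semidirect product of the normal subgroup \<open>N\<close> and the
  subgroup \<open>H\<close>, which acts on \<open>N\<close> by conjugation.\<close>

definition semidirect_product :: "('a, 'b) monoid_scheme \<Rightarrow> 'a set \<Rightarrow> 'a set \<Rightarrow> bool" where
  "semidirect_product G N H \<longleftrightarrow>
     N \<lhd> G \<and> subgroup H G \<and> N \<inter> H = {\<one>\<^bsub>G\<^esub>} \<and> N <#>\<^bsub>G\<^esub> H = carrier G"

definition unit_mult :: "complex \<Rightarrow> complex \<Rightarrow> complex" where
  "unit_mult e = (\<lambda>x \<in> eis_ints. e * x)"

definition C6 :: "(complex \<Rightarrow> complex) set" where
  "C6 = unit_mult ` Units eis_ring"

definition C2 :: "(complex \<Rightarrow> complex) set" where
  "C2 = {\<lambda>x \<in> eis_ints. x, \<lambda>x \<in> eis_ints. cnj x}"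

definition D6 :: "(complex \<Rightarrow> complex) set" where
  "D6 = {\<lambda>x \<in> eis_ints. e * s x | e s. e \<in> Units eis_ring \<and> s \<in> {id, cnj}}"

definition D6_group :: "(complex \<Rightarrow> complex) monoid" where
  "D6_group = BijGroup eis_ints\<lparr>carrier := D6\<rparr>"

definition regular_hexagon :: "complex set" where
  "regular_hexagon = convex hull {z. z ^ 6 = 1}"

definition isometry_group_of :: "'a::metric_space set \<Rightarrow> ('a \<Rightarrow> 'a) monoid" where
  "isometry_group_of P = BijGroup UNIV
     \<lparr>carrier := {f \<in> Bij UNIV. (\<forall>x y. dist (f x) (f y) = dist x y) \<and> f ` P = P}\<rparr>"

definition GL2Z :: "(int ^ 2 ^ 2) monoid" where
  "GL2Z = \<lparr>carrier = {A. invertible A}, monoid.mult = (**), one = mat 1\<rparr>"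

definition maximal_finite_subgroup :: "'a set \<Rightarrow> ('a, 'b) monoid_scheme \<Rightarrow> bool" where
  "maximal_finite_subgroup M G \<longleftrightarrow>
     subgroup M G \<and> finite M \<and> (\<forall>N. subgroup N G \<and> finite N \<and> M \<subseteq> N \<longrightarrow> N = M)"

definition Q_rho :: "complex ring" where
  "Q_rho = complex_ring\<lparr>carrier := generate_field complex_ring (\<rat> \<union> {eis_rho})\<rparr>"

definition ring_aut_group :: "('a, 'b) ring_scheme \<Rightarrow> ('a \<Rightarrow> 'a) monoid" where
  "ring_aut_group R =
     BijGroup (carrier R)\<lparr>carrier := {f \<in> Bij (carrier R). f \<in> ring_iso R R}\<rparr>"

end

theory Submission
  imports Defs
begin

text \<open>Write L for the Eisenstein integers, V for the k-free ones and X for the closure of the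
translates of V. Both groups are determined by one rigidity statement: a homeomorphism \<Phi>
of X with \<Phi>(U - t) = \<Phi>(U) - A t for an automorphism A of the group L has the form
\<Phi>(U) = A(U) + c, and A is z \<mapsto> e z or z \<mapsto> e cnj z for a unit e (lemma
\<open>equivariant_homeomorphism_affine\<close>). Elements of the centraliser are the case A = id;
an element of the normaliser determines such an A by its conjugation action on the translations.

Rigidity is read off from the finite members of X. Every member of X misses, for each prime
p, some residue class modulo p^k; call such sets admissible. A finite admissible set belongs
to X (\<open>finite_admissible_in_hull\<close>): the translation that is needed is prescribed
modulo finitely many prime powers by the Chinese remainder theorem, and the other primes can be
avoided at the same time because \<Sum> N(q)^-2 converges, as a count of lattice points in a
large square shows.

By continuity of \<Phi> at {0} and equivariance, s \<in> \<Phi>({0}) implies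
A t + s \<in> \<Phi>(T) whenever T \<in> X and the other points of T are far from t \<in> T.
So if T is sparse and admissible, then A(T) + s is contained in an admissible set. Sparseness
is no restriction on residues: a sparse T can represent any prescribed residue classes modulo one
number while being harmless modulo all other primes (\<open>covering_test_set\<close>). Three
choices of T give everything.

\<^item> Let p be a prime that does not divide its conjugate cnj p, and let T represent
  all classes modulo p^k (cnj p)^k except the multiples of p^k or of (cnj p)^k. As
  A(T) + s misses a class modulo p^k, the map A^-1 sends p^k L into p^k L or into
  (cnj p)^k L. With p outside the divisors of two numbers attached to A, this is only possible
  if A^-1, hence A, is complex linear or conjugate linear
  (\<open>endomorphism_linear_part\<close>).

\<^item> Let A = id. If \<Phi>({0}) had two elements s0, s1 and p does not divide
  s1 - s0, then a set T that represents all classes modulo p^k but one would have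
  T + {s0, s1} in an admissible set, although this sum meets all classes
  (\<open>image_of_singleton_unique\<close>).

\<^item> Let moreover \<Phi>({0}) = {0}. If some x \<in> \<Phi>(G) is not in the finite set
  G, enlarge G by a T that represents all classes modulo p^k except that of x; the image
  then contains x and T and meets all classes. So \<Phi>(G) \<subseteq> G
  (\<open>image_of_finite_subset\<close>), the same holds for \<Phi>^-1, and \<Phi> is the identity
  on finite sets, which are dense.

The statements about D6 are computations with the six units. That it is a maximal finite subgroup
of GL(2,Z) follows by averaging: a finite group that contains it preserves a positive
quadratic form, this form is invariant under multiplication by \<rho> and hence a multiple of the
norm, and the norm has no further automorphisms.\<close>

section \<open>Arithmetic of the Eisenstein integers\<close>

text \<open>Coordinates with respect to the basis 1, \<rho>. On a type of their own the Eisenstein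
integers form an integral domain, so that divisibility and prime elements are the type class notions
and carry no membership side conditions; \<open>to_complex\<close> below is the embedding into
\<complex>.\<close>

datatype eis = Eis (eis_fst: int) (eis_snd: int)

instantiation eis :: comm_ring_1
begin
definition "0 = Eis 0 0"
definition "1 = Eis 1 0"
fun plus_eis where "Eis a b + Eis c d = Eis (a + c) (b + d)"
fun minus_eis where "Eis a b - Eis c d = Eis (a - c) (b - d)"
fun uminus_eis where "- Eis a b = Eis (- a) (- b)"
fun times_eis where "Eis a b * Eis c d = Eis (a * c - b * d) (a * d + b * c - b * d)"
instance
proof
  fix x y z :: eis
  show "x + y + z = x + (y + z)" by (cases x; cases y; cases z) simp
  show "x + y = y + x" by (cases x; cases y) simp
  show "0 + x = x" by (cases x) (simp add: zero_eis_def)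
  show "- x + x = 0" by (cases x) (simp add: zero_eis_def)
  show "x - y = x + - y" by (cases x; cases y) simp
  show "x * y * z = x * (y * z)" by (cases x; cases y; cases z) (simp add: algebra_simps)
  show "x * y = y * x" by (cases x; cases y) (simp add: algebra_simps)
  show "1 * x = x" by (cases x) (simp add: one_eis_def)
  show "(x + y) * z = x * z + y * z" by (cases x; cases y; cases z) (simp add: algebra_simps)
  show "(0::eis) \<noteq> 1" by (simp add: zero_eis_def one_eis_def)
qed
end

fun eis_norm :: "eis \<Rightarrow> int" where "eis_norm (Eis a b) = a\<^sup>2 - a * b + b\<^sup>2"
fun eis_cnj :: "eis \<Rightarrow> eis" where "eis_cnj (Eis a b) = Eis (a - b) (- b)"

definition eis_omega :: eis where "eis_omega = Eis 0 1"

lemma eis_of_int: "of_int n = Eis n 0"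
proof -
  have nat: "of_nat m = Eis (int m) 0" for m
    by (induction m) (auto simp: zero_eis_def one_eis_def)
  show ?thesis
  proof (cases "n \<ge> 0")
    case True
    then show ?thesis using nat[of "nat n"] by (metis int_nat_eq of_int_of_nat_eq)
  next
    case False
    then have "of_int n = - (of_nat (nat (- n)) :: eis)" by (simp add: of_nat_nat)
    then show ?thesis using False by (simp add: nat)
  qed
qed

lemma eis_norm_mult: "eis_norm (x * y) = eis_norm x * eis_norm y"
  by (cases x; cases y) (simp add: algebra_simps power2_eq_square)

lemma eis_norm_cnj [simp]: "eis_norm (eis_cnj x) = eis_norm x"
  by (cases x) (simp add: algebra_simps power2_eq_square)

lemma eis_mult_cnj: "x * eis_cnj x = of_int (eis_norm x)"
  by (cases x) (simp add: eis_of_int algebra_simps power2_eq_square)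

lemma eis_cnj_cnj [simp]: "eis_cnj (eis_cnj x) = x" by (cases x) simp
lemma eis_cnj_add: "eis_cnj (x + y) = eis_cnj x + eis_cnj y" by (cases x; cases y) simp
lemma eis_cnj_diff: "eis_cnj (x - y) = eis_cnj x - eis_cnj y" by (cases x; cases y) simp
lemma eis_cnj_mult: "eis_cnj (x * y) = eis_cnj x * eis_cnj y"
  by (cases x; cases y) (simp add: algebra_simps)
lemma eis_cnj_0 [simp]: "eis_cnj 0 = 0" by (simp add: zero_eis_def)
lemma eis_cnj_1 [simp]: "eis_cnj 1 = 1" by (simp add: one_eis_def)

lemma eis_norm_four: "4 * eis_norm (Eis a b) = (2 * a - b)\<^sup>2 + 3 * b\<^sup>2"
  by (simp add: algebra_simps power2_eq_square)

lemma eis_norm_nonneg [simp]: "eis_norm x \<ge> 0"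
proof (cases x)
  case (Eis a b)
  have "0 \<le> 4 * eis_norm (Eis a b)" unfolding eis_norm_four by simp
  then show ?thesis using Eis by simp
qed

lemma eis_norm_eq_0 [simp]: "eis_norm x = 0 \<longleftrightarrow> x = 0"
proof (cases x)
  case (Eis a b)
  have "4 * eis_norm (Eis a b) = 0 \<longleftrightarrow> a = 0 \<and> b = 0"
    unfolding eis_norm_four by (auto simp: add_nonneg_eq_0_iff)
  then have "a\<^sup>2 - a * b + b\<^sup>2 = 0 \<longleftrightarrow> a = 0 \<and> b = 0" by simp linarith
  then show ?thesis using Eis by (simp add: zero_eis_def)
qed

lemma eis_norm_0 [simp]: "eis_norm 0 = 0" by simp
lemma eis_norm_1 [simp]: "eis_norm 1 = 1" by (simp add: one_eis_def)
lemma eis_norm_pos: "x \<noteq> 0 \<Longrightarrow> eis_norm x > 0"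
  using eis_norm_nonneg[of x] eis_norm_eq_0[of x] by linarith

instance eis :: idom
proof
  fix x y :: eis assume "x \<noteq> 0" "y \<noteq> 0"
  then have "eis_norm (x * y) \<noteq> 0" by (simp add: eis_norm_mult)
  then show "x * y \<noteq> 0" by auto
qed

instance eis :: ring_char_0
proof
  show "inj (of_nat :: nat \<Rightarrow> eis)"
    by (rule injI) (metis eis.inject eis_of_int of_int_of_nat_eq of_nat_eq_iff)
qed

lemma eis_norm_dvd: "x dvd y \<Longrightarrow> eis_norm x dvd eis_norm y"
  by (auto simp: eis_norm_mult elim!: dvdE)

lemma eis_norm_power: "eis_norm (x ^ n) = eis_norm x ^ n"
  by (induction n) (simp_all add: eis_norm_mult)

lemma dvd_eis_norm: "x dvd of_int (eis_norm x)"
  by (metis dvd_triv_left eis_mult_cnj)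

lemma eis_unit_iff: "x dvd 1 \<longleftrightarrow> eis_norm x = 1"
proof
  assume "x dvd 1"
  then have "eis_norm x dvd 1" using eis_norm_dvd[of x 1] by simp
  then show "eis_norm x = 1" using eis_norm_nonneg[of x] by auto
next
  assume "eis_norm x = 1"
  then show "x dvd 1" using dvd_eis_norm[of x] by simp
qed

lemma eis_cnj_dvd: "eis_cnj x dvd eis_cnj y \<longleftrightarrow> x dvd y"
  by (metis dvd_def eis_cnj_cnj eis_cnj_mult)

lemma eis_cnj_power: "eis_cnj (x ^ n) = eis_cnj x ^ n"
  by (induction n) (simp_all add: eis_cnj_mult)

lemma round_division:
  fixes c n :: int assumes "n > 0"
  obtains q where "2 * \<bar>c - q * n\<bar> \<le> n"
proof
  define q where "q = (2 * c + n) div (2 * n)"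
  have "(2 * c + n) mod (2 * n) < 2 * n" "(2 * c + n) mod (2 * n) \<ge> 0" using assms by simp_all
  moreover have "(2 * c + n) = q * (2 * n) + (2 * c + n) mod (2 * n)" unfolding q_def by (rule div_mult_mod_eq[symmetric])
  ultimately have "2 * (c - q * n) < n" "2 * (c - q * n) \<ge> - n" by (simp_all add: algebra_simps)
  then show "2 * \<bar>c - q * n\<bar> \<le> n" by linarith
qed

text \<open>Round the coordinates of x / y to nearest integers: the error has coordinates of
absolute value at most 1/2, hence norm at most 3/4.\<close>

lemma eis_division:
  assumes "y \<noteq> 0"
  obtains q where "eis_norm (x - q * y) < eis_norm y"
proof -
  let ?n = "eis_norm y"
  have n: "?n > 0" using assms eis_norm_pos by blast
  obtain c d where cd: "x * eis_cnj y = Eis c d" by (cases "x * eis_cnj y")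
  obtain q1 where q1: "2 * \<bar>c - q1 * ?n\<bar> \<le> ?n" using round_division[OF n] .
  obtain q2 where q2: "2 * \<bar>d - q2 * ?n\<bar> \<le> ?n" using round_division[OF n] .
  define r s where "r = c - q1 * ?n" and "s = d - q2 * ?n"
  have "(x - Eis q1 q2 * y) * eis_cnj y = x * eis_cnj y - Eis q1 q2 * of_int ?n"
    unfolding eis_mult_cnj[symmetric] by (simp add: algebra_simps)
  also have "\<dots> = Eis r s"
    by (simp add: cd eis_of_int r_def s_def)
  finally have "eis_norm (x - Eis q1 q2 * y) * ?n = r\<^sup>2 - r * s + s\<^sup>2"
    by (metis eis_norm.simps eis_norm_cnj eis_norm_mult)
  moreover have "4 * (r\<^sup>2 - r * s + s\<^sup>2) \<le> 3 * ?n\<^sup>2"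
  proof -
    have r: "2 * \<bar>r\<bar> \<le> ?n" and s: "2 * \<bar>s\<bar> \<le> ?n" using q1 q2 by (simp_all add: r_def s_def)
    have "(2 * \<bar>r\<bar>) * (2 * \<bar>r\<bar>) \<le> ?n * ?n" by (intro mult_mono) (use r s n in auto)
    moreover have "(2 * \<bar>s\<bar>) * (2 * \<bar>s\<bar>) \<le> ?n * ?n" by (intro mult_mono) (use r s n in auto)
    moreover have "(2 * \<bar>r\<bar>) * (2 * \<bar>s\<bar>) \<le> ?n * ?n" by (intro mult_mono) (use r s n in auto)
    moreover have "- (r * s) \<le> \<bar>r\<bar> * \<bar>s\<bar>" by (simp flip: abs_mult)
    ultimately show ?thesis by (simp add: power2_eq_square abs_mult_self_eq)
  qed
  ultimately have "4 * eis_norm (x - Eis q1 q2 * y) * ?n \<le> (3 * ?n) * ?n"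
    by (simp add: power2_eq_square algebra_simps)
  then have "4 * eis_norm (x - Eis q1 q2 * y) \<le> 3 * ?n"
    using n by (meson mult_le_cancel_right_pos)
  then have "eis_norm (x - Eis q1 q2 * y) < ?n" using n by linarith
  then show ?thesis by (rule that)
qed

lemma eis_bezout: "\<exists>d u v. d = u * x + v * y \<and> d dvd x \<and> d dvd (y :: eis)"
proof (induction "nat (eis_norm y)" arbitrary: x y rule: less_induct)
  case less
  show ?case
  proof (cases "y = 0")
    case True
    then have "x = 1 * x + 0 * y \<and> x dvd x \<and> x dvd y" by simp
    then show ?thesis by blast
  next
    case False
    obtain q where q: "eis_norm (x - q * y) < eis_norm y" using eis_division[OF False] .
    then have "nat (eis_norm (x - q * y)) < nat (eis_norm y)"
      by (simp add: eis_norm_pos[OF False])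
    from less[OF this, of y] obtain d u v
      where d: "d = u * y + v * (x - q * y)" "d dvd y" "d dvd x - q * y" by blast
    have "d dvd (x - q * y) + q * y" using d(2,3) by (intro dvd_add) auto
    then have "d dvd x" by simp
    moreover have "d = v * x + (u - v * q) * y" using d(1) by (simp add: algebra_simps)
    ultimately show ?thesis using d(2) by blast
  qed
qed

text \<open>Coprimality in Bezout form. This is what the Chinese remainder theorem consumes, and for
an element of a Euclidean ring it is equivalent to having no common divisor other than units.\<close>

definition comaximal :: "eis \<Rightarrow> eis \<Rightarrow> bool" where
  "comaximal x y \<longleftrightarrow> (\<exists>u v. u * x + v * y = 1)"

lemma comaximal_sym: "comaximal x y \<Longrightarrow> comaximal y x"
  unfolding comaximal_def by (metis add.commute)

lemma comaximal_mult:
  assumes "comaximal x z" "comaximal y z"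
  shows "comaximal (x * y) z"
proof -
  obtain a b c d where "a * x + b * z = 1" "c * y + d * z = 1"
    using assms unfolding comaximal_def by blast
  then have "(a * x + b * z) * (c * y + d * z) = 1" by simp
  then have "(a * c) * (x * y) + (a * x * d + b * c * y + b * d * z) * z = 1"
    by (simp add: algebra_simps)
  then show ?thesis unfolding comaximal_def by blast
qed

lemma comaximal_power: "comaximal x z \<Longrightarrow> comaximal (x ^ n) z"
proof (induction n)
  case 0
  show ?case unfolding comaximal_def by (rule exI[of _ 1], rule exI[of _ 0]) simp
qed (simp add: comaximal_mult)

lemma common_divisor_or_comaximal:
  obtains "comaximal x y" | d where "\<not> d dvd 1" "d dvd x" "d dvd y"
proof -
  obtain d u v where d: "d = u * x + v * y" "d dvd x" "d dvd y"
    using eis_bezout by blast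
  show ?thesis
  proof (cases "d dvd 1")
    case True
    then obtain e where "1 = d * e" by blast
    then have "(e * u) * x + (e * v) * y = 1" using d(1) by (simp add: algebra_simps)
    then show ?thesis using that(1) unfolding comaximal_def by blast
  qed (use that d in blast)
qed

lemma prime_comaximal:
  assumes "prime_elem (p :: eis)" "\<not> p dvd x"
  shows "comaximal p x"
proof (rule common_divisor_or_comaximal[of p x])
  fix d assume d: "\<not> d dvd 1" "d dvd p" "d dvd x"
  then obtain e where e: "p = d * e" by blast
  then have "p dvd d \<or> p dvd e" using assms(1) by (metis dvd_refl prime_elem_dvd_multD)
  then have "p dvd e" using d(3) assms(2) dvd_trans by blast
  then obtain f where "e = p * f" by blast
  then have "p * 1 = p * (d * f)" using e by (simp add: algebra_simps)
  moreover have "p \<noteq> 0" using assms(1) by auto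
  ultimately have "1 = d * f" by (metis mult_cancel_left)
  then have "d dvd 1" by (rule dvdI)
  then show ?thesis using d(1) by blast
qed

lemma chinese_remainder:
  assumes "comaximal x y"
  obtains t where "x dvd t - a" "y dvd t - b"
proof -
  obtain u v where uv: "u * x + v * y = 1" using assms unfolding comaximal_def by blast
  show ?thesis
  proof
    have "(b * u * x + a * v * y) - a = b * u * x + a * v * y - a * (u * x + v * y)" by (simp add: uv)
    also have "\<dots> = x * (b * u - a * u)" by (simp add: algebra_simps)
    finally show "x dvd (b * u * x + a * v * y) - a" by simp
    have "(b * u * x + a * v * y) - b = b * u * x + a * v * y - b * (u * x + v * y)" by (simp add: uv)
    also have "\<dots> = y * (a * v - b * v)" by (simp add: algebra_simps)
    finally show "y dvd (b * u * x + a * v * y) - b" by simp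
  qed
qed

lemma comaximal_dvd_mult:
  assumes "comaximal x y" "x dvd y * z"
  shows "x dvd z"
proof -
  obtain u v where uv: "u * x + v * y = 1" using assms unfolding comaximal_def by blast
  have "x dvd (u * z) * x + v * (y * z)" using assms(2) by (intro dvd_add) auto
  also have "(u * z) * x + v * (y * z) = (u * x + v * y) * z" by (simp add: algebra_simps)
  finally show ?thesis by (simp add: uv)
qed

lemma prime_power_dvd_mult:
  assumes "prime_elem (p :: eis)" "\<not> p dvd x" "p ^ n dvd x * z"
  shows "p ^ n dvd z"
  using comaximal_dvd_mult[OF comaximal_power[OF prime_comaximal]] assms by blast

text \<open>A non-unit divisor of least norm is irreducible, and irreducible elements
are prime by the Bezout identity.\<close>

lemma prime_divisor_exists:
  assumes "\<not> x dvd 1" "x \<noteq> 0"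
  obtains p where "prime_elem p" "p dvd (x :: eis)"
proof -
  have "\<exists>p. prime_elem p \<and> p dvd x" using assms
  proof (induction "nat (eis_norm x)" arbitrary: x rule: less_induct)
    case less
    show ?case
    proof (cases "\<exists>d. d dvd x \<and> \<not> d dvd 1 \<and> eis_norm d < eis_norm x")
      case True
      then obtain d where d: "d dvd x" "\<not> d dvd 1" "eis_norm d < eis_norm x" by blast
      moreover have "d \<noteq> 0" using d less.prems by auto
      moreover have "nat (eis_norm d) < nat (eis_norm x)"
        using d(3) eis_norm_pos[OF less.prems(2)] by simp
      ultimately obtain p where "prime_elem p" "p dvd d" using less.hyps[of d] d(2) by blast
      then show ?thesis using d(1) dvd_trans by blast
    next
      case False
      have "prime_elem x"
      proof (rule prime_elemI[OF less.prems(2) less.prems(1)])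
        fix a b assume ab: "x dvd a * b"
        show "x dvd a \<or> x dvd b"
        proof (rule common_divisor_or_comaximal[of x a])
          assume "comaximal x a" then show ?thesis using ab comaximal_dvd_mult by blast
        next
          fix d assume d: "\<not> d dvd 1" "d dvd x" "d dvd a"
          then obtain e where e: "x = d * e" by blast
          have "eis_norm d \<ge> eis_norm x" using False d by force
          moreover have "e \<noteq> 0" "d \<noteq> 0" using e less.prems by auto
          then have "eis_norm e > 0" "eis_norm d > 0" using eis_norm_pos by auto
          ultimately have "eis_norm d * eis_norm e \<le> eis_norm d * 1" by (simp add: e eis_norm_mult)
          then have "eis_norm e = 1" using \<open>eis_norm e > 0\<close> \<open>eis_norm d > 0\<close> by simp
          then obtain e' where "1 = e * e'" using eis_unit_iff by blast
          then have "d = x * e'" unfolding e by (metis mult.assoc mult.right_neutral)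
          then have "x dvd d" by (rule dvdI)
          then show ?thesis using d dvd_trans by blast
        qed
      qed
      then show ?thesis by (intro exI[of _ x]) simp
    qed
  qed
  then show ?thesis using that by blast
qed

lemma of_int_unit_eis: "(of_int n :: eis) dvd 1 \<longleftrightarrow> \<bar>n\<bar> = 1"
proof -
  have "eis_norm (of_int n) = n\<^sup>2" by (simp add: eis_of_int)
  then show ?thesis by (auto simp: eis_unit_iff power2_eq_1_iff abs_if)
qed

text \<open>Euclid's argument: a prime divisor of 1 + 2 N(x) cannot divide x.\<close>

lemma prime_avoiding:
  assumes "x \<noteq> 0"
  obtains p where "prime_elem p" "\<not> p dvd (x :: eis)"
proof -
  have n: "eis_norm x > 0" using eis_norm_pos assms by blast
  let ?m = "1 + 2 * eis_norm x"
  have "\<not> (of_int ?m :: eis) dvd 1" unfolding of_int_unit_eis using n by linarith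
  moreover have "(of_int ?m :: eis) \<noteq> 0" unfolding of_int_eq_0_iff using n by linarith
  ultimately obtain p where p: "prime_elem p" "p dvd (of_int ?m :: eis)"
    using prime_divisor_exists by blast
  have "\<not> p dvd x"
  proof
    assume "p dvd x"
    then have "p dvd of_int (eis_norm x)" using dvd_eis_norm dvd_trans by blast
    then have "p dvd of_int (eis_norm x) * 2" by simp
    then have "p dvd of_int ?m - of_int (eis_norm x) * 2" using p(2) dvd_diff by blast
    also have "of_int ?m - of_int (eis_norm x) * 2 = (1 :: eis)" by simp
    finally show False using p(1) by (simp add: prime_elem_def)
  qed
  then show ?thesis using p that by blast
qed

text \<open>A prime divisor p of 1 - n \<rho> does not divide n. If it divided
cnj p, it would divide (1 - n\<rho>) - cnj (1 - n \<rho>) = -n (\<rho> - cnj \<rho>) and thus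
3 n, a divisor of n^2 when n is a multiple of 6.\<close>

lemma split_prime_avoiding:
  assumes "x \<noteq> 0"
  obtains p where "prime_elem p" "\<not> p dvd (x :: eis)" "\<not> p dvd eis_cnj p" "\<not> p dvd 2"
proof -
  define n where "n = 6 * eis_norm x"
  have n: "n > 0" using eis_norm_pos[OF assms] by (simp add: n_def)
  let ?y = "Eis 1 (- n)"
  have "n + n\<^sup>2 > 0" using n by (simp add: add_pos_pos)
  then have "eis_norm ?y \<noteq> 1" by simp
  moreover have "?y \<noteq> 0" by (simp add: zero_eis_def)
  ultimately obtain p where p: "prime_elem p" "p dvd ?y"
    using prime_divisor_exists eis_unit_iff by metis
  have pn: "\<not> p dvd of_int n"
  proof
    assume "p dvd of_int n"
    then have "p dvd ?y + of_int n * eis_omega" using p(2) by (intro dvd_add) auto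
    also have "?y + of_int n * eis_omega = 1" by (simp add: eis_of_int eis_omega_def one_eis_def)
    finally show False using p(1) by (simp add: prime_elem_def)
  qed
  show ?thesis
  proof
    show "prime_elem p" by fact
    show "\<not> p dvd x"
    proof
      assume "p dvd x"
      then have "p dvd of_int (eis_norm x)" using dvd_eis_norm dvd_trans by blast
      then show False using pn by (simp add: n_def)
    qed
    show "\<not> p dvd 2"
    proof
      assume "p dvd 2"
      then have "p dvd 2 * (3 * of_int (eis_norm x))" by (rule dvd_mult2)
      then show False using pn by (simp add: n_def mult.assoc[symmetric])
    qed
    show "\<not> p dvd eis_cnj p"
    proof
      assume "p dvd eis_cnj p"
      moreover have "eis_cnj p dvd eis_cnj ?y" using p(2) by (simp only: eis_cnj_dvd)
      ultimately have "p dvd ?y - eis_cnj ?y" using p(2) dvd_trans dvd_diff by blast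
      then have "p dvd (?y - eis_cnj ?y) * (eis_omega - eis_cnj eis_omega) * of_int (2 * eis_norm x)"
        using dvd_mult2 by blast
      also have "(?y - eis_cnj ?y) * (eis_omega - eis_cnj eis_omega) = of_int (3 * n)"
        by (simp add: eis_omega_def eis_of_int)
      also have "of_int (3 * n) * of_int (2 * eis_norm x) = (of_int (n * n) :: eis)"
        unfolding n_def of_int_mult[symmetric] by simp
      finally show False using pn p(1) by (simp add: prime_elem_dvd_mult_iff)
    qed
  qed
qed

text \<open>Removing from x all factors in common with w leaves a number that is comaximal with
w and still contains the full power of every prime that does not divide w.\<close>

lemma coprime_part:
  assumes "x \<noteq> 0"
  obtains M where "M \<noteq> 0" "comaximal M w"
    "\<And>q j. prime_elem q \<Longrightarrow> \<not> q dvd w \<Longrightarrow> q ^ j dvd x \<Longrightarrow> q ^ j dvd (M :: eis)"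
proof -
  have "\<exists>M. M \<noteq> 0 \<and> comaximal M w \<and> (\<forall>q j. prime_elem q \<longrightarrow> \<not> q dvd w \<longrightarrow> q ^ j dvd x \<longrightarrow> q ^ j dvd M)"
    using assms
  proof (induction "nat (eis_norm x)" arbitrary: x rule: less_induct)
    case less
    show ?case
    proof (rule common_divisor_or_comaximal[of x w])
      assume "comaximal x w" then show ?thesis using less.prems by blast
    next
      fix d assume d: "\<not> d dvd 1" "d dvd x" "d dvd w"
      then obtain e where e: "x = d * e" by blast
      have "e \<noteq> 0" "d \<noteq> 0" using e less.prems by auto
      then have "eis_norm e > 0" "eis_norm d > 0" using eis_norm_pos by auto
      moreover have "eis_norm d \<noteq> 1" using d(1) eis_unit_iff by blast
      ultimately have "eis_norm e < eis_norm x" unfolding e eis_norm_mult by auto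
      then obtain M where M: "M \<noteq> 0" "comaximal M w"
        "\<forall>q j. prime_elem q \<longrightarrow> \<not> q dvd w \<longrightarrow> q ^ j dvd e \<longrightarrow> q ^ j dvd M"
        using less.hyps[of e] \<open>e \<noteq> 0\<close> eis_norm_pos[OF less.prems] by auto
      have "q ^ j dvd M" if "prime_elem q" "\<not> q dvd w" "q ^ j dvd x" for q j
      proof -
        have "\<not> q dvd d" using that(2) d(3) dvd_trans by blast
        then have "q ^ j dvd e" using prime_power_dvd_mult that e by blast
        then show ?thesis using M(3) that by blast
      qed
      then show ?thesis using M by blast
    qed
  qed
  then show ?thesis using that by blast
qed

section \<open>Finite admissible sets and a sieve\<close>

definition kfree :: "nat \<Rightarrow> eis set" where
  "kfree k = {x. \<forall>p. prime_elem p \<longrightarrow> \<not> p ^ k dvd x}"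

definition admissible :: "nat \<Rightarrow> eis set \<Rightarrow> bool" where
  "admissible k U \<longleftrightarrow> (\<forall>p. prime_elem p \<longrightarrow> (\<exists>c. \<forall>u\<in>U. \<not> p ^ k dvd u - c))"

text \<open>The closure of the translates of \<open>kfree k\<close> in the product topology, in terms
of finite windows.\<close>

definition hull_of_kfree :: "nat \<Rightarrow> eis set set" where
  "hull_of_kfree k = {U. \<forall>B. finite B \<longrightarrow> (\<exists>t. \<forall>b\<in>B. b \<in> U \<longleftrightarrow> b - t \<in> kfree k)}"

definition eis_box :: "int \<Rightarrow> eis set" where
  "eis_box R = (\<lambda>(a, b). Eis a b) ` ({0..<R} \<times> {0..<R})"

lemma finite_eis_box [simp]: "finite (eis_box R)" by (simp add: eis_box_def)

lemma card_eis_box: "R \<ge> 0 \<Longrightarrow> int (card (eis_box R)) = R\<^sup>2"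
  unfolding eis_box_def
  by (subst card_image) (auto simp: inj_on_def power2_eq_square)

lemma eis_norm_lt_of_coords:
  assumes "\<bar>real_of_int a\<bar> < h" "\<bar>real_of_int b\<bar> < h"
  shows "real_of_int (eis_norm (Eis a b)) < 3 * h\<^sup>2"
proof -
  have "\<bar>real_of_int a\<bar> * \<bar>real_of_int a\<bar> < h * h" "\<bar>real_of_int b\<bar> * \<bar>real_of_int b\<bar> < h * h"
    "\<bar>real_of_int a\<bar> * \<bar>real_of_int b\<bar> < h * h"
    by (intro mult_strict_mono'; use assms in auto)+
  moreover have "- (real_of_int a * real_of_int b) \<le> \<bar>real_of_int a\<bar> * \<bar>real_of_int b\<bar>"
    by (simp flip: abs_mult)
  ultimately show ?thesis by (simp add: power2_eq_square abs_mult_self_eq)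
qed

lemma floor_eq_imp_close:
  assumes "\<lfloor>x / h\<rfloor> = \<lfloor>y / h\<rfloor>" "h > 0"
  shows "\<bar>x - y\<bar> < (h::real)"
proof -
  have "\<bar>x / h - y / h\<bar> < 1" using assms(1) by linarith
  then have "\<bar>(x - y) / h\<bar> < 1" by (simp add: diff_divide_distrib)
  then show ?thesis using assms(2) by (simp add: abs_divide)
qed

text \<open>Cut the square into cells of side sqrt (N(w))/2. Two points in one cell
differ by an element of norm less than N(w), so each cell contains at most one point of a residue
class modulo w.\<close>

lemma card_congruent_in_box:
  assumes "w \<noteq> 0" "S \<subseteq> eis_box R" "\<And>x y. x \<in> S \<Longrightarrow> y \<in> S \<Longrightarrow> w dvd x - y" "R \<ge> 0"
  shows "real (card S) \<le> 8 * real_of_int R ^ 2 / real_of_int (eis_norm w) + 2"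
proof -
  let ?n = "real_of_int (eis_norm w)"
  have n: "?n > 0" using eis_norm_pos[OF assms(1)] by simp
  define h where "h = sqrt ?n / 2"
  have h: "h > 0" "4 * h\<^sup>2 = ?n" using n by (simp_all add: h_def power_divide)
  define m where "m = \<lfloor>real_of_int R / h\<rfloor>"
  have m0: "m \<ge> 0" using assms(4) h by (simp add: m_def)
  define f where "f x = (\<lfloor>real_of_int (eis_fst x) / h\<rfloor>, \<lfloor>real_of_int (eis_snd x) / h\<rfloor>)" for x
  have "inj_on f S"
  proof (rule inj_onI)
    fix x y assume xy: "x \<in> S" "y \<in> S" "f x = f y"
    obtain a b c d where x: "x = Eis a b" and y: "y = Eis c d" by (cases x; cases y)
    have "\<bar>real_of_int a - real_of_int c\<bar> < h" "\<bar>real_of_int b - real_of_int d\<bar> < h"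
      using xy(3) h(1) by (auto simp: f_def x y intro!: floor_eq_imp_close)
    then have "real_of_int (eis_norm (x - y)) < 3 * h\<^sup>2"
      unfolding x y minus_eis.simps by (intro eis_norm_lt_of_coords) auto
    then have "real_of_int (eis_norm (x - y)) < ?n" using h by (smt (verit) zero_less_power2)
    then have lt: "eis_norm (x - y) < eis_norm w" by simp
    have "eis_norm w dvd eis_norm (x - y)" using assms(3) xy eis_norm_dvd by blast
    then have "eis_norm (x - y) = 0"
      using lt by (metis eis_norm_nonneg linorder_not_less zdvd_imp_le nless_le)
    then show "x = y" by simp
  qed
  moreover have "f ` S \<subseteq> {0..m} \<times> {0..m}"
  proof (rule image_subsetI)
    fix x assume "x \<in> S"
    then obtain a b where x: "x = Eis a b" "0 \<le> a" "a < R" "0 \<le> b" "b < R"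
      using assms(2) by (auto simp: eis_box_def)
    then show "f x \<in> {0..m} \<times> {0..m}"
      using h by (auto simp: f_def m_def intro!: floor_mono divide_right_mono)
  qed
  ultimately have "card S \<le> card ({0..m} \<times> {0..m})"
    by (metis card_inj_on_le finite_SigmaI finite_atLeastAtMost_int)
  also have "\<dots> = nat (m + 1) * nat (m + 1)" by (simp add: card_cartesian_product)
  finally have "real (card S) \<le> real (nat (m + 1) * nat (m + 1))" by linarith
  also have "\<dots> = (real_of_int m + 1)\<^sup>2" using m0 by (simp add: power2_eq_square)
  also have "\<dots> \<le> 2 * (real_of_int m)\<^sup>2 + 2"
    using sum_squares_bound[of "real_of_int m" 1] by (simp add: power2_eq_square algebra_simps)
  also have "(real_of_int m)\<^sup>2 \<le> (real_of_int R / h)\<^sup>2"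
    using m0 by (intro power_mono) (auto simp: m_def)
  also have "(real_of_int R / h)\<^sup>2 = 4 * (real_of_int R)\<^sup>2 / ?n"
    unfolding h(2)[symmetric] by (simp add: power_divide)
  finally show ?thesis by simp
qed

lemma sum_inverse_squares_nat: "(\<Sum>i\<le>n. 1 / (1 + real i)\<^sup>2) \<le> 2 - 1 / (real n + 1)"
proof (induction n)
  case (Suc n)
  have "1 / (real n + 2)\<^sup>2 \<le> 1 / (real n + 1) - 1 / (real n + 2)"
  proof -
    have "1 / (real n + 1) - 1 / (real n + 2) = 1 / ((real n + 1) * (real n + 2))"
      by (simp add: field_simps)
    moreover have "1 / (real n + 2)\<^sup>2 \<le> 1 / ((real n + 1) * (real n + 2))"
      unfolding power2_eq_square by (intro divide_left_mono mult_right_mono) auto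
    ultimately show ?thesis by linarith
  qed
  then show ?case using Suc by (simp add: algebra_simps)
qed simp

lemma sum_inverse_squares_int:
  assumes "finite A"
  shows "(\<Sum>a\<in>A. 1 / (1 + \<bar>real_of_int a\<bar>)\<^sup>2) \<le> 4"
proof -
  obtain n where n: "\<And>a. a \<in> A \<Longrightarrow> nat \<bar>a\<bar> \<le> n"
    using assms finite_nat_set_iff_bounded_le[of "(\<lambda>a. nat \<bar>a\<bar>) ` A"] by auto
  let ?g = "\<lambda>a. 1 / (1 + \<bar>real_of_int a\<bar>)\<^sup>2"
  have sub: "A \<subseteq> int ` {..n} \<union> (\<lambda>i. - int i) ` {..n}"
  proof
    fix a assume "a \<in> A"
    then have "nat \<bar>a\<bar> \<in> {..n}" using n by simp
    moreover have "a = int (nat \<bar>a\<bar>) \<or> a = - int (nat \<bar>a\<bar>)" by linarith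
    ultimately show "a \<in> int ` {..n} \<union> (\<lambda>i. - int i) ` {..n}" by blast
  qed
  have "sum ?g A \<le> sum ?g (int ` {..n} \<union> (\<lambda>i. - int i) ` {..n})"
    by (rule sum_mono2) (use sub in auto)
  also have "\<dots> \<le> sum ?g (int ` {..n}) + sum ?g ((\<lambda>i. - int i) ` {..n})"
    by (subst sum.union_inter[symmetric]) (auto intro!: sum_nonneg)
  also have "sum ?g (int ` {..n}) = (\<Sum>i\<le>n. 1 / (1 + real i)\<^sup>2)"
    by (subst sum.reindex) auto
  also have "sum ?g ((\<lambda>i. - int i) ` {..n}) = (\<Sum>i\<le>n. 1 / (1 + real i)\<^sup>2)"
    by (subst sum.reindex) (auto simp: inj_on_def)
  finally show ?thesis using sum_inverse_squares_nat[of n]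
    by (smt (verit) divide_nonneg_nonneg of_nat_0_le_iff)
qed

lemma eis_norm_ge_product:
  assumes "Eis a b \<noteq> 0"
  shows "(1 + \<bar>a\<bar>) * (1 + \<bar>b\<bar>) \<le> 6 * eis_norm (Eis a b)"
proof -
  have 1: "\<bar>a\<bar> * \<bar>b\<bar> + \<bar>a\<bar> + \<bar>b\<bar> \<le> 5 * eis_norm (Eis a b)"
  proof -
    have "2 * eis_norm (Eis a b) = a\<^sup>2 + b\<^sup>2 + (a - b)\<^sup>2" by (simp add: power2_eq_square algebra_simps)
    then have s: "a\<^sup>2 + b\<^sup>2 \<le> 2 * eis_norm (Eis a b)" by (smt (verit) zero_le_power2)
    have "0 \<le> (\<bar>a\<bar> - \<bar>b\<bar>)\<^sup>2" by simp
    then have "2 * (\<bar>a\<bar> * \<bar>b\<bar>) \<le> a\<^sup>2 + b\<^sup>2" by (simp add: power2_diff mult.assoc)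
    moreover have "\<bar>a\<bar> \<le> a\<^sup>2" "\<bar>b\<bar> \<le> b\<^sup>2"
      by (metis abs_ge_zero int_one_le_iff_zero_less mult_left_mono mult.right_neutral
          not_less_iff_gr_or_eq order_le_less power2_abs power2_eq_square abs_zero power_zero_numeral)+
    ultimately show ?thesis using s eis_norm_nonneg[of "Eis a b"] by linarith
  qed
  have "eis_norm (Eis a b) \<ge> 1" using eis_norm_pos[OF assms] by linarith
  then show ?thesis using 1 by (simp add: algebra_simps)
qed

text \<open>By \<open>eis_norm_ge_product\<close> the sum is dominated by a product of
two one-dimensional sums. Boundedness of the partial sums is
what the tail estimate \<open>inverse_norm_squares_tail\<close> rests on.\<close>

lemma sum_inverse_norm_squares:
  assumes "finite W"
  shows "(\<Sum>w\<in>W. 1 / (real_of_int (eis_norm w))\<^sup>2) \<le> 576"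
proof -
  let ?g = "\<lambda>a::int. 1 / (1 + \<bar>real_of_int a\<bar>)\<^sup>2"
  define P where "P = (\<lambda>w. (eis_fst w, eis_snd w)) ` W"
  have fin: "finite (fst ` P)" "finite (snd ` P)" using assms by (auto simp: P_def)
  have "1 / (real_of_int (eis_norm w))\<^sup>2 \<le> 36 * (?g (eis_fst w) * ?g (eis_snd w))" for w
  proof (cases "w = 0")
    case False
    obtain a b where w: "w = Eis a b" by (cases w)
    have "real_of_int ((1 + \<bar>a\<bar>) * (1 + \<bar>b\<bar>)) \<le> real_of_int (6 * eis_norm w)"
      using eis_norm_ge_product[of a b] False unfolding w of_int_le_iff by blast
    then have "((1 + \<bar>real_of_int a\<bar>) * (1 + \<bar>real_of_int b\<bar>))\<^sup>2 \<le> (6 * real_of_int (eis_norm w))\<^sup>2"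
      by (intro power_mono) auto
    moreover have "((1 + \<bar>real_of_int a\<bar>) * (1 + \<bar>real_of_int b\<bar>))\<^sup>2 > 0"
      by (intro zero_less_power mult_pos_pos) auto
    ultimately have "1 / (6 * real_of_int (eis_norm w))\<^sup>2 \<le> 1 / ((1 + \<bar>real_of_int a\<bar>) * (1 + \<bar>real_of_int b\<bar>))\<^sup>2"
      using \<open>w \<noteq> 0\<close> by (intro divide_left_mono mult_pos_pos) auto
    moreover have "1 / (6 * real_of_int (eis_norm w))\<^sup>2 = (1 / (real_of_int (eis_norm w))\<^sup>2) / 36"
      by (simp only: power_mult_distrib) simp
    moreover have "?g a * ?g b = 1 / ((1 + \<bar>real_of_int a\<bar>) * (1 + \<bar>real_of_int b\<bar>))\<^sup>2"
      by (simp only: power_mult_distrib) simp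
    moreover have "eis_fst w = a" "eis_snd w = b" by (simp_all add: w)
    moreover have "x \<le> 36 * y" if "x / 36 \<le> y" for x y :: real using that by simp
    ultimately show ?thesis by (simp only:)
  qed simp
  then have "(\<Sum>w\<in>W. 1 / (real_of_int (eis_norm w))\<^sup>2) \<le> (\<Sum>w\<in>W. 36 * (?g (eis_fst w) * ?g (eis_snd w)))"
    by (rule sum_mono)
  also have "\<dots> = 36 * (\<Sum>w\<in>W. ?g (eis_fst w) * ?g (eis_snd w))" by (simp only: sum_distrib_left)
  also have "(\<Sum>w\<in>W. ?g (eis_fst w) * ?g (eis_snd w)) = (\<Sum>(a, b)\<in>P. ?g a * ?g b)"
    unfolding P_def by (subst sum.reindex) (auto simp: inj_on_def eis.expand)
  also have "\<dots> \<le> (\<Sum>(a, b)\<in>fst ` P \<times> snd ` P. ?g a * ?g b)"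
  proof (rule sum_mono2)
    show "finite (fst ` P \<times> snd ` P)" using fin by blast
    show "P \<subseteq> fst ` P \<times> snd ` P" by (rule subset_fst_snd)
    show "0 \<le> (case x of (a, b) \<Rightarrow> ?g a * ?g b)" for x by (cases x) simp
  qed
  also have "\<dots> = sum ?g (fst ` P) * sum ?g (snd ` P)"
    by (simp only: sum_product sum.cartesian_product)
  also have "\<dots> \<le> 4 * 4"
    by (intro mult_mono sum_inverse_squares_int fin sum_nonneg) auto
  finally show ?thesis by simp
qed

lemma inverse_norm_squares_tail:
  assumes "e > 0"
  obtains W where "finite W"
    "\<And>W'. finite W' \<Longrightarrow> W' \<inter> W = {} \<Longrightarrow> (\<Sum>w\<in>W'. 1 / (real_of_int (eis_norm w))\<^sup>2) < e"
proof -
  let ?s = "\<lambda>W. \<Sum>w\<in>W. 1 / (real_of_int (eis_norm w))\<^sup>2"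
  let ?S = "?s ` {W. finite W}"
  have bdd: "bdd_above ?S" using sum_inverse_norm_squares by (auto intro!: bdd_aboveI)
  have "Sup ?S - e < Sup ?S" using assms by simp
  moreover have "?S \<noteq> {}" by blast
  ultimately obtain W where W: "finite W" "Sup ?S - e < ?s W"
    using less_cSup_iff[OF _ bdd] by blast
  show ?thesis
  proof
    fix W' assume W': "finite W'" "W' \<inter> W = {}"
    have "?s (W' \<union> W) \<le> Sup ?S" using W W' bdd by (intro cSup_upper) auto
    then show "?s W' < e" using W W' by (simp add: sum.union_disjoint)
  qed (rule W(1))
qed

lemma eis_norm_add_le: "eis_norm (x + y) \<le> 2 * eis_norm x + 2 * eis_norm y"
proof -
  have "eis_norm (x + y) + eis_norm (x - y) = 2 * eis_norm x + 2 * eis_norm y"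
    by (cases x; cases y) (simp add: power2_eq_square algebra_simps)
  then show ?thesis using eis_norm_nonneg[of "x - y"] by linarith
qed

lemma eis_norm_uminus [simp]: "eis_norm (- x) = eis_norm x"
  by (cases x) (simp add: power2_eq_square algebra_simps)

lemma eis_norm_box: "z \<in> eis_box R \<Longrightarrow> eis_norm z \<le> 2 * R\<^sup>2"
proof -
  assume "z \<in> eis_box R"
  then obtain a b where z: "z = Eis a b" "0 \<le> a" "a < R" "0 \<le> b" "b < R" by (auto simp: eis_box_def)
  have "a\<^sup>2 \<le> R\<^sup>2" "b\<^sup>2 \<le> R\<^sup>2" "0 \<le> a * b" using z by (auto intro!: power_mono)
  then show ?thesis unfolding z(1) eis_norm.simps by linarith
qed

lemma small_norm_card:
  assumes "n \<ge> 0"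
  shows "finite {q. eis_norm q \<le> n\<^sup>2}" "int (card {q. eis_norm q \<le> n\<^sup>2}) \<le> (4 * n + 1)\<^sup>2"
proof -
  let ?Q = "{q. eis_norm q \<le> n\<^sup>2}"
  have sub: "?Q \<subseteq> (\<lambda>(a, b). Eis a b) ` ({- 2 * n..2 * n} \<times> {- 2 * n..2 * n})"
  proof
    fix q assume q: "q \<in> ?Q"
    obtain a b where ab: "q = Eis a b" by (cases q)
    have "4 * eis_norm q = (2 * a - b)\<^sup>2 + 3 * b\<^sup>2" "4 * eis_norm q = (2 * b - a)\<^sup>2 + 3 * a\<^sup>2"
      unfolding ab by (simp_all add: power2_eq_square algebra_simps)
    moreover have "(2 * a - b)\<^sup>2 \<ge> 0" "(2 * b - a)\<^sup>2 \<ge> 0" "a\<^sup>2 \<ge> 0" "b\<^sup>2 \<ge> 0" "4 * eis_norm q \<le> (2 * n)\<^sup>2"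
      using q by (simp_all add: power_mult_distrib)
    ultimately have "a\<^sup>2 \<le> (2 * n)\<^sup>2" "b\<^sup>2 \<le> (2 * n)\<^sup>2" by linarith+
    then have "\<bar>a\<bar> \<le> 2 * n" "\<bar>b\<bar> \<le> 2 * n" using assms by (simp_all only: abs_le_square_iff[symmetric] abs_mult abs_of_nonneg abs_numeral)
    then show "q \<in> (\<lambda>(a, b). Eis a b) ` ({- 2 * n..2 * n} \<times> {- 2 * n..2 * n})"
      unfolding ab by (intro image_eqI[of _ _ "(a, b)"]) auto
  qed
  then show "finite ?Q" by (rule finite_subset) simp
  have "card ?Q \<le> card ((\<lambda>(a, b). Eis a b) ` ({- 2 * n..2 * n} \<times> {- 2 * n..2 * n}))"
    by (rule card_mono[OF _ sub]) simp
  also have "\<dots> \<le> card ({- 2 * n..2 * n} \<times> {- 2 * n..2 * n})" by (rule card_image_le) simp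
  also have "\<dots> = nat (4 * n + 1) * nat (4 * n + 1)" by (simp add: card_cartesian_product algebra_simps)
  finally have "int (card ?Q) \<le> int (nat (4 * n + 1) * nat (4 * n + 1))" by linarith
  then show "int (card ?Q) \<le> (4 * n + 1)\<^sup>2" using assms by (simp add: power2_eq_square)
qed

text \<open>The sieve. Among the R^2 points z of a square of side R, at most one
satisfies f = m z, and for the others q^k divides a non-zero number of norm O(R^2), which
leaves only primes of norm O(R). Each of these excludes at most 8 R^2 / N(q)^2 + 2 points, so
that all of them together exclude 8 R^2 \<Sum> N(q)^-2 + O(R) points for each f; by the
assumption on the sum, this is less than R^2 / (2 |F|) up to the error O(R).\<close>

lemma exists_outside_prime_powers:
  assumes k: "k \<ge> 2" and F: "finite F" and m: "m \<noteq> 0"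
    and tail: "\<And>W'. finite W' \<Longrightarrow> (\<And>w. w \<in> W' \<Longrightarrow> prime_elem w \<and> \<not> w dvd m) \<Longrightarrow>
      (\<Sum>w\<in>W'. 1 / (real_of_int (eis_norm w))\<^sup>2) < 1 / (16 * (real (card F) + 1))"
  obtains z where "\<And>f q. f \<in> F \<Longrightarrow> prime_elem q \<Longrightarrow> \<not> q dvd m \<Longrightarrow> \<not> q ^ k dvd f - m * z"
proof (rule ccontr)
  assume "\<not> thesis"
  then have bad: "\<exists>f\<in>F. \<exists>q. prime_elem q \<and> \<not> q dvd m \<and> q ^ k dvd f - m * z" for z
    using that by metis
  define K where "K = (\<Sum>f\<in>F. eis_norm f)"
  have K: "eis_norm f \<le> K" if "f \<in> F" for f
    unfolding K_def using that F by (intro member_le_sum) auto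
  have K0: "K \<ge> 0" unfolding K_def by (intro sum_nonneg) simp
  \<comment> \<open>For z in the square, f - m z has norm at most C R^2.\<close>
  define C where "C = 2 * K + 4 * eis_norm m"
  have C: "C \<ge> 1" using K0 eis_norm_pos[OF m] by (simp add: C_def)
  \<comment> \<open>With R = C n^2, the bound C R on the norm of a relevant prime is the square
    (C n)^2; the size of n makes R^2 exceed the final estimate 110 |F| (C n)^2.\<close>
  define n where "n = 110 * int (card F) + 1"
  have n: "n \<ge> 1" by (simp add: n_def)
  define R where "R = C * n\<^sup>2"
  have R: "R \<ge> 1" using C n unfolding R_def by (metis mult_mono one_le_power mult_1 zero_le_one order_trans)
  define Q where "Q = {q. prime_elem q \<and> \<not> q dvd m \<and> eis_norm q \<le> (C * n)\<^sup>2}"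
  have Cn: "C * n \<ge> 1" using C n by (metis mult_mono mult_1 zero_le_one order_trans)
  have Qsub: "Q \<subseteq> {q. eis_norm q \<le> (C * n)\<^sup>2}" by (auto simp: Q_def)
  have finQ: "finite Q" and cardQ: "int (card Q) \<le> (4 * (C * n) + 1)\<^sup>2"
    using small_norm_card[of "C * n"] Cn finite_subset[OF Qsub] card_mono[OF _ Qsub] by auto
  define bad_at where "bad_at f q = {z \<in> eis_box R. q ^ k dvd f - m * z}" for f q
  have cover: "eis_box R \<subseteq> (\<Union>f\<in>F. {z \<in> eis_box R. f = m * z} \<union> (\<Union>q\<in>Q. bad_at f q))"
  proof
    fix z assume z: "z \<in> eis_box R"
    obtain f q where fq: "f \<in> F" "prime_elem q" "\<not> q dvd m" "q ^ k dvd f - m * z" using bad by blast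
    show "z \<in> (\<Union>f\<in>F. {z \<in> eis_box R. f = m * z} \<union> (\<Union>q\<in>Q. bad_at f q))"
    proof (cases "f = m * z")
      case False
      have q1: "eis_norm q \<ge> 1" using eis_norm_pos[of q] fq(2) by fastforce
      have "eis_norm (f - m * z) \<le> 2 * eis_norm f + 2 * eis_norm (m * z)"
        using eis_norm_add_le[of f "- (m * z)"] by simp
      also have "\<dots> \<le> 2 * K * R\<^sup>2 + 2 * (eis_norm m * (2 * R\<^sup>2))"
      proof -
        have "eis_norm f * 1 \<le> K * R\<^sup>2" using K[OF fq(1)] K0 R by (intro mult_mono) auto
        moreover have "eis_norm m * eis_norm z \<le> eis_norm m * (2 * R\<^sup>2)"
          by (intro mult_left_mono eis_norm_box z) simp
        ultimately show ?thesis by (simp add: eis_norm_mult)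
      qed
      also have "\<dots> = C * R\<^sup>2" by (simp add: C_def algebra_simps)
      also have "\<dots> \<le> C\<^sup>2 * R\<^sup>2" using C by (intro mult_right_mono) (auto simp: power2_eq_square)
      finally have up: "eis_norm (f - m * z) \<le> (C * R)\<^sup>2" by (simp add: power_mult_distrib)
      have "eis_norm q ^ k dvd eis_norm (f - m * z)" using eis_norm_dvd[OF fq(4)] by (simp add: eis_norm_power)
      moreover have "eis_norm (f - m * z) > 0" using False eis_norm_pos by simp
      ultimately have "eis_norm q ^ k \<le> eis_norm (f - m * z)" by (simp add: zdvd_imp_le)
      moreover have "eis_norm q ^ 2 \<le> eis_norm q ^ k" using k q1 by (rule power_increasing)
      ultimately have "eis_norm q ^ 2 \<le> (C * R)\<^sup>2" using up by linarith
      moreover have "C * R \<ge> 0" using C R by simp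
      ultimately have "eis_norm q \<le> C * R" by (rule power2_le_imp_le)
      also have "C * R = (C * n)\<^sup>2" by (simp add: R_def power2_eq_square)
      finally have "q \<in> Q" using fq by (simp add: Q_def)
      then show ?thesis using fq z by (auto simp: bad_at_def)
    qed (use fq z in auto)
  qed
  have zero: "card {z \<in> eis_box R. f = m * z} \<le> 1" for f
    using m by (auto simp: card_le_Suc0_iff_eq)
  have badcard: "real (card (bad_at f q)) \<le> 8 * (real_of_int R)\<^sup>2 * (1 / (real_of_int (eis_norm q))\<^sup>2) + 2"
    if q: "q \<in> Q" for f q
  proof -
    have q1: "eis_norm q \<ge> 1" using eis_norm_pos[of q] q by (fastforce simp: Q_def)
    have q0: "q ^ k \<noteq> 0" using q by (auto simp: Q_def)
    have "real (card (bad_at f q)) \<le> 8 * (real_of_int R)\<^sup>2 / real_of_int (eis_norm (q ^ k)) + 2"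
    proof (rule card_congruent_in_box[OF q0])
      fix x y assume xy: "x \<in> bad_at f q" "y \<in> bad_at f q"
      then have "q ^ k dvd f - m * y" "q ^ k dvd f - m * x" by (simp_all add: bad_at_def)
      then have "q ^ k dvd (f - m * y) - (f - m * x)" by (rule dvd_diff)
      then have "q ^ k dvd m * (x - y)" by (simp add: algebra_simps)
      then show "q ^ k dvd x - y" using prime_power_dvd_mult q by (auto simp: Q_def)
    qed (use R in \<open>auto simp: bad_at_def\<close>)
    also have "8 * (real_of_int R)\<^sup>2 / real_of_int (eis_norm (q ^ k)) \<le> 8 * (real_of_int R)\<^sup>2 / (real_of_int (eis_norm q))\<^sup>2"
    proof (rule divide_left_mono)
      have "eis_norm q ^ 2 \<le> eis_norm q ^ k" using k q1 by (intro power_increasing) auto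
      then have "real_of_int (eis_norm q ^ 2) \<le> real_of_int (eis_norm q ^ k)" by linarith
      then show "(real_of_int (eis_norm q))\<^sup>2 \<le> real_of_int (eis_norm (q ^ k))" by (simp add: eis_norm_power)
    qed (use q1 in \<open>auto simp: eis_norm_power intro!: mult_pos_pos\<close>)
    finally show ?thesis by simp
  qed
  have sumQ: "(\<Sum>q\<in>Q. 1 / (real_of_int (eis_norm q))\<^sup>2) < 1 / (16 * (real (card F) + 1))"
    by (rule tail[OF finQ]) (auto simp: Q_def)
  define T where "T = 8 * (real_of_int R)\<^sup>2 / (16 * (real (card F) + 1)) + 2 * real (card Q)"
  have per_f: "real (card ({z \<in> eis_box R. f = m * z} \<union> (\<Union>q\<in>Q. bad_at f q))) \<le> 1 + T" for f
  proof -
    have "card ({z \<in> eis_box R. f = m * z} \<union> (\<Union>q\<in>Q. bad_at f q))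
        \<le> card {z \<in> eis_box R. f = m * z} + card (\<Union>q\<in>Q. bad_at f q)" by (rule card_Un_le)
    also have "\<dots> \<le> 1 + (\<Sum>q\<in>Q. card (bad_at f q))"
      using zero[of f] card_UN_le[OF finQ, of "bad_at f"] by linarith
    finally have "real (card ({z \<in> eis_box R. f = m * z} \<union> (\<Union>q\<in>Q. bad_at f q)))
        \<le> real (1 + (\<Sum>q\<in>Q. card (bad_at f q)))" by (simp only: of_nat_le_iff)
    also have "\<dots> = 1 + (\<Sum>q\<in>Q. real (card (bad_at f q)))" by simp
    also have "(\<Sum>q\<in>Q. real (card (bad_at f q)))
        \<le> (\<Sum>q\<in>Q. 8 * (real_of_int R)\<^sup>2 * (1 / (real_of_int (eis_norm q))\<^sup>2) + 2)"
      by (intro sum_mono badcard)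
    also have "\<dots> = 8 * (real_of_int R)\<^sup>2 * (\<Sum>q\<in>Q. 1 / (real_of_int (eis_norm q))\<^sup>2) + 2 * real (card Q)"
      by (simp only: sum.distrib sum_distrib_left sum_constant mult.commute)
    also have "\<dots> \<le> 8 * (real_of_int R)\<^sup>2 * (1 / (16 * (real (card F) + 1))) + 2 * real (card Q)"
      using sumQ by (intro add_right_mono mult_left_mono) auto
    finally show ?thesis by (simp add: T_def)
  qed
  have "real_of_int (R\<^sup>2) = real_of_int (int (card (eis_box R)))" using card_eis_box[of R] R by simp
  then have "real_of_int (R\<^sup>2) = real (card (eis_box R))" by (simp only: of_int_of_nat_eq)
  also have "card (eis_box R) \<le> card (\<Union>f\<in>F. {z \<in> eis_box R. f = m * z} \<union> (\<Union>q\<in>Q. bad_at f q))"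
    by (rule card_mono[OF _ cover]) (use F finQ in \<open>auto simp: bad_at_def\<close>)
  also have "\<dots> \<le> (\<Sum>f\<in>F. card ({z \<in> eis_box R. f = m * z} \<union> (\<Union>q\<in>Q. bad_at f q)))"
    by (rule card_UN_le[OF F])
  also have "real \<dots> \<le> (\<Sum>f\<in>F. 1 + T)" unfolding of_nat_sum by (intro sum_mono per_f)
  finally have main: "(real_of_int R)\<^sup>2 \<le> real (card F) * (1 + T)" by simp
  let ?c = "real (card F)"
  have "?c * (8 * (real_of_int R)\<^sup>2 / (16 * (?c + 1))) \<le> (real_of_int R)\<^sup>2 / 2"
  proof -
    have "?c / (?c + 1) * ((real_of_int R)\<^sup>2 / 2) \<le> 1 * ((real_of_int R)\<^sup>2 / 2)"
      by (intro mult_right_mono) auto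
    moreover have "c * (8 * x / (16 * d)) = c / d * (x / 2)" for c d x :: real
      by (cases "d = 0") (simp_all add: field_simps)
    ultimately show ?thesis by (simp only: mult_1)
  qed
  then have "(real_of_int R)\<^sup>2 / 2 \<le> ?c * (1 + 2 * real (card Q))"
  proof -
    have "x / 2 \<le> c * (1 + 2 * r)" if "x \<le> c * (1 + (a + 2 * r))" "c * a \<le> x / 2" for x c a r :: real
      using that by (simp add: distrib_left)
    from this[OF main[unfolded T_def]] show ?thesis using \<open>?c * _ \<le> _\<close> by blast
  qed
  then have "real_of_int (R\<^sup>2) \<le> real_of_int (2 * int (card F) * (1 + 2 * int (card Q)))" by simp
  then have "R\<^sup>2 \<le> 2 * int (card F) * (1 + 2 * int (card Q))" by (simp only: of_int_le_iff)
  also have "\<dots> \<le> 2 * int (card F) * (1 + 2 * (4 * (C * n) + 1)\<^sup>2)"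
    using cardQ by (intro mult_left_mono) auto
  also have "\<dots> \<le> 2 * int (card F) * (55 * (C * n)\<^sup>2)"
  proof (intro mult_left_mono)
    have "C * n \<le> (C * n)\<^sup>2" using self_le_power[OF Cn] by simp
    then show "1 + 2 * (4 * (C * n) + 1)\<^sup>2 \<le> 55 * (C * n)\<^sup>2"
      using Cn by (simp add: power2_sum power_mult_distrib)
  qed simp
  finally have "(C * n)\<^sup>2 * n\<^sup>2 \<le> (C * n)\<^sup>2 * (110 * int (card F))"
    by (simp add: R_def power2_eq_square algebra_simps)
  then have "n\<^sup>2 \<le> 110 * int (card F)" using C n by (simp add: mult_le_cancel_left)
  moreover have "n \<le> n\<^sup>2" using self_le_power[OF n] by simp
  ultimately show False by (simp add: n_def)
qed

text \<open>The residue class t + m L as the state of a Chinese remainder construction: for the primes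
that divide m, the sets F - t' with t' \<in> t + m L contain no multiple of q^k, and this
can no longer be spoiled when the class is refined, because q^k divides m.\<close>

definition avoids :: "nat \<Rightarrow> eis set \<Rightarrow> eis \<Rightarrow> eis \<Rightarrow> bool" where
  "avoids k F t m \<longleftrightarrow> m \<noteq> 0 \<and>
     (\<forall>q. prime_elem q \<longrightarrow> q dvd m \<longrightarrow> q ^ k dvd m \<and> (\<forall>f\<in>F. \<not> q ^ k dvd f - t))"

lemma dvd_minus_cong:
  assumes "(d :: eis) dvd s - t"
  shows "d dvd f - s \<longleftrightarrow> d dvd f - t"
proof -
  have "f - t = (f - s) + (s - t)" by simp
  then show ?thesis using assms by (metis dvd_add_left_iff)
qed

lemma prime_dvd_prime:
  assumes "prime_elem (q :: eis)" "prime_elem r" "r dvd q"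
  shows "q dvd r"
proof (rule ccontr)
  assume "\<not> q dvd r"
  then have "comaximal q r" using assms prime_comaximal by blast
  then obtain u v where "u * q + v * r = 1" unfolding comaximal_def by blast
  moreover have "r dvd u * q + v * r" using assms(3) by simp
  ultimately show False using assms(2) by (simp add: prime_elem_def)
qed

lemma avoids_extend:
  assumes av: "avoids k F t m" and q: "prime_elem q" "\<not> q dvd m" and c: "\<And>f. f \<in> F \<Longrightarrow> \<not> q ^ k dvd f - c"
  obtains t' where "avoids k F t' (m * q ^ k)" "m dvd t' - t" "q ^ k dvd t' - c"
proof -
  have "comaximal m (q ^ k)" using comaximal_sym comaximal_power prime_comaximal q by blast
  then obtain t' where t': "m dvd t' - t" "q ^ k dvd t' - c" using chinese_remainder by blast
  have "r ^ k dvd m * q ^ k \<and> (\<forall>f\<in>F. \<not> r ^ k dvd f - t')" if r: "prime_elem r" "r dvd m * q ^ k" for r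
  proof (cases "r dvd m")
    case True
    then have "r ^ k dvd m" "\<forall>f\<in>F. \<not> r ^ k dvd f - t" using av r by (auto simp: avoids_def)
    then show ?thesis using t'(1) dvd_minus_cong dvd_trans by (meson dvd_mult2)
  next
    case False
    then have "r dvd q ^ k" using r prime_elem_dvd_mult_iff by blast
    then have rq: "r dvd q" using r prime_elem_dvd_power by blast
    then have "q dvd r" using prime_dvd_prime q r by blast
    then have "q ^ k dvd r ^ k" "r ^ k dvd q ^ k" using rq by (simp_all add: dvd_power_same)
    then show ?thesis using t'(2) c dvd_minus_cong dvd_trans by (meson dvd_mult)
  qed
  moreover have "m * q ^ k \<noteq> 0" using av q by (auto simp: avoids_def)
  ultimately have "avoids k F t' (m * q ^ k)" by (simp add: avoids_def)
  then show ?thesis using t' that by blast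
qed

lemma avoids_small_primes:
  assumes "finite W" "admissible k F" "k > 0"
  obtains t m where "avoids k F t m" "\<And>q. q \<in> W \<Longrightarrow> prime_elem q \<Longrightarrow> q dvd m"
proof -
  have "\<exists>t m. avoids k F t m \<and> (\<forall>q\<in>W. prime_elem q \<longrightarrow> q dvd m)" using assms(1)
  proof (induction W rule: finite_induct)
    case empty
    have "avoids k F 0 1" by (simp add: avoids_def prime_elem_def)
    then show ?case by blast
  next
    case (insert q W)
    then obtain t m where tm: "avoids k F t m" "\<forall>q\<in>W. prime_elem q \<longrightarrow> q dvd m" by blast
    show ?case
    proof (cases "prime_elem q \<and> \<not> q dvd m")
      case True
      then obtain c where "\<And>f. f \<in> F \<Longrightarrow> \<not> q ^ k dvd f - c" using assms(2) unfolding admissible_def by blast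
      then obtain t' where "avoids k F t' (m * q ^ k)" using avoids_extend[OF tm(1)] True by metis
      moreover have "q dvd m * q ^ k" using assms(3) by (simp add: dvd_power)
      ultimately show ?thesis using tm(2) by (metis dvd_mult2 insertE)
    qed (use tm in blast)
  qed
  then show ?thesis using that by blast
qed

text \<open>For each b \<in> B a fresh prime p is used up to make b - t divisible by p^k. If
p divides none of the differences f - b, this does no harm to the points of F.\<close>

lemma avoids_and_hits:
  assumes "finite B" "finite F" "B \<inter> F = {}" "avoids k F t m" "k > 0"
  obtains t' m' where "avoids k F t' m'" "m dvd m'" "\<And>b. b \<in> B \<Longrightarrow> \<exists>p. prime_elem p \<and> p ^ k dvd m' \<and> p ^ k dvd b - t'"
proof -
  have "\<exists>t' m'. avoids k F t' m' \<and> m dvd m' \<and> (\<forall>b\<in>B. \<exists>p. prime_elem p \<and> p ^ k dvd m' \<and> p ^ k dvd b - t')"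
    using assms(1,3)
  proof (induction B rule: finite_induct)
    case empty
    show ?case using assms(4) by (intro exI[of _ t] exI[of _ m]) simp
  next
    case (insert b B)
    have "B \<inter> F = {}" using insert.prems by blast
    from insert.IH[OF this] obtain t' m' where tm: "avoids k F t' m'" "m dvd m'"
      "\<forall>b\<in>B. \<exists>p. prime_elem p \<and> p ^ k dvd m' \<and> p ^ k dvd b - t'" by blast
    have "m' * (\<Prod>f\<in>F. f - b) \<noteq> 0" using tm(1) assms(2) insert.prems by (auto simp: avoids_def)
    then obtain p where p: "prime_elem p" "\<not> p dvd m' * (\<Prod>f\<in>F. f - b)" using prime_avoiding by blast
    have "\<not> p dvd m'" using p(2) by (meson dvd_mult2)
    have "\<not> p ^ k dvd f - b" if f: "f \<in> F" for f
    proof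
      assume "p ^ k dvd f - b"
      then have "p dvd f - b" using assms(5) by (metis dvd_power dvd_trans)
      moreover have "f - b dvd (\<Prod>f\<in>F. f - b)" using f assms(2) by (rule dvd_prodI[rotated])
      ultimately show False using p(2) dvd_trans dvd_mult by metis
    qed
    then obtain s where s: "avoids k F s (m' * p ^ k)" "m' dvd s - t'" "p ^ k dvd s - b"
      using avoids_extend[OF tm(1) p(1) \<open>\<not> p dvd m'\<close>] by metis
    have "\<exists>p. prime_elem p \<and> p ^ k dvd m' * p' ^ k \<and> p ^ k dvd b' - s" if "b' \<in> B" for b' p'
      using tm(3) that s(2) by (meson dvd_minus_cong dvd_mult2 dvd_trans)
    moreover have "p ^ k dvd b - s" using s(3) by (metis dvd_minus_iff minus_diff_eq)
    ultimately have "\<forall>b'\<in>insert b B. \<exists>q. prime_elem q \<and> q ^ k dvd m' * p ^ k \<and> q ^ k dvd b' - s"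
      using p(1) by (metis dvd_triv_right insertE)
    then show ?case using s(1) tm(2) by (meson dvd_mult2)
  qed
  then show ?thesis using that by blast
qed

text \<open>A translation t is found for which F - t is k-free while the other
points of the window B become multiples of k-th powers of primes. The Chinese remainder theorem
takes care of the primes in the finite exceptional set of the sum \<Sum> N(q)^-2 and of the
primes attached to B; the sieve then avoids all remaining primes.\<close>

lemma finite_admissible_in_hull:
  assumes k: "k \<ge> 2" and F: "finite F" "admissible k F"
  shows "F \<in> hull_of_kfree k"
  unfolding hull_of_kfree_def
proof (intro CollectI allI impI)
  fix B :: "eis set" assume B: "finite B"
  have k0: "k > 0" using k by simp
  have "1 / (16 * (real (card F) + 1)) > 0" by simp
  then obtain W where W: "finite W" "\<And>W'. finite W' \<Longrightarrow> W' \<inter> W = {} \<Longrightarrow>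
      (\<Sum>w\<in>W'. 1 / (real_of_int (eis_norm w))\<^sup>2) < 1 / (16 * (real (card F) + 1))"
    using inverse_norm_squares_tail by blast
  obtain t0 m0 where tm0: "avoids k F t0 m0" "\<And>q. q \<in> W \<Longrightarrow> prime_elem q \<Longrightarrow> q dvd m0"
    using avoids_small_primes[OF W(1) F(2) k0] by blast
  have "finite (B - F)" "(B - F) \<inter> F = {}" using B by auto
  then obtain t m where tm: "avoids k F t m" "m0 dvd m"
    and hits: "\<And>b. b \<in> B - F \<Longrightarrow> \<exists>p. prime_elem p \<and> p ^ k dvd m \<and> p ^ k dvd b - t"
    using avoids_and_hits[OF _ F(1) _ tm0(1) k0] by metis
  let ?F = "(\<lambda>f. f - t) ` F"
  have cF: "card ?F = card F" by (intro card_image) (auto simp: inj_on_def)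
  obtain z where z: "\<And>f q. f \<in> ?F \<Longrightarrow> prime_elem q \<Longrightarrow> \<not> q dvd m \<Longrightarrow> \<not> q ^ k dvd f - m * z"
  proof (rule exists_outside_prime_powers[OF k, of ?F m])
    show "(\<Sum>w\<in>W'. 1 / (real_of_int (eis_norm w))\<^sup>2) < 1 / (16 * (real (card ?F) + 1))"
      if "finite W'" "\<And>w. w \<in> W' \<Longrightarrow> prime_elem w \<and> \<not> w dvd m" for W'
      unfolding cF using that W(2) tm0(2) tm(2) by (meson disjoint_iff dvd_trans)
  qed (use F tm in \<open>auto simp: avoids_def\<close>)
  have eq: "f - (t + m * z) = (f - t) - m * z" for f :: eis by simp
  have "f - (t + m * z) \<in> kfree k" if f: "f \<in> F" for f
    unfolding kfree_def
  proof (intro CollectI allI impI)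
    fix q :: eis assume q: "prime_elem q"
    show "\<not> q ^ k dvd f - (t + m * z)"
    proof (cases "q dvd m")
      case True
      then have "q ^ k dvd m" "\<not> q ^ k dvd f - t" using tm(1) q f by (auto simp: avoids_def)
      then show ?thesis using dvd_minus_cong[of "q ^ k" "t + m * z" t f] by simp
    next
      case False
      then show ?thesis unfolding eq using z f q by blast
    qed
  qed
  moreover have "b - (t + m * z) \<notin> kfree k" if b: "b \<in> B - F" for b
  proof -
    obtain p where p: "prime_elem p" "p ^ k dvd m" "p ^ k dvd b - t" using hits[OF b] by blast
    then have "p ^ k dvd b - (t + m * z)" unfolding eq by (intro dvd_diff[OF p(3)] dvd_mult2)
    then show ?thesis using p(1) by (auto simp: kfree_def)
  qed
  ultimately have "\<forall>b\<in>B. b \<in> F \<longleftrightarrow> b - (t + m * z) \<in> kfree k" by blast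
  then show "\<exists>t. \<forall>b\<in>B. b \<in> F \<longleftrightarrow> b - t \<in> kfree k" by blast
qed

section \<open>Sparse test sets\<close>

text \<open>N(w) is a multiple of w, so it suffices to reduce the coordinates modulo
N(w).\<close>

lemma finite_residue_system:
  assumes "w \<noteq> 0"
  obtains C where "finite C" "\<And>x. \<exists>c\<in>C. w dvd x - (c :: eis)"
proof
  let ?n = "eis_norm w"
  show "finite (eis_box ?n)" by simp
  fix x :: eis
  obtain a b where x: "x = Eis a b" by (cases x)
  have n: "?n > 0" using eis_norm_pos assms by blast
  have "x - Eis (a mod ?n) (b mod ?n) = of_int ?n * Eis (a div ?n) (b div ?n)"
    by (simp add: x eis_of_int minus_mod_eq_mult_div)
  then have "w dvd x - Eis (a mod ?n) (b mod ?n)" by (metis dvd_eis_norm dvd_mult2)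
  moreover have "Eis (a mod ?n) (b mod ?n) \<in> eis_box ?n"
    using n unfolding eis_box_def by (intro image_eqI[of _ _ "(a mod ?n, b mod ?n)"]) auto
  ultimately show "\<exists>c\<in>eis_box ?n. w dvd x - c" by blast
qed

text \<open>If U meets every class modulo p^k, then finitely many points of U do, and on this
finite window U cannot agree with a translate of the k-free numbers.\<close>

lemma hull_admissible:
  assumes "U \<in> hull_of_kfree k" "k > 0"
  shows "admissible k U"
  unfolding admissible_def
proof (intro allI impI, rule ccontr)
  fix p :: eis assume p: "prime_elem p" and "\<nexists>c. \<forall>u\<in>U. \<not> p ^ k dvd u - c"
  then obtain h where h: "\<And>c. h c \<in> U" "\<And>c. p ^ k dvd h c - c" by metis
  have "p ^ k \<noteq> 0" using p by auto
  then obtain C where C: "finite C" "\<And>x. \<exists>c\<in>C. p ^ k dvd x - c" using finite_residue_system by blast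
  from C(1) have "finite (h ` C)" by simp
  then obtain t where t: "\<forall>b\<in>h ` C. b \<in> U \<longleftrightarrow> b - t \<in> kfree k"
    using assms(1) unfolding hull_of_kfree_def by blast
  obtain c where c: "c \<in> C" "p ^ k dvd t - c" using C(2) by blast
  then have "h c - t \<in> kfree k" using t h by blast
  moreover have "p ^ k dvd h c - t" using h(2)[of c] c(2) dvd_minus_cong by blast
  ultimately show False using p by (auto simp: kfree_def)
qed

lemma admissible_subset: "admissible k U \<Longrightarrow> F \<subseteq> U \<Longrightarrow> admissible k F"
  unfolding admissible_def by (meson subsetD)

lemma finite_subset_in_hull:
  assumes "k \<ge> 2" "U \<in> hull_of_kfree k" "finite F" "F \<subseteq> U"
  shows "F \<in> hull_of_kfree k"
proof -
  have "admissible k U" using hull_admissible assms(1,2) by simp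
  then show ?thesis using finite_admissible_in_hull assms admissible_subset by blast
qed

lemma prime_power_not_dvd_1:
  assumes "prime_elem (p :: eis)" "k > 0" shows "\<not> p ^ k dvd 1"
  using assms dvd_power[of k p] dvd_trans by (metis prime_elem_def)

lemma prime_dvd_diff_nat:
  assumes "i \<noteq> j" "i \<le> n" "j \<le> n" "(q :: eis) dvd of_nat i - of_nat j"
  shows "q dvd of_nat (fact n)"
proof -
  have *: "q dvd of_nat (fact n)" if "a < b" "b \<le> n" "q dvd of_nat b - of_nat a" for a b
  proof -
    have "(b - a) dvd (fact n :: nat)" using that by (intro dvd_fact) auto
    then obtain r where "(fact n :: nat) = (b - a) * r" by blast
    then have "(of_nat (fact n) :: eis) = of_nat (b - a) * of_nat r" by (simp only: of_nat_mult)
    moreover have "of_nat (b - a) = (of_nat b - of_nat a :: eis)" using that(1) by (simp add: of_nat_diff)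
    ultimately show ?thesis using that(3) by (metis dvd_mult2)
  qed
  have "q dvd of_nat j - of_nat i" using assms(4) by (metis dvd_minus_iff minus_diff_eq)
  then show ?thesis using *[of i j] *[of j i] assms by linarith
qed

text \<open>The integers 0, ..., n are pairwise incongruent modulo a prime that does not
divide n!, so there are more than n classes. This avoids computing the index of an ideal.\<close>

lemma misses_class_if_few:
  assumes "prime_elem (q :: eis)" "\<not> q dvd of_nat (fact n)" "finite S" "card S \<le> n" "k > 0"
  shows "\<exists>c. \<forall>u\<in>S. \<not> q ^ k dvd u - c"
proof (rule ccontr)
  assume "\<nexists>c. \<forall>u\<in>S. \<not> q ^ k dvd u - c"
  then obtain h where h: "\<And>c. h c \<in> S" "\<And>c. q ^ k dvd h c - c" by metis
  have "inj_on (\<lambda>i. h (of_nat i)) {..n}"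
  proof (rule inj_onI, rule ccontr)
    fix i j assume ij: "i \<in> {..n}" "j \<in> {..n}" "h (of_nat i) = h (of_nat j)" "i \<noteq> j"
    have "q ^ k dvd (h (of_nat j) - of_nat j) - (h (of_nat i) - of_nat i)" by (intro dvd_diff h)
    then have "q ^ k dvd of_nat i - of_nat j" using ij(3) by simp
    then have "q dvd of_nat i - of_nat j" using assms(5) dvd_power dvd_trans by blast
    then show False using prime_dvd_diff_nat[OF ij(4)] ij assms(2) by auto
  qed
  then have "card {..n} \<le> card S" using h(1) assms(3) by (intro card_inj_on_le) auto
  then show False using assms(4) by simp
qed

text \<open>Modulo w the points are chosen in the classes of C, and modulo a number M that is
divisible by q^k for all small primes q not dividing w they are chosen congruent to one point g0
of G. So modulo q^k the set T adds no class to those of G; for the other primes, those that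
do not divide n!, the set G \<union> T is too small to meet all classes. Each point may be moved by
multiples of w M, which leaves room to keep the points away from D and from each other.\<close>

lemma sparse_test_set:
  assumes k: "k > 0" and w: "w \<noteq> 0" and C: "finite C" and D: "finite D" and G: "finite G"
    and adm: "\<And>q. prime_elem q \<Longrightarrow> \<not> q dvd w \<Longrightarrow> \<exists>c. \<forall>g\<in>G. \<not> q ^ k dvd g - c"
  obtains T where "finite T" "\<forall>c\<in>C. \<exists>t\<in>T. w dvd t - c" "\<forall>t\<in>T. \<exists>c\<in>C. w dvd t - c"
    "\<forall>t\<in>T. t \<notin> D" "\<forall>t\<in>T. \<forall>t'\<in>T. t' \<noteq> t \<longrightarrow> t' - t \<notin> D"
    "\<forall>q. prime_elem q \<longrightarrow> \<not> q dvd w \<longrightarrow> (\<exists>c. \<forall>u\<in>G \<union> T. \<not> q ^ k dvd u - (c :: eis))"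
proof -
  define n where "n = card G + card C"
  define g0 where "g0 = (if G = {} then 0 else SOME g. g \<in> G)"
  have g0: "g0 \<in> G" if "G \<noteq> {}" using that by (simp add: g0_def some_in_eq)
  have "of_nat (fact n) ^ k \<noteq> (0 :: eis)" by (metis fact_nonzero of_nat_eq_0_iff power_not_zero)
  then obtain M where M: "M \<noteq> 0" "comaximal M w"
    "\<And>q j. prime_elem q \<Longrightarrow> \<not> q dvd w \<Longrightarrow> q ^ j dvd of_nat (fact n) ^ k \<Longrightarrow> q ^ j dvd M"
    using coprime_part by metis
  define good where "good C T \<longleftrightarrow> finite T \<and> card T \<le> card C \<and> (\<forall>t\<in>T. M dvd t - g0) \<and> (\<forall>c\<in>C. \<exists>t\<in>T. w dvd t - c) \<and>
      (\<forall>t\<in>T. \<exists>c\<in>C. w dvd t - c) \<and> (\<forall>t\<in>T. t \<notin> D) \<and> (\<forall>t\<in>T. \<forall>t'\<in>T. t' \<noteq> t \<longrightarrow> t' - t \<notin> D)" for C T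
  have "\<exists>T. good C T"
    using C
  proof (induction C rule: finite_induct)
    case empty
    have "good {} {}" by (simp add: good_def)
    then show ?case by blast
  next
    case (insert c C)
    then obtain T where "good C T" by blast
  then have T: "finite T" "card T \<le> card C" "\<forall>t\<in>T. M dvd t - g0" "\<forall>c\<in>C. \<exists>t\<in>T. w dvd t - c"
      "\<forall>t\<in>T. \<exists>c\<in>C. w dvd t - c" "\<forall>t\<in>T. t \<notin> D" "\<forall>t\<in>T. \<forall>t'\<in>T. t' \<noteq> t \<longrightarrow> t' - t \<notin> D"
    unfolding good_def by - (elim conjE, assumption)+
    obtain t0 where t0: "M dvd t0 - g0" "w dvd t0 - c" using chinese_remainder[OF M(2)] by blast
    define f where "f j = t0 + w * M * of_int j" for j
    have "inj f" using w M(1) by (auto simp: f_def inj_on_def)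
    then have inf: "infinite (range f)" by (simp add: finite_image_iff infinite_UNIV_int)
    define bad where "bad = D \<union> (\<lambda>(t, d). t + d) ` (T \<times> D) \<union> (\<lambda>(t, d). t - d) ` (T \<times> D)"
    have "finite bad" using D T(1) by (simp add: bad_def)
    then obtain t where t: "t \<in> range f" "t \<notin> bad" using inf by (meson finite_subset subsetI)
    then obtain j where j: "t = f j" by blast
    have tM: "M dvd t - g0" and tw: "w dvd t - c"
    proof -
      have "M dvd (t0 - g0) + w * M * of_int j" using t0(1) by (intro dvd_add) auto
      then show "M dvd t - g0" by (simp add: j f_def algebra_simps)
      have "w dvd (t0 - c) + w * M * of_int j" using t0(2) by (intro dvd_add) auto
      then show "w dvd t - c" by (simp add: j f_def algebra_simps)
    qed
    have tD: "t \<notin> D" using t(2) by (simp add: bad_def)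
    have tT: "t - t' \<notin> D" "t' - t \<notin> D" if t': "t' \<in> T" for t'
    proof -
      have "t = t' + d \<Longrightarrow> d \<notin> D" "t = t' - d \<Longrightarrow> d \<notin> D" for d
        using t(2) t' by (force simp: bad_def)+
      from this(1)[of "t - t'"] this(2)[of "t' - t"] show "t - t' \<notin> D" "t' - t \<notin> D" by simp_all
    qed
    have "card (insert t T) \<le> card (insert c C)"
      using T(1,2) insert.hyps by (simp add: card_insert_if)
    moreover have "\<forall>t1\<in>insert t T. \<forall>t2\<in>insert t T. t2 \<noteq> t1 \<longrightarrow> t2 - t1 \<notin> D" using T(7) tT by blast
    moreover have "\<forall>t1\<in>insert t T. M dvd t1 - g0" using T(3) tM by (metis insertE)
    moreover have "\<forall>c1\<in>insert c C. \<exists>t1\<in>insert t T. w dvd t1 - c1" using T(4) tw by (metis insertCI insertE)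
    moreover have "\<forall>t1\<in>insert t T. \<exists>c1\<in>insert c C. w dvd t1 - c1" using T(5) tw by (metis insertCI insertE)
    moreover have "\<forall>t1\<in>insert t T. t1 \<notin> D" using T(6) tD by (metis insertE)
    moreover have "finite (insert t T)" using T(1) by simp
    ultimately have "good (insert c C) (insert t T)" unfolding good_def by (intro conjI)
    then show ?case by blast
  qed
  then obtain T where "good C T" by blast
  then have T: "finite T" "card T \<le> card C" "\<forall>t\<in>T. M dvd t - g0" "\<forall>c\<in>C. \<exists>t\<in>T. w dvd t - c"
      "\<forall>t\<in>T. \<exists>c\<in>C. w dvd t - c" "\<forall>t\<in>T. t \<notin> D" "\<forall>t\<in>T. \<forall>t'\<in>T. t' \<noteq> t \<longrightarrow> t' - t \<notin> D"
    unfolding good_def by - (elim conjE, assumption)+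
  have miss: "\<exists>c. \<forall>u\<in>G \<union> T. \<not> q ^ k dvd u - c" if q: "prime_elem q" "\<not> q dvd w" for q
  proof (cases "q dvd of_nat (fact n)")
    case True
    then have "q ^ k dvd M" using M(3) q by (simp add: dvd_power_same)
    then have tg: "q ^ k dvd t - g0" if "t \<in> T" for t using T(3) that dvd_trans by blast
    have tg': "q ^ k dvd t - c \<longleftrightarrow> q ^ k dvd g0 - c" if "t \<in> T" for t c
    proof -
      have "t - c = (t - g0) + (g0 - c)" by simp
      then show ?thesis using tg[OF that] by (metis dvd_add_right_iff)
    qed
    show ?thesis
    proof (cases "G = {}")
      case True
      have "\<not> q ^ k dvd g0 - (g0 + 1)" using prime_power_not_dvd_1[OF q(1) k] by simp
      then show ?thesis using True tg' by (intro exI[of _ "g0 + 1"]) simp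
    next
      case False
      then show ?thesis using adm[OF q] g0 tg' by (metis Un_iff)
    qed
  next
    case False
    have "card (G \<union> T) \<le> n" using card_Un_le[of G T] T(2) by (simp add: n_def)
    then show ?thesis using misses_class_if_few q False G T(1) k by blast
  qed
  show ?thesis
    by (rule that[OF T(1,4,5,6,7)]) (use miss in blast)
qed

section \<open>Equivariant maps of the shift space\<close>

text \<open>Continuity for the product topology: membership of x in the image is decided by a
finite window.\<close>

definition continuous_on_hull :: "nat \<Rightarrow> (eis set \<Rightarrow> eis set) \<Rightarrow> bool" where
  "continuous_on_hull k \<Phi> \<longleftrightarrow> (\<forall>U\<in>hull_of_kfree k. \<forall>x. \<exists>B. finite B \<and>
     (\<forall>U'\<in>hull_of_kfree k. U' \<inter> B = U \<inter> B \<longrightarrow> (x \<in> \<Phi> U' \<longleftrightarrow> x \<in> \<Phi> U)))"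

definition equivariant_endo :: "nat \<Rightarrow> (eis \<Rightarrow> eis) \<Rightarrow> (eis set \<Rightarrow> eis set) \<Rightarrow> bool" where
  "equivariant_endo k A \<Phi> \<longleftrightarrow> (\<forall>U\<in>hull_of_kfree k. \<Phi> U \<in> hull_of_kfree k) \<and> continuous_on_hull k \<Phi> \<and>
     (\<forall>U\<in>hull_of_kfree k. \<forall>t. \<Phi> ((\<lambda>u. u - t) ` U) = (\<lambda>u. u - A t) ` \<Phi> U)"

lemma mem_shift: "x \<in> (\<lambda>u. u - t) ` U \<longleftrightarrow> x + t \<in> (U :: eis set)"
  by (metis (no_types, lifting) add_diff_cancel_right' diff_add_cancel image_iff)

lemma shift_in_hull:
  assumes "U \<in> hull_of_kfree k"
  shows "(\<lambda>u. u - t) ` U \<in> hull_of_kfree k"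
  unfolding hull_of_kfree_def
proof (intro CollectI allI impI)
  fix B :: "eis set" assume "finite B"
  then have "finite ((\<lambda>b. b + t) ` B)" by simp
  then obtain s where s: "\<forall>b\<in>(\<lambda>b. b + t) ` B. b \<in> U \<longleftrightarrow> b - s \<in> kfree k"
    using assms unfolding hull_of_kfree_def by blast
  have "b \<in> (\<lambda>u. u - t) ` U \<longleftrightarrow> b - (s - t) \<in> kfree k" if "b \<in> B" for b
  proof -
    have "b + t \<in> U \<longleftrightarrow> b + t - s \<in> kfree k" using s that by blast
    moreover have "b + t - s = b - (s - t)" by simp
    ultimately show ?thesis unfolding mem_shift by (simp only:)
  qed
  then show "\<exists>s. \<forall>b\<in>B. b \<in> (\<lambda>u. u - t) ` U \<longleftrightarrow> b - s \<in> kfree k" by blast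
qed

lemma empty_in_hull: "k \<ge> 2 \<Longrightarrow> {} \<in> hull_of_kfree k"
  by (rule finite_admissible_in_hull) (auto simp: admissible_def)

lemma singleton_in_hull: "k \<ge> 2 \<Longrightarrow> {x} \<in> hull_of_kfree k"
proof (rule finite_admissible_in_hull)
  assume "k \<ge> 2"
  then have "\<not> p ^ k dvd x - (x + 1)" if "prime_elem p" for p
    using prime_power_not_dvd_1[OF that] by simp
  then show "admissible k {x}" unfolding admissible_def by blast
qed auto

text \<open>The image of the empty set is invariant under all translations, and the whole lattice is not
admissible.\<close>

lemma image_of_empty:
  assumes "k \<ge> 2" "equivariant_endo k A \<Phi>" "surj A"
  shows "\<Phi> {} = {}"
proof (rule ccontr)
  assume "\<Phi> {} \<noteq> {}"
  then obtain x where x: "x \<in> \<Phi> {}" by blast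
  have in_hull: "\<Phi> {} \<in> hull_of_kfree k"
    using assms(2) empty_in_hull[OF assms(1)] by (simp add: equivariant_endo_def)
  have "y \<in> \<Phi> {}" for y
  proof -
    obtain t where t: "A t = x - y" using assms(3) by (metis surjD)
    have "\<Phi> ((\<lambda>u. u - t) ` {}) = (\<lambda>u. u - A t) ` \<Phi> {}"
      using assms(2) empty_in_hull[OF assms(1)] unfolding equivariant_endo_def by blast
    then have "y \<in> \<Phi> {} \<longleftrightarrow> y \<in> (\<lambda>u. u - A t) ` \<Phi> {}" by (simp only: image_empty)
    then have "y \<in> \<Phi> {} \<longleftrightarrow> y + A t \<in> \<Phi> {}" by (simp only: mem_shift)
    then show ?thesis using x t by simp
  qed
  then have "\<Phi> {} = UNIV" by blast
  moreover obtain p :: eis where "prime_elem p" using prime_avoiding[of 1] by auto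
  moreover have "admissible k (\<Phi> {})" using hull_admissible in_hull assms(1) by simp
  ultimately show False unfolding admissible_def by (metis UNIV_I diff_self dvd_0_right)
qed

text \<open>D is the window that decides whether s belongs to the image of {0}. Seen from
t, a sparse set looks like {0} on this window.\<close>

lemma image_of_sparse:
  assumes k: "k \<ge> 2" and eq: "equivariant_endo k A \<Phi>" and s: "s \<in> \<Phi> {0}"
  obtains D where "finite D"
    "\<And>T t. T \<in> hull_of_kfree k \<Longrightarrow> t \<in> T \<Longrightarrow> (\<And>t'. t' \<in> T \<Longrightarrow> t' \<noteq> t \<Longrightarrow> t' - t \<notin> D) \<Longrightarrow> A t + s \<in> \<Phi> T"
proof -
  obtain D where D: "finite D" "\<And>U'. U' \<in> hull_of_kfree k \<Longrightarrow> U' \<inter> D = {0} \<inter> D \<Longrightarrow> s \<in> \<Phi> U'"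
    using eq s singleton_in_hull[OF k, of 0] unfolding equivariant_endo_def continuous_on_hull_def by metis
  have "A t + s \<in> \<Phi> T"
    if T: "T \<in> hull_of_kfree k" "t \<in> T" "\<And>t'. t' \<in> T \<Longrightarrow> t' \<noteq> t \<Longrightarrow> t' - t \<notin> D" for T t
  proof -
    have "(\<lambda>u. u - t) ` T \<inter> D = {0} \<inter> D"
      using T(2,3) by force
    then have "s \<in> \<Phi> ((\<lambda>u. u - t) ` T)" using D(2) shift_in_hull T(1) by blast
    also have "\<dots> = (\<lambda>u. u - A t) ` \<Phi> T" using eq T(1) unfolding equivariant_endo_def by blast
    finally show ?thesis by (simp add: mem_shift add.commute)
  qed
  then show ?thesis using D(1) that by blast
qed

lemma prime_elem_cnj: "prime_elem p \<Longrightarrow> prime_elem (eis_cnj p)"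
proof (rule prime_elemI)
  assume p: "prime_elem p"
  show "eis_cnj p \<noteq> 0" using p by (metis eis_cnj_0 eis_cnj_cnj prime_elem_def)
  show "\<not> eis_cnj p dvd 1" using p by (metis eis_cnj_1 eis_cnj_dvd prime_elem_def)
  fix a b assume "eis_cnj p dvd a * b"
  then have "p dvd eis_cnj a * eis_cnj b" by (metis eis_cnj_cnj eis_cnj_dvd eis_cnj_mult)
  then show "eis_cnj p dvd a \<or> eis_cnj p dvd b"
    using p by (metis eis_cnj_cnj eis_cnj_dvd prime_elem_dvd_multD)
qed

text \<open>A version for cosets of the fact that a group is not the union of two proper subgroups. If
a dvd d and x \<in> L is not a multiple of a, neither d + x nor d - x is one, so b
divides both and therefore 2 d; this is where halving is needed.\<close>

lemma subgroup_in_union: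
  fixes a b d :: eis
  assumes add: "\<And>x y. x \<in> L \<Longrightarrow> y \<in> L \<Longrightarrow> x + y \<in> L" and neg: "\<And>x. x \<in> L \<Longrightarrow> - x \<in> L" and "0 \<in> L"
    and cover: "\<And>x. x \<in> L \<Longrightarrow> a dvd d + x \<or> b dvd d + x"
    and half: "\<And>x. a dvd 2 * x \<Longrightarrow> a dvd x" "\<And>x. b dvd 2 * x \<Longrightarrow> b dvd x"
  shows "(\<forall>x\<in>L. a dvd x) \<or> (\<forall>x\<in>L. b dvd x)"
proof -
  have *: "(\<forall>x\<in>L. a dvd x) \<or> (\<forall>x\<in>L. b dvd x)"
    if cov: "\<And>x. x \<in> L \<Longrightarrow> a dvd d + x \<or> b dvd d + x" and b2: "\<And>x. b dvd 2 * x \<Longrightarrow> b dvd x"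
      and ad: "a dvd d" for a b
  proof (rule ccontr)
    assume "\<not> ?thesis"
    then obtain x y where x: "x \<in> L" "\<not> a dvd x" and y: "y \<in> L" "\<not> b dvd y" by blast
    have "\<not> a dvd d + x" "\<not> a dvd d + - x"
      using x(2) ad by (simp_all only: dvd_add_right_iff dvd_minus_iff not_False_eq_True)
    then have b: "b dvd d + x" "b dvd d + - x" using cov x neg by blast+
    then have "b dvd (d + x) + (d + - x)" by (rule dvd_add)
    then have "b dvd d" using b2[of d] by simp
    then have bx: "b dvd x" using b(1) by (simp only: dvd_add_right_iff)
    have ay: "a dvd y" using cov[OF y(1)] y(2) ad \<open>b dvd d\<close> by (simp add: dvd_add_right_iff)
    have "a dvd d + (x + y) \<or> b dvd d + (x + y)" using cov add x y by blast
    then have "a dvd x + y \<or> b dvd x + y" using ad \<open>b dvd d\<close> by (simp only: dvd_add_right_iff)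
    then show False using x y bx ay by (simp add: dvd_add_left_iff dvd_add_right_iff)
  qed
  show ?thesis
  proof (cases "a dvd d")
    case True
    then show ?thesis using *[of a b] cover half by blast
  next
    case False
    then have "b dvd d" using cover[OF \<open>0 \<in> L\<close>] by simp
    then show ?thesis using *[of b a] cover half by blast
  qed
qed

lemma additive_of_int_mult:
  assumes "\<And>x y. A (x + y) = A x + A (y :: eis)"
  shows "A (of_int n * x) = of_int n * (A x :: eis)"
proof -
  interpret additive A by unfold_locales (rule assms)
  have nat: "A (of_nat m * x) = of_nat m * A x" for m
    by (induction m) (simp_all add: zero add distrib_right)
  show ?thesis
  proof (cases "n \<ge> 0")
    case True
    then show ?thesis using nat[of "nat n"] by simp
  next
    case False
    then have "of_int n = - (of_nat (nat (- n)) :: eis)" by simp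
    then show ?thesis using nat[of "nat (- n)"] by (simp only: minus mult_minus_left)
  qed
qed

text \<open>Every additive map of L is a sum \<alpha> z + \<beta> cnj z after
multiplication by \<rho> - cnj \<rho>; the two coefficients are found by evaluation at 1 and
\<rho>.\<close>

lemma additive_decomposition:
  assumes "\<And>x y. B (x + y) = B x + B (y :: eis)"
  shows "(eis_omega - eis_cnj eis_omega) * B z =
    (B eis_omega - eis_cnj eis_omega * B 1) * z + (eis_omega * B 1 - B eis_omega) * eis_cnj z"
proof -
  obtain a b where z: "z = Eis a b" by (cases z)
  have z': "z = of_int a * 1 + of_int b * eis_omega" by (simp add: z eis_of_int eis_omega_def)
  have Bz: "B z = of_int a * B 1 + of_int b * B eis_omega"
    unfolding z' assms using additive_of_int_mult[OF assms] by metis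
  obtain c d e f where *: "B 1 = Eis c d" "B eis_omega = Eis e f" by (cases "B 1"; cases "B eis_omega")
  show ?thesis unfolding Bz * unfolding z by (simp add: eis_of_int eis_omega_def algebra_simps)
qed

section \<open>Rigidity\<close>

text \<open>The symmetries of the hexagonal lattice that fix the origin.\<close>

definition hexagonal :: "(eis \<Rightarrow> eis) \<Rightarrow> bool" where
  "hexagonal A \<longleftrightarrow> (\<exists>e. e dvd 1 \<and> (A = (\<lambda>z. e * z) \<or> A = (\<lambda>z. e * eis_cnj z)))"

text \<open>A prime that divides a power of p is associated to p.\<close>

lemma prime_power_dvd_prime_power:
  assumes "prime_elem (p :: eis)" "prime_elem q" "q dvd p ^ n"
  shows "p ^ k dvd q ^ k"
proof -
  have "q dvd p" using assms prime_elem_dvd_power by blast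
  then show ?thesis using prime_dvd_prime[OF assms(1,2)] dvd_power_same by blast
qed

lemma odd_prime_power_half:
  assumes "prime_elem (p :: eis)" "\<not> p dvd 2" "p ^ k dvd 2 * x"
  shows "p ^ k dvd x"
  using prime_power_dvd_mult assms by blast

text \<open>The test sets for the rigidity argument: together with G they avoid only what they have
to, the class of x modulo p^k and modulo q^k. Two primes are needed for
\<open>endomorphism_linear_part\<close>; elsewhere q = p.\<close>

lemma covering_test_set:
  assumes k: "k \<ge> 2" and p: "prime_elem p" and q: "prime_elem q"
    and D: "finite D" and G: "finite G" "admissible k G"
    and miss: "\<And>g. g \<in> G \<Longrightarrow> \<not> p ^ k dvd g - x \<and> \<not> q ^ k dvd g - x"
  obtains T where "finite T" "G \<union> T \<in> hull_of_kfree k"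
    "\<forall>t\<in>T. t \<notin> D" "\<forall>t\<in>T. \<forall>t'\<in>T. t' \<noteq> t \<longrightarrow> t' - t \<notin> D"
    "\<forall>y. \<not> p ^ k dvd y - x \<longrightarrow> \<not> q ^ k dvd y - x \<longrightarrow> (\<exists>t\<in>T. p ^ k * q ^ k dvd t - y)"
proof -
  define w where "w = p ^ k * q ^ k"
  have w0: "w \<noteq> 0" using p q by (auto simp: w_def)
  have pw: "p ^ k dvd w" "q ^ k dvd w" by (simp_all add: w_def)
  have k0: "k > 0" using k by simp
  have cong: "r ^ k dvd y - x \<longleftrightarrow> r ^ k dvd z - x" if "r ^ k dvd w" "w dvd y - z" for r y z
  proof -
    have "y - x = (y - z) + (z - x)" by simp
    moreover have "r ^ k dvd y - z" using that dvd_trans by blast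
    ultimately show ?thesis by (metis dvd_add_right_iff)
  qed
  obtain R where R: "finite R" "\<And>y. \<exists>c\<in>R. w dvd y - c" using finite_residue_system[OF w0] by blast
  define C where "C = {c \<in> R. \<not> p ^ k dvd c - x \<and> \<not> q ^ k dvd c - x}"
  have finC: "finite C" using R(1) by (simp add: C_def)
  have G_misses: "\<exists>c. \<forall>g\<in>G. \<not> r ^ k dvd g - c" if "prime_elem r" for r :: eis
    using G(2) that unfolding admissible_def by blast
  obtain T where T: "finite T" "\<forall>c\<in>C. \<exists>t\<in>T. w dvd t - c" "\<forall>t\<in>T. \<exists>c\<in>C. w dvd t - c"
    "\<forall>t\<in>T. t \<notin> D" "\<forall>t\<in>T. \<forall>t'\<in>T. t' \<noteq> t \<longrightarrow> t' - t \<notin> D"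
    "\<forall>r. prime_elem r \<longrightarrow> \<not> r dvd w \<longrightarrow> (\<exists>c. \<forall>u\<in>G \<union> T. \<not> r ^ k dvd u - c)"
    by (rule sparse_test_set[OF k0 w0 finC D G(1)]) (erule G_misses, rule that)
  have Tx: "\<not> p ^ k dvd t - x" "\<not> q ^ k dvd t - x" if t: "t \<in> T" for t
    using T(3) t cong[OF pw(1)] cong[OF pw(2)] unfolding C_def by blast+
  have "admissible k (G \<union> T)"
    unfolding admissible_def
  proof (intro allI impI)
    fix r :: eis assume r: "prime_elem r"
    show "\<exists>c. \<forall>u\<in>G \<union> T. \<not> r ^ k dvd u - c"
    proof (cases "r dvd w")
      case True
      then have "r dvd p ^ k \<or> r dvd q ^ k" using r prime_elem_dvd_multD unfolding w_def by blast
      then have "p ^ k dvd r ^ k \<or> q ^ k dvd r ^ k" using prime_power_dvd_prime_power p q r by blast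
      then have "\<forall>u\<in>G \<union> T. \<not> r ^ k dvd u - x" using Tx miss dvd_trans by (metis Un_iff)
      then show ?thesis by blast
    next
      case False
      then show ?thesis using T(6) r by blast
    qed
  qed
  then have TX: "G \<union> T \<in> hull_of_kfree k" using finite_admissible_in_hull k T(1) G(1) by blast
  have hit: "\<exists>t\<in>T. w dvd t - y" if y: "\<not> p ^ k dvd y - x" "\<not> q ^ k dvd y - x" for y
  proof -
    obtain c where c: "c \<in> R" "w dvd y - c" using R(2) by blast
    have "c \<in> C" using cong[OF pw(1) c(2)] cong[OF pw(2) c(2)] y c(1) unfolding C_def by blast
    then obtain t where t: "t \<in> T" "w dvd t - c" using T(2) by blast
    have "w dvd (t - c) - (y - c)" by (rule dvd_diff[OF t(2) c(2)])
    then show ?thesis using t(1) by auto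
  qed
  show ?thesis
    by (rule that[OF T(1) TX T(4,5)]) (use hit in \<open>simp add: w_def\<close>)
qed

text \<open>The two alternatives say \<beta> = 0 or \<alpha> = 0 in the decomposition of
\<open>additive_decomposition\<close> for the inverse B of A, so that B is linear or conjugate
linear. Suppose both coefficients are non-zero and choose p dividing neither \<alpha> cnj \<alpha>
nor \<beta>. The test set shows that a coset of {x : p^k dvd A x} consists of multiples of
p^k and of (cnj p)^k. So this group consists of multiples of one of them, and evaluation at
B(p^k) gives p^k dvd \<beta> or (cnj p)^k dvd \<alpha>.\<close>

lemma endomorphism_linear_part:
  assumes k: "k \<ge> 2" and eq: "equivariant_endo k A \<Phi>" and s: "s \<in> \<Phi> {0}"
    and add: "\<And>x y. A (x + y) = A x + A y" and AB: "\<And>x. A (B x) = x" and BA: "\<And>x. B (A x) = x"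
  shows "eis_omega * B 1 = B eis_omega \<or> B eis_omega = eis_cnj eis_omega * B 1"
proof (rule ccontr)
  assume contra: "\<not> ?thesis"
  have addB: "B (x + y) = B x + B y" for x y by (metis AB BA add)
  \<comment> \<open>The coefficients of \<open>additive_decomposition\<close>.\<close>
  define \<alpha> \<beta> where "\<alpha> = B eis_omega - eis_cnj eis_omega * B 1" and "\<beta> = eis_omega * B 1 - B eis_omega"
  have "\<alpha> * eis_cnj \<alpha> * \<beta> \<noteq> 0"
    using contra by (auto simp: \<alpha>_def \<beta>_def) (metis eis_cnj_0 eis_cnj_cnj right_minus_eq)
  then obtain p where p: "prime_elem p" "\<not> p dvd \<alpha> * eis_cnj \<alpha> * \<beta>" "\<not> p dvd eis_cnj p" "\<not> p dvd 2"
    using split_prime_avoiding by blast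
  define q where "q = eis_cnj p"
  have q: "prime_elem q" "\<not> q dvd p" "\<not> q dvd 2"
  proof -
    show "prime_elem q" using prime_elem_cnj p(1) by (simp add: q_def)
    show "\<not> q dvd p" using p(3) by (metis eis_cnj_cnj eis_cnj_dvd q_def)
    have "eis_cnj 2 = 2" by (metis eis_cnj_1 eis_cnj_add one_add_one)
    then show "\<not> q dvd 2" using p(4) by (metis eis_cnj_dvd q_def)
  qed
  have nd: "\<not> p dvd \<beta>" "\<not> q dvd \<alpha>"
  proof -
    show "\<not> p dvd \<beta>" using p(2) dvd_mult by blast
    have "\<not> p dvd eis_cnj \<alpha>" using p(2) by (metis dvd_mult dvd_mult2)
    then show "\<not> q dvd \<alpha>" by (metis eis_cnj_cnj eis_cnj_dvd q_def)
  qed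
  define w where "w = p ^ k * q ^ k"
  have w: "w = of_int (eis_norm p ^ k)"
    by (simp only: w_def q_def power_mult_distrib[symmetric] eis_mult_cnj of_int_power)
  have pw: "p ^ k dvd w" by (simp add: w_def)
  obtain D where D: "finite D" "\<And>T t. T \<in> hull_of_kfree k \<Longrightarrow> t \<in> T \<Longrightarrow>
      (\<And>t'. t' \<in> T \<Longrightarrow> t' \<noteq> t \<Longrightarrow> t' - t \<notin> D) \<Longrightarrow> A t + s \<in> \<Phi> T"
    using image_of_sparse[OF k eq s] by metis
  have k0: "k > 0" using k by simp
  have empty: "admissible k {}" by (simp add: admissible_def)
  obtain T where T: "finite T" "{} \<union> T \<in> hull_of_kfree k"
    "\<forall>t\<in>T. t \<notin> D" "\<forall>t\<in>T. \<forall>t'\<in>T. t' \<noteq> t \<longrightarrow> t' - t \<notin> D"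
    "\<forall>y. \<not> p ^ k dvd y - 0 \<longrightarrow> \<not> q ^ k dvd y - 0 \<longrightarrow> (\<exists>t\<in>T. p ^ k * q ^ k dvd t - y)"
    using covering_test_set[OF k p(1) q(1) D(1) finite.emptyI empty, of 0] by (metis empty_iff)
  have TX: "T \<in> hull_of_kfree k" using T(2) by simp
  have "admissible k (\<Phi> T)" using TX eq hull_admissible k0 unfolding equivariant_endo_def by blast
  then obtain c where c: "\<And>u. u \<in> \<Phi> T \<Longrightarrow> \<not> p ^ k dvd u - c" using p(1) unfolding admissible_def by blast
  \<comment> \<open>The class c modulo p^k that is missed by A(T) + s is pulled back to a coset
    of {x : p^k dvd A x} that T misses.\<close>
  define d where "d = B (c - s)"
  have miss: "\<not> p ^ k dvd A (t - d)" if t: "t \<in> T" for t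
  proof -
    have "A t + s \<in> \<Phi> T" using D(2)[OF TX t] T(4) t by blast
    then have "\<not> p ^ k dvd A t + s - c" by (rule c)
    moreover have "A t = A (t - d) + A d" using add[of "t - d" d] by simp
    moreover have "A d = c - s" by (simp add: d_def AB)
    ultimately show ?thesis by simp
  qed
  define L where "L = {x. p ^ k dvd A x}"
  have A0: "A 0 = 0" using add[of 0 0] by simp
  have Aneg: "A (- x) = - A x" for x using add[of x "- x"] A0 by (simp add: eq_neg_iff_add_eq_0 add.commute)
  have cover: "p ^ k dvd d + x \<or> q ^ k dvd d + x" if x: "x \<in> L" for x
  proof (rule ccontr)
    assume no: "\<not> ?thesis"
    \<comment> \<open>The modulus w is a rational integer, so A respects congruences modulo
      w.\<close>
    then obtain t where t: "t \<in> T" "w dvd t - (d + x)" using T(5) by (auto simp: w_def)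
    then obtain y where "t - (d + x) = w * y" by blast
    then have "t - d = x + w * y" by (simp add: algebra_simps)
    then have "A (t - d) = A x + w * A y" by (simp only: add w additive_of_int_mult[OF add])
    moreover have "p ^ k dvd A x + w * A y" using x pw by (intro dvd_add) (auto simp: L_def)
    ultimately show False using miss[OF t(1)] by simp
  qed
  have "(\<forall>x\<in>L. p ^ k dvd x) \<or> (\<forall>x\<in>L. q ^ k dvd x)"
  proof (rule subgroup_in_union[of L _ d])
    show "x + y \<in> L" if "x \<in> L" "y \<in> L" for x y using that by (simp add: L_def add)
    show "- x \<in> L" if "x \<in> L" for x using that by (simp add: L_def Aneg)
    show "0 \<in> L" by (simp add: L_def A0)
    show "p ^ k dvd d + x \<or> q ^ k dvd d + x" if "x \<in> L" for x using cover that .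
    show "p ^ k dvd x" if "p ^ k dvd 2 * x" for x using odd_prime_power_half p that by blast
    show "q ^ k dvd x" if "q ^ k dvd 2 * x" for x using odd_prime_power_half q that by blast
  qed
  moreover have "B (p ^ k) \<in> L" by (simp add: L_def AB)
  ultimately have "p ^ k dvd B (p ^ k) \<or> q ^ k dvd B (p ^ k)" by blast
  moreover have dec: "(eis_omega - eis_cnj eis_omega) * B (p ^ k) = \<alpha> * p ^ k + \<beta> * q ^ k"
    using additive_decomposition[of B, OF addB] by (simp only: \<alpha>_def \<beta>_def q_def eis_cnj_power)
  ultimately have "p ^ k dvd \<alpha> * p ^ k + \<beta> * q ^ k \<or> q ^ k dvd \<alpha> * p ^ k + \<beta> * q ^ k"
    by (metis dvd_mult)
  then have "p ^ k dvd q ^ k * \<beta> \<or> q ^ k dvd p ^ k * \<alpha>"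
    by (metis dvd_add_left_iff dvd_add_right_iff dvd_triv_right mult.commute)
  then have "p ^ k dvd \<beta> \<or> q ^ k dvd \<alpha>"
    using prime_power_dvd_mult[OF p(1)] prime_power_dvd_mult[OF q(1)] p q
    by (metis prime_elem_dvd_power q_def)
  then show False using nd k0 by (metis dvd_power dvd_trans)
qed

text \<open>T represents all classes modulo p^k except that of 0. A class c is met by
T + s0 unless c \<equiv> s0, and then it is met by T + s1.\<close>

lemma image_of_singleton_unique:
  assumes k: "k \<ge> 2" and eq: "equivariant_endo k (\<lambda>t. t) \<Phi>" and s: "s0 \<in> \<Phi> {0}" "s1 \<in> \<Phi> {0}"
  shows "s0 = s1"
proof (rule ccontr)
  assume "s0 \<noteq> s1"
  then obtain p where p: "prime_elem p" "\<not> p dvd s1 - s0" using prime_avoiding[of "s1 - s0"] by auto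
  have k0: "k > 0" using k by simp
  obtain D0 where D0: "finite D0" "\<And>T t. T \<in> hull_of_kfree k \<Longrightarrow> t \<in> T \<Longrightarrow>
      (\<And>t'. t' \<in> T \<Longrightarrow> t' \<noteq> t \<Longrightarrow> t' - t \<notin> D0) \<Longrightarrow> t + s0 \<in> \<Phi> T"
    using image_of_sparse[OF k eq s(1)] by metis
  obtain D1 where D1: "finite D1" "\<And>T t. T \<in> hull_of_kfree k \<Longrightarrow> t \<in> T \<Longrightarrow>
      (\<And>t'. t' \<in> T \<Longrightarrow> t' \<noteq> t \<Longrightarrow> t' - t \<notin> D1) \<Longrightarrow> t + s1 \<in> \<Phi> T"
    using image_of_sparse[OF k eq s(2)] by metis
  have finD: "finite (D0 \<union> D1)" using D0 D1 by simp
  have empty: "admissible k {}" by (simp add: admissible_def)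
  obtain T where T: "finite T" "{} \<union> T \<in> hull_of_kfree k"
    "\<forall>t\<in>T. t \<notin> D0 \<union> D1" "\<forall>t\<in>T. \<forall>t'\<in>T. t' \<noteq> t \<longrightarrow> t' - t \<notin> D0 \<union> D1"
    "\<forall>y. \<not> p ^ k dvd y - 0 \<longrightarrow> \<not> p ^ k dvd y - 0 \<longrightarrow> (\<exists>t\<in>T. p ^ k * p ^ k dvd t - y)"
    using covering_test_set[OF k p(1) p(1) finD finite.emptyI empty, of 0] by (metis empty_iff)
  have TX: "T \<in> hull_of_kfree k" using T(2) by simp
  have hit: "\<exists>t\<in>T. p ^ k dvd t - y" if "\<not> p ^ k dvd y" for y
    using T(5) that by (metis diff_zero dvd_mult_left)
  have "admissible k (\<Phi> T)" using TX eq hull_admissible k0 unfolding equivariant_endo_def by blast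
  then obtain c where c: "\<And>u. u \<in> \<Phi> T \<Longrightarrow> \<not> p ^ k dvd u - c" using p(1) unfolding admissible_def by blast
  have mem: "t + s0 \<in> \<Phi> T" "t + s1 \<in> \<Phi> T" if t: "t \<in> T" for t
    using D0(2)[OF TX t] D1(2)[OF TX t] T(4) t by blast+
  show False
  proof (cases "p ^ k dvd c - s0")
    case False
    then obtain t where t: "t \<in> T" "p ^ k dvd t - (c - s0)" using hit by blast
    have "t + s0 - c = t - (c - s0)" by simp
    then show False using c[OF mem(1)[OF t(1)]] t(2) by metis
  next
    case True
    have "\<not> p ^ k dvd c - s1"
    proof
      assume "p ^ k dvd c - s1"
      with True have "p ^ k dvd (c - s0) - (c - s1)" by (rule dvd_diff)
      then have "p ^ k dvd s1 - s0" by simp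
      then show False using p(2) k0 dvd_power dvd_trans by blast
    qed
    then obtain t where t: "t \<in> T" "p ^ k dvd t - (c - s1)" using hit by blast
    have "t + s1 - c = t - (c - s1)" by simp
    then show False using c[OF mem(2)[OF t(1)]] t(2) by metis
  qed
qed

text \<open>An extra point x of the image would fill the one class modulo p^k that G \<union> T
has to leave free.\<close>

lemma image_of_finite_subset:
  assumes k: "k \<ge> 2" and eq: "equivariant_endo k (\<lambda>t. t) \<Phi>" and s: "\<Phi> {0} = {0}"
    and G: "finite G" "G \<in> hull_of_kfree k"
  shows "\<Phi> G \<subseteq> G"
proof (rule ccontr)
  assume "\<not> \<Phi> G \<subseteq> G"
  then obtain x where x: "x \<in> \<Phi> G" "x \<notin> G" by blast
  then have "(\<Prod>g\<in>G. g - x) \<noteq> 0" using G(1) by auto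
  then obtain p where p: "prime_elem p" "\<not> p dvd (\<Prod>g\<in>G. g - x)" using prime_avoiding by blast
  have k0: "k > 0" using k by simp
  have pg: "\<not> p ^ k dvd g - x" if "g \<in> G" for g
  proof
    assume "p ^ k dvd g - x"
    then have "p dvd g - x" using k0 dvd_power dvd_trans by blast
    then show False using p(2) dvd_prodI[OF G(1) that, of "\<lambda>g. g - x"] dvd_trans by blast
  qed
  have "0 \<in> \<Phi> {0}" using s by simp
  then obtain D0 where D0: "finite D0" "\<And>T t. T \<in> hull_of_kfree k \<Longrightarrow> t \<in> T \<Longrightarrow>
      (\<And>t'. t' \<in> T \<Longrightarrow> t' \<noteq> t \<Longrightarrow> t' - t \<notin> D0) \<Longrightarrow> t + 0 \<in> \<Phi> T"
    using image_of_sparse[OF k eq] by metis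
  obtain Bx where Bx: "finite Bx" "\<And>U. U \<in> hull_of_kfree k \<Longrightarrow> U \<inter> Bx = G \<inter> Bx \<Longrightarrow> x \<in> \<Phi> U"
    using eq G(2) x(1) unfolding equivariant_endo_def continuous_on_hull_def by metis
  \<comment> \<open>Away from D, adding T changes neither the window that puts x into the image
    nor, seen from a point of T, the window that puts this point into the image.\<close>
  define D where "D = D0 \<union> Bx \<union> (\<lambda>(g, d). g - d) ` (G \<times> D0)"
  have finD: "finite D" using D0 Bx G by (simp add: D_def)
  have admG: "admissible k G" using hull_admissible G(2) k0 by blast
  have pg2: "\<not> p ^ k dvd g - x \<and> \<not> p ^ k dvd g - x" if "g \<in> G" for g using pg that by blast
  obtain T where T: "finite T" "G \<union> T \<in> hull_of_kfree k"
    "\<forall>t\<in>T. t \<notin> D" "\<forall>t\<in>T. \<forall>t'\<in>T. t' \<noteq> t \<longrightarrow> t' - t \<notin> D"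
    "\<forall>y. \<not> p ^ k dvd y - x \<longrightarrow> \<not> p ^ k dvd y - x \<longrightarrow> (\<exists>t\<in>T. p ^ k * p ^ k dvd t - y)"
    using covering_test_set[OF k p(1) p(1) finD G(1) admG pg2] by metis
  note TX = T(2)
  have "admissible k (\<Phi> (G \<union> T))" using TX eq hull_admissible k0 unfolding equivariant_endo_def by blast
  then obtain c where c: "\<And>u. u \<in> \<Phi> (G \<union> T) \<Longrightarrow> \<not> p ^ k dvd u - c" using p(1) unfolding admissible_def by blast
  have "(G \<union> T) \<inter> Bx = G \<inter> Bx" using T(3) by (auto simp: D_def)
  then have "x \<in> \<Phi> (G \<union> T)" using Bx(2) TX by blast
  then have "\<not> p ^ k dvd x - c" by (rule c)
  then have cx: "\<not> p ^ k dvd c - x" by (metis dvd_minus_iff minus_diff_eq)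
  obtain t where t: "t \<in> T" "p ^ k dvd t - c" using T(5) cx by (metis dvd_mult_left)
  have "t + 0 \<in> \<Phi> (G \<union> T)"
  proof (rule D0(2)[OF TX])
    fix t' assume t': "t' \<in> G \<union> T" "t' \<noteq> t"
    show "t' - t \<notin> D0"
    proof (cases "t' \<in> T")
      case True
      then show ?thesis using T(4) t(1) t'(2) unfolding D_def by blast
    next
      case False
      then have "t' \<in> G" using t' by blast
      show ?thesis
      proof
        assume "t' - t \<in> D0"
        then have "t' - (t' - t) \<in> D" using \<open>t' \<in> G\<close> unfolding D_def by (intro UnI2 image_eqI[of _ _ "(t', t' - t)"]) auto
        then show False using T(3) t(1) by simp
      qed
    qed
  qed (use t in blast)
  then show False using c t(2) by simp
qed

lemma hexagonal_of_linear_part: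
  assumes add: "\<And>x y. A (x + y) = A x + A y" and AB: "\<And>x. A (B x) = x" and BA: "\<And>x. B (A x) = x"
    and B: "eis_omega * B 1 = B eis_omega \<or> B eis_omega = eis_cnj eis_omega * B 1"
  shows "hexagonal A"
proof -
  let ?d = "eis_omega - eis_cnj eis_omega"
  have addB: "B (x + y) = B x + B y" for x y by (metis AB BA add)
  have d: "?d \<noteq> 0" by (simp add: eis_omega_def zero_eis_def)
  note dec = additive_decomposition[of B, OF addB]
  from B show ?thesis
  proof
    assume "eis_omega * B 1 = B eis_omega"
    then have "?d * B z = ?d * (B 1 * z)" for z using dec[of z] by (simp add: algebra_simps)
    then have Bz: "B z = B 1 * z" for z using d by (metis mult_cancel_left)
    have e: "B 1 * A 1 = 1" using Bz[of "A 1"] BA by simp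
    then have "A 1 dvd 1" by (metis dvd_triv_right)
    moreover have "A z = A 1 * z" for z
    proof -
      have "B (A 1 * z) = (B 1 * A 1) * z" by (subst Bz) (simp add: mult.assoc)
      then have "B (A 1 * z) = z" using e by simp
      then show ?thesis using AB by metis
    qed
    ultimately show ?thesis unfolding hexagonal_def by blast
  next
    assume "B eis_omega = eis_cnj eis_omega * B 1"
    then have "?d * B z = ?d * (B 1 * eis_cnj z)" for z using dec[of z] by (simp add: algebra_simps)
    then have Bz: "B z = B 1 * eis_cnj z" for z using d by (metis mult_cancel_left)
    have e: "B 1 * eis_cnj (A 1) = 1" using Bz[of "A 1"] BA by simp
    then have "eis_cnj (A 1) dvd eis_cnj 1" by (metis dvd_triv_right eis_cnj_1)
    then have "A 1 dvd 1" by (simp only: eis_cnj_dvd)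
    moreover have "A z = A 1 * eis_cnj z" for z
    proof -
      have "B (A 1 * eis_cnj z) = (B 1 * eis_cnj (A 1)) * z"
        by (subst Bz) (simp add: eis_cnj_mult mult.assoc)
      then have "B (A 1 * eis_cnj z) = z" using e by simp
      then show ?thesis using AB by metis
    qed
    ultimately show ?thesis unfolding hexagonal_def by blast
  qed
qed

lemma hexagonal_id: "hexagonal (\<lambda>z. z)"
proof -
  have "(\<lambda>t. t) = (\<lambda>z::eis. 1 * z)" by (rule ext) simp
  then show ?thesis unfolding hexagonal_def using one_dvd by blast
qed

lemma hexagonal_add: "hexagonal A \<Longrightarrow> A (x + y) = A x + A y"
  by (auto simp: hexagonal_def eis_cnj_add distrib_left)

lemma hexagonal_diff: "hexagonal A \<Longrightarrow> A (x - y) = A x - A y"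
  by (auto simp: hexagonal_def eis_cnj_diff right_diff_distrib)

lemma hexagonal_0: "hexagonal A \<Longrightarrow> A 0 = 0"
  by (auto simp: hexagonal_def)

lemma hexagonal_inverse:
  assumes "hexagonal A"
  obtains B where "hexagonal B" "\<And>x. A (B x) = x" "\<And>x. B (A x) = x"
proof -
  obtain e where e: "e dvd 1" "A = (\<lambda>z. e * z) \<or> A = (\<lambda>z. e * eis_cnj z)"
    using assms by (auto simp: hexagonal_def)
  obtain f where f: "1 = e * f" using e(1) by blast
  have cf: "eis_cnj e * eis_cnj f = 1" by (metis eis_cnj_1 eis_cnj_mult f)
  have u: "f dvd 1" "eis_cnj f dvd 1" using f cf by (metis dvd_triv_right)+
  from e(2) show ?thesis
  proof
    assume A: "A = (\<lambda>z. e * z)"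
    show ?thesis
    proof (rule that[of "\<lambda>z. f * z"])
      show "hexagonal (\<lambda>z. f * z)" using u unfolding hexagonal_def by blast
      show "A (f * x) = x" "f * A x = x" for x unfolding A by (metis f mult.assoc mult.commute mult_1)+
    qed
  next
    assume A: "A = (\<lambda>z. e * eis_cnj z)"
    show ?thesis
    proof (rule that[of "\<lambda>z. eis_cnj f * eis_cnj z"])
      show "hexagonal (\<lambda>z. eis_cnj f * eis_cnj z)" using u unfolding hexagonal_def by blast
      show "A (eis_cnj f * eis_cnj x) = x" for x
        unfolding A eis_cnj_mult eis_cnj_cnj by (metis f mult.assoc mult_1)
      show "eis_cnj f * eis_cnj (A x) = x" for x
        unfolding A eis_cnj_mult eis_cnj_cnj by (metis cf mult.assoc mult.commute mult_1)
    qed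
  qed
qed

lemma kfree_unit_mult: "e dvd 1 \<Longrightarrow> e * z \<in> kfree k \<longleftrightarrow> z \<in> kfree k"
proof -
  assume "e dvd 1"
  then obtain f where f: "1 = e * f" by blast
  have "q dvd e * z \<longleftrightarrow> q dvd z" for q
    by (metis dvd_mult f mult.assoc mult.commute mult_1)
  then show ?thesis by (simp add: kfree_def)
qed

lemma kfree_cnj: "eis_cnj z \<in> kfree k \<longleftrightarrow> z \<in> kfree k"
proof -
  have *: "eis_cnj z \<in> kfree k" if "z \<in> kfree k" for z
    unfolding kfree_def
  proof (intro CollectI allI impI)
    fix p :: eis assume p: "prime_elem p"
    then have "\<not> eis_cnj p ^ k dvd z" using that prime_elem_cnj by (auto simp: kfree_def)
    then show "\<not> p ^ k dvd eis_cnj z" by (metis eis_cnj_cnj eis_cnj_dvd eis_cnj_power)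
  qed
  show ?thesis using *[of z] *[of "eis_cnj z"] by auto
qed

lemma kfree_hexagonal: "hexagonal A \<Longrightarrow> A z \<in> kfree k \<longleftrightarrow> z \<in> kfree k"
  by (auto simp: hexagonal_def kfree_unit_mult kfree_cnj)

lemma mem_affine_image:
  assumes "hexagonal A" "\<And>x. A (B x) = x" "\<And>x. B (A x) = x"
  shows "x \<in> (\<lambda>u. A u + c) ` U \<longleftrightarrow> B (x - c) \<in> U"
proof
  assume "x \<in> (\<lambda>u. A u + c) ` U"
  then obtain u where "u \<in> U" "x = A u + c" by blast
  then show "B (x - c) \<in> U" using assms(3) by simp
next
  assume "B (x - c) \<in> U"
  then have "A (B (x - c)) + c \<in> (\<lambda>u. A u + c) ` U" by blast
  then show "x \<in> (\<lambda>u. A u + c) ` U" using assms(2) by simp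
qed

lemma equivariant_affine:
  assumes A: "hexagonal A"
  shows "equivariant_endo k A (\<lambda>U. (\<lambda>u. A u + c) ` U)"
proof -
  obtain B where B: "hexagonal B" "\<And>x. A (B x) = x" "\<And>x. B (A x) = x" using hexagonal_inverse[OF A] by blast
  note mem = mem_affine_image[OF A B(2,3)]
  have "(\<lambda>u. A u + c) ` U \<in> hull_of_kfree k" if U: "U \<in> hull_of_kfree k" for U
    unfolding hull_of_kfree_def
  proof (intro CollectI allI impI)
    fix S :: "eis set" assume "finite S"
    then have "finite ((\<lambda>b. B (b - c)) ` S)" by simp
    then obtain t where t: "\<forall>b\<in>(\<lambda>b. B (b - c)) ` S. b \<in> U \<longleftrightarrow> b - t \<in> kfree k"
      using U unfolding hull_of_kfree_def by blast
    have "b \<in> (\<lambda>u. A u + c) ` U \<longleftrightarrow> b - (A t + c) \<in> kfree k" if "b \<in> S" for b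
    proof -
      have "B (b - c) \<in> U \<longleftrightarrow> B (b - c) - t \<in> kfree k" using t that by blast
      moreover have "A (B (b - c) - t) = b - (A t + c)" by (simp add: hexagonal_diff[OF A] B(2))
      ultimately show ?thesis unfolding mem by (metis kfree_hexagonal[OF A])
    qed
    then show "\<exists>t. \<forall>b\<in>S. b \<in> (\<lambda>u. A u + c) ` U \<longleftrightarrow> b - t \<in> kfree k" by blast
  qed
  moreover have "continuous_on_hull k (\<lambda>U. (\<lambda>u. A u + c) ` U)"
    unfolding continuous_on_hull_def mem
  proof (intro ballI allI)
    fix U x
    show "\<exists>S. finite S \<and> (\<forall>U'\<in>hull_of_kfree k. U' \<inter> S = U \<inter> S \<longrightarrow> (B (x - c) \<in> U') = (B (x - c) \<in> U))"
      by (rule exI[of _ "{B (x - c)}"]) blast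
  qed
  moreover have "(\<lambda>u. A u + c) ` (\<lambda>u. u - t) ` U = (\<lambda>u. u - A t) ` (\<lambda>u. A u + c) ` U" for U t
    unfolding image_image by (simp add: hexagonal_diff[OF A] algebra_simps)
  ultimately show ?thesis unfolding equivariant_endo_def by blast
qed

lemma equivariant_endo_comp:
  assumes \<Phi>: "equivariant_endo k A \<Phi>" and \<Psi>: "equivariant_endo k B \<Psi>"
  shows "equivariant_endo k (\<lambda>t. A (B t)) (\<lambda>U. \<Phi> (\<Psi> U))"
proof -
  have "continuous_on_hull k (\<lambda>U. \<Phi> (\<Psi> U))"
    unfolding continuous_on_hull_def
  proof (intro ballI allI)
    fix U x assume U: "U \<in> hull_of_kfree k"
    then have "\<Psi> U \<in> hull_of_kfree k" using \<Psi> by (simp add: equivariant_endo_def)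
    then obtain S where S: "finite S" "\<And>U'. U' \<in> hull_of_kfree k \<Longrightarrow> U' \<inter> S = \<Psi> U \<inter> S \<Longrightarrow> (x \<in> \<Phi> U' \<longleftrightarrow> x \<in> \<Phi> (\<Psi> U))"
      using \<Phi> unfolding equivariant_endo_def continuous_on_hull_def by meson
    have "\<forall>s. \<exists>W. finite W \<and> (\<forall>U'\<in>hull_of_kfree k. U' \<inter> W = U \<inter> W \<longrightarrow> (s \<in> \<Psi> U' \<longleftrightarrow> s \<in> \<Psi> U))"
      using \<Psi> U unfolding equivariant_endo_def continuous_on_hull_def by blast
    then obtain W where W: "\<And>s. finite (W s)"
      "\<And>s U'. U' \<in> hull_of_kfree k \<Longrightarrow> U' \<inter> W s = U \<inter> W s \<Longrightarrow> (s \<in> \<Psi> U' \<longleftrightarrow> s \<in> \<Psi> U)" by metis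
    show "\<exists>S. finite S \<and> (\<forall>U'\<in>hull_of_kfree k. U' \<inter> S = U \<inter> S \<longrightarrow> (x \<in> \<Phi> (\<Psi> U') \<longleftrightarrow> x \<in> \<Phi> (\<Psi> U)))"
    proof (intro exI conjI ballI impI)
      show "finite (\<Union>s\<in>S. W s)" using S(1) W(1) by blast
      fix U' assume U': "U' \<in> hull_of_kfree k" "U' \<inter> (\<Union>s\<in>S. W s) = U \<inter> (\<Union>s\<in>S. W s)"
      have "s \<in> \<Psi> U' \<longleftrightarrow> s \<in> \<Psi> U" if "s \<in> S" for s
        using W(2)[OF U'(1)] U'(2) that by blast
      then have "\<Psi> U' \<inter> S = \<Psi> U \<inter> S" by blast
      moreover have "\<Psi> U' \<in> hull_of_kfree k" using \<Psi> U' by (simp add: equivariant_endo_def)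
      ultimately show "x \<in> \<Phi> (\<Psi> U') \<longleftrightarrow> x \<in> \<Phi> (\<Psi> U)" using S(2) by blast
    qed
  qed
  then show ?thesis using \<Phi> \<Psi> unfolding equivariant_endo_def by simp
qed

lemma identity_if_identity_on_finite:
  assumes k: "k \<ge> 2" and eq: "equivariant_endo k A \<Phi>"
    and fin: "\<And>F. finite F \<Longrightarrow> F \<in> hull_of_kfree k \<Longrightarrow> \<Phi> F = F" and U: "U \<in> hull_of_kfree k"
  shows "\<Phi> U = U"
proof (rule Set.set_eqI)
  fix x
  obtain B where B: "finite B" "\<And>U'. U' \<in> hull_of_kfree k \<Longrightarrow> U' \<inter> B = U \<inter> B \<Longrightarrow> (x \<in> \<Phi> U' \<longleftrightarrow> x \<in> \<Phi> U)"
    using eq U unfolding equivariant_endo_def continuous_on_hull_def by meson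
  define F where "F = U \<inter> insert x B"
  have F: "finite F" "F \<in> hull_of_kfree k"
    using B(1) finite_subset_in_hull[OF k U, of F] by (auto simp: F_def)
  have "F \<inter> B = U \<inter> B" by (auto simp: F_def)
  then have "x \<in> \<Phi> F \<longleftrightarrow> x \<in> \<Phi> U" using B(2) F(2) by blast
  then show "x \<in> \<Phi> U \<longleftrightarrow> x \<in> U" using fin[OF F] by (auto simp: F_def)
qed

text \<open>After composition with the inverse of A and a translation, the map
commutes with translations and fixes {0}. It then fixes all finite sets, because it and its
inverse map each of them into itself.\<close>

lemma equivariant_homeomorphism_affine:
  assumes k: "k \<ge> 2" and \<Phi>: "equivariant_endo k A \<Phi>" and \<Psi>: "equivariant_endo k A' \<Psi>"
    and inv: "\<And>U. U \<in> hull_of_kfree k \<Longrightarrow> \<Phi> (\<Psi> U) = U" "\<And>U. U \<in> hull_of_kfree k \<Longrightarrow> \<Psi> (\<Phi> U) = U"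
    and add: "\<And>x y. A (x + y) = A x + A y" and AB: "\<And>x. A (A' x) = x" "\<And>x. A' (A x) = x"
  obtains c where "hexagonal A" "\<And>U. U \<in> hull_of_kfree k \<Longrightarrow> \<Phi> U = (\<lambda>u. A u + c) ` U"
proof -
  have \<Phi>0: "\<Phi> {} = {}" using image_of_empty[OF k \<Phi>] AB(1) by (metis surjI)
  have "\<Phi> {0} \<noteq> {}"
  proof
    assume "\<Phi> {0} = {}"
    then have "\<Psi> (\<Phi> {0}) = \<Psi> (\<Phi> {})" using \<Phi>0 by simp
    then show False using inv(2) singleton_in_hull[OF k] empty_in_hull[OF k] by simp
  qed
  then obtain s where s: "s \<in> \<Phi> {0}" by blast
  have A: "hexagonal A"
    using hexagonal_of_linear_part[OF add AB endomorphism_linear_part[OF k \<Phi> s add AB]] .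
  obtain B where B: "hexagonal B" "\<And>x. A (B x) = x" "\<And>x. B (A x) = x" using hexagonal_inverse[OF A] by blast
  have BA': "A' = B" by (metis AB(1) B(3) ext)
  have "equivariant_endo k (\<lambda>t. B (A t)) (\<lambda>U. (\<lambda>u. B u + 0) ` \<Phi> U)"
    by (rule equivariant_endo_comp[OF equivariant_affine[OF B(1)] \<Phi>])
  then have \<Phi>1: "equivariant_endo k (\<lambda>t. t) (\<lambda>U. B ` \<Phi> U)" by (simp add: B)
  have "B s \<in> B ` \<Phi> {0}" using s by blast
  then have single: "B ` \<Phi> {0} = {B s}" using image_of_singleton_unique[OF k \<Phi>1] by blast
  have "y = s" if "y \<in> \<Phi> {0}" for y
  proof -
    have "B y = B s" using single that by blast
    then show ?thesis using B(2) by metis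
  qed
  then have \<Phi>s: "\<Phi> {0} = {s}" using s by blast
  define \<Phi>2 where "\<Phi>2 U = (\<lambda>u. u + - B s) ` B ` \<Phi> U" for U
  have \<Phi>2: "equivariant_endo k (\<lambda>t. t) \<Phi>2"
    unfolding \<Phi>2_def by (rule equivariant_endo_comp[OF equivariant_affine[OF hexagonal_id] \<Phi>1])
  have \<Phi>20: "\<Phi>2 {0} = {0}" by (simp add: \<Phi>2_def single)
  define \<Psi>2 where "\<Psi>2 U = \<Psi> ((\<lambda>u. A u + s) ` U)" for U
  have \<Psi>2: "equivariant_endo k (\<lambda>t. t) \<Psi>2"
    using equivariant_endo_comp[OF \<Psi> equivariant_affine[OF A, of k s]]
    by (simp add: \<Psi>2_def[abs_def] BA' B)
  have \<Psi>20: "\<Psi>2 {0} = {0}"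
    using \<Phi>s inv(2)[OF singleton_in_hull[OF k, of 0]] by (simp add: \<Psi>2_def hexagonal_0[OF A])
  have translate_back: "(\<lambda>u. A u + s) ` \<Phi>2 U = \<Phi> U" for U
    by (simp add: \<Phi>2_def image_image hexagonal_diff[OF A] B)
  have inverse2: "\<Psi>2 (\<Phi>2 U) = U" if "U \<in> hull_of_kfree k" for U
    using inv(2)[OF that] by (simp add: \<Psi>2_def translate_back)
  have fin: "\<Phi>2 F = F" if F: "finite F" "F \<in> hull_of_kfree k" for F
  proof
    show sub: "\<Phi>2 F \<subseteq> F" using image_of_finite_subset[OF k \<Phi>2 \<Phi>20 F] .
    have "finite (\<Phi>2 F)" "\<Phi>2 F \<in> hull_of_kfree k"
      using sub F \<Phi>2 finite_subset unfolding equivariant_endo_def by blast+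
    from image_of_finite_subset[OF k \<Psi>2 \<Psi>20 this] show "F \<subseteq> \<Phi>2 F" using inverse2[OF F(2)] by simp
  qed
  have "\<Phi>2 U = U" if "U \<in> hull_of_kfree k" for U
    using identity_if_identity_on_finite[OF k \<Phi>2 fin that] .
  then show ?thesis using that[OF A] translate_back by metis
qed

section \<open>Eisenstein integers as complex numbers\<close>

lemma eis_rho_eq: "eis_rho = Complex (- 1 / 2) (sqrt 3 / 2)"
proof -
  have "eis_rho = exp (\<i> * of_real (2 * pi / 3))" by (simp add: eis_rho_def mult.commute)
  also have "\<dots> = cis (2 * pi / 3)" by (simp add: cis_conv_exp)
  also have "\<dots> = Complex (- 1 / 2) (sqrt 3 / 2)" by (simp add: cis.ctr cos_120 sin_120)
  finally show ?thesis .
qed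

lemma Re_eis_rho [simp]: "Re eis_rho = - 1 / 2" and Im_eis_rho [simp]: "Im eis_rho = sqrt 3 / 2"
  by (simp_all add: eis_rho_eq)

lemma eis_rho_square: "eis_rho * eis_rho = - 1 - eis_rho"
  by (rule complex_eqI) (simp_all add: field_simps)

lemma cnj_eis_rho: "cnj eis_rho = - 1 - eis_rho"
  by (rule complex_eqI) simp_all

fun to_complex :: "eis \<Rightarrow> complex" where
  "to_complex (Eis a b) = of_int a + of_int b * eis_rho"

lemma to_complex_add: "to_complex (x + y) = to_complex x + to_complex y"
  by (cases x; cases y) (simp add: algebra_simps)
lemma to_complex_diff: "to_complex (x - y) = to_complex x - to_complex y"
  by (cases x; cases y) (simp add: algebra_simps)
lemma to_complex_minus: "to_complex (- x) = - to_complex x"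
  by (cases x) simp
lemma to_complex_0 [simp]: "to_complex 0 = 0" by (simp add: zero_eis_def)
lemma to_complex_1 [simp]: "to_complex 1 = 1" by (simp add: one_eis_def)

lemma to_complex_mult: "to_complex (x * y) = to_complex x * to_complex y"
proof -
  obtain a b c d where xy: "x = Eis a b" "y = Eis c d" by (cases x; cases y)
  have "to_complex x * to_complex y =
    of_int a * of_int c + (of_int a * of_int d + of_int b * of_int c) * eis_rho + of_int b * of_int d * (eis_rho * eis_rho)"
    by (simp add: xy algebra_simps)
  then show ?thesis unfolding eis_rho_square by (simp add: xy algebra_simps)
qed

lemma to_complex_power: "to_complex (x ^ n) = to_complex x ^ n"
  by (induction n) (simp_all add: to_complex_mult)

lemma to_complex_cnj: "to_complex (eis_cnj x) = cnj (to_complex x)"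
  by (cases x) (simp add: cnj_eis_rho algebra_simps)

lemma inj_to_complex: "inj to_complex"
proof (rule injI)
  fix x y assume "to_complex x = to_complex y"
  then have *: "to_complex (x - y) = 0" by (simp add: to_complex_diff)
  obtain a b where ab: "x - y = Eis a b" by (cases "x - y")
  have "Im (to_complex (Eis a b)) = 0" "Re (to_complex (Eis a b)) = 0" using * ab by simp_all
  then have "b = 0" "a = 0" by simp_all
  then show "x = y" using ab by (metis eq_iff_diff_eq_0 zero_eis_def)
qed

lemma to_complex_eq_iff [simp]: "to_complex x = to_complex y \<longleftrightarrow> x = y"
  using inj_to_complex by (simp add: inj_eq)

lemma range_to_complex: "range to_complex = eis_ints"
proof
  show "range to_complex \<subseteq> eis_ints"
  proof
    fix z assume "z \<in> range to_complex"
    then obtain x where "z = to_complex x" by blast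
    then show "z \<in> eis_ints" by (cases x) (auto simp: eis_ints_def)
  qed
  show "eis_ints \<subseteq> range to_complex"
  proof
    fix z assume "z \<in> eis_ints"
    then obtain a b where "z = to_complex (Eis a b)" by (auto simp: eis_ints_def)
    then show "z \<in> range to_complex" by blast
  qed
qed

lemma to_complex_in [simp]: "to_complex x \<in> eis_ints"
  using range_to_complex by blast

lemma eis_intsE:
  assumes "z \<in> eis_ints" obtains x where "z = to_complex x"
  using assms range_to_complex by blast

lemma eis_ring_simps [simp]:
  "carrier eis_ring = eis_ints" "monoid.mult eis_ring = (*)" "one eis_ring = 1"
  "ring.zero eis_ring = 0" "ring.add eis_ring = (+)"
  by (simp_all add: eis_ring_def complex_ring_def)

lemma eis_ring_pow: "p [^]\<^bsub>eis_ring\<^esub> (n::nat) = p ^ n"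
  by (induction n) (simp_all add: nat_pow_def mult.commute)

lemma eis_divides: "to_complex x divides\<^bsub>eis_ring\<^esub> to_complex y \<longleftrightarrow> x dvd y"
proof
  assume "to_complex x divides\<^bsub>eis_ring\<^esub> to_complex y"
  then obtain c where "c \<in> eis_ints" "to_complex y = to_complex x * c" by (auto simp: factor_def)
  then show "x dvd y" by (metis dvdI eis_intsE to_complex_eq_iff to_complex_mult)
next
  assume "x dvd y"
  then obtain c where "y = x * c" by blast
  then show "to_complex x divides\<^bsub>eis_ring\<^esub> to_complex y"
    unfolding factor_def by (intro bexI[of _ "to_complex c"]) (simp_all add: to_complex_mult)
qed

lemma Units_eis_ring: "Units eis_ring = to_complex ` {e. e dvd 1}"
proof (intro equalityI subsetI)
  fix z assume "z \<in> Units eis_ring"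
  then obtain y where "z \<in> eis_ints" "y \<in> eis_ints" "y * z = 1" by (auto simp: Units_def)
  then obtain a b where ab: "z = to_complex a" "y = to_complex b" by (metis eis_intsE)
  then have "to_complex (b * a) = to_complex 1" using \<open>y * z = 1\<close> by (simp add: to_complex_mult)
  then have "1 = a * b" by (simp only: to_complex_eq_iff mult.commute)
  then have "a dvd 1" by (rule dvdI)
  then show "z \<in> to_complex ` {e. e dvd 1}" using ab by blast
next
  fix z assume "z \<in> to_complex ` {e. e dvd 1}"
  then obtain a where a: "z = to_complex a" "a dvd 1" by blast
  then obtain b where "1 = a * b" by blast
  then have "to_complex a * to_complex b = 1" by (metis to_complex_1 to_complex_mult)
  then show "z \<in> Units eis_ring"
    unfolding Units_def a(1) by (auto simp: mult.commute intro!: bexI[of _ "to_complex b"])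
qed

lemma ring_prime_eis: "ring_prime\<^bsub>eis_ring\<^esub> (to_complex p) \<longleftrightarrow> prime_elem p"
proof -
  have "to_complex p = 0 \<longleftrightarrow> p = 0" by (metis to_complex_0 to_complex_eq_iff)
  moreover have "to_complex p \<in> Units eis_ring \<longleftrightarrow> p dvd 1" by (auto simp: Units_eis_ring)
  moreover have "(\<forall>a\<in>eis_ints. \<forall>b\<in>eis_ints. to_complex p divides\<^bsub>eis_ring\<^esub> (a * b) \<longrightarrow>
      to_complex p divides\<^bsub>eis_ring\<^esub> a \<or> to_complex p divides\<^bsub>eis_ring\<^esub> b) \<longleftrightarrow>
      (\<forall>a b. p dvd a * b \<longrightarrow> p dvd a \<or> p dvd b)"
    unfolding range_to_complex[symmetric] by (simp add: eis_divides to_complex_mult[symmetric])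
  ultimately show ?thesis by (simp add: ring_prime_def Divisibility.prime_def prime_elem_def)
qed

lemma kfree_eis_eq: "kfree_eis k = to_complex ` kfree k"
proof (intro equalityI subsetI)
  fix z assume z: "z \<in> kfree_eis k"
  then obtain x where x: "z = to_complex x" by (auto simp: kfree_eis_def elim: eis_intsE)
  have "\<not> p ^ k dvd x" if "prime_elem p" for p
    using z that ring_prime_eis[of p] eis_divides[of "p ^ k" x] x
    by (auto simp: kfree_eis_def eis_ring_pow to_complex_power)
  then show "z \<in> to_complex ` kfree k" using x by (auto simp: kfree_def)
next
  fix z assume "z \<in> to_complex ` kfree k"
  then obtain x where x: "z = to_complex x" "x \<in> kfree k" by blast
  have "\<not> (q [^]\<^bsub>eis_ring\<^esub> k) divides\<^bsub>eis_ring\<^esub> z" if q: "q \<in> eis_ints" "ring_prime\<^bsub>eis_ring\<^esub> q" for q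
  proof -
    obtain p where p: "q = to_complex p" using q(1) eis_intsE by blast
    then have "prime_elem p" using q(2) ring_prime_eis by blast
    then have "\<not> p ^ k dvd x" using x(2) by (auto simp: kfree_def)
    then show ?thesis by (simp add: p x(1) eis_ring_pow to_complex_power[symmetric] eis_divides)
  qed
  then show "z \<in> kfree_eis k" using x(1) by (simp add: kfree_eis_def)
qed

section \<open>The topology of the configuration space\<close>

lemma topspace_config [simp]: "topspace (config_topology L) = Pow L"
  by (auto simp: config_topology_def topspace_pullback_topology)

lemma openin_config:
  "openin (config_topology L) \<U> \<longleftrightarrow> \<U> \<subseteq> Pow L \<and>
    (\<forall>U\<in>\<U>. \<exists>B. finite B \<and> B \<subseteq> L \<and> (\<forall>U'\<subseteq>L. U' \<inter> B = U \<inter> B \<longrightarrow> U' \<in> \<U>))"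
proof -
  let ?f = "\<lambda>U. \<lambda>x\<in>L. x \<in> U" and ?P = "product_topology (\<lambda>_. discrete_topology (UNIV :: bool set)) L"
  show ?thesis
  proof
    assume "openin (config_topology L) \<U>"
    then obtain W where W: "openin ?P W" "\<U> = ?f -` W \<inter> Pow L"
      by (auto simp: config_topology_def openin_pullback_topology)
    have "\<exists>B. finite B \<and> B \<subseteq> L \<and> (\<forall>U'\<subseteq>L. U' \<inter> B = U \<inter> B \<longrightarrow> U' \<in> \<U>)" if U: "U \<in> \<U>" for U
    proof -
      have "?f U \<in> W" using U W by blast
      then obtain Y where Y: "finite {i \<in> L. Y i \<noteq> (UNIV :: bool set)}" "?f U \<in> Pi\<^sub>E L Y" "Pi\<^sub>E L Y \<subseteq> W"
        using W(1) unfolding openin_product_topology_alt by auto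
      let ?B = "{i \<in> L. Y i \<noteq> UNIV}"
      have "U' \<in> \<U>" if U': "U' \<subseteq> L" "U' \<inter> ?B = U \<inter> ?B" for U'
      proof -
        have "(i \<in> U') \<in> Y i" if "i \<in> L" for i
        proof (cases "Y i = UNIV")
          case False
          then have "i \<in> U' \<longleftrightarrow> i \<in> U" using U'(2) that by blast
          then show ?thesis using Y(2) that by (auto simp: PiE_iff)
        qed simp
        then have "?f U' \<in> Pi\<^sub>E L Y" by auto
        then show ?thesis using Y(3) W(2) U'(1) by blast
      qed
      then show ?thesis using Y(1) by (intro exI[of _ ?B]) auto
    qed
    moreover have "\<U> \<subseteq> Pow L" unfolding W(2) by (rule Int_lower2)
    ultimately show "\<U> \<subseteq> Pow L \<and> (\<forall>U\<in>\<U>. \<exists>B. finite B \<and> B \<subseteq> L \<and> (\<forall>U'\<subseteq>L. U' \<inter> B = U \<inter> B \<longrightarrow> U' \<in> \<U>))"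
      by (intro conjI ballI)
  next
    assume R: "\<U> \<subseteq> Pow L \<and> (\<forall>U\<in>\<U>. \<exists>B. finite B \<and> B \<subseteq> L \<and> (\<forall>U'\<subseteq>L. U' \<inter> B = U \<inter> B \<longrightarrow> U' \<in> \<U>))"
    define W where "W = {g \<in> Pi\<^sub>E L (\<lambda>_. UNIV :: bool set). {i \<in> L. g i} \<in> \<U>}"
    have "openin ?P W"
      unfolding openin_product_topology_alt
    proof
      fix g assume g: "g \<in> W"
      define U where "U = {i \<in> L. g i}"
      have "U \<in> \<U>" using g by (simp add: W_def U_def)
      then obtain B where B: "finite B" "B \<subseteq> L" "\<And>U'. U' \<subseteq> L \<Longrightarrow> U' \<inter> B = U \<inter> B \<Longrightarrow> U' \<in> \<U>" using R by meson
      define Y where "Y i = (if i \<in> B then {g i} else UNIV)" for i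
      have "{i \<in> L. Y i \<noteq> UNIV} \<subseteq> B" by (auto simp: Y_def)
      then have "finite {i \<in> L. Y i \<noteq> topspace (discrete_topology UNIV)}" using B(1) finite_subset by simp
      moreover have "g \<in> Pi\<^sub>E L Y" using g by (auto simp: W_def Y_def PiE_iff)
      moreover have "Pi\<^sub>E L Y \<subseteq> W"
      proof
        fix h assume h: "h \<in> Pi\<^sub>E L Y"
        have "h i = g i" if "i \<in> B" for i
        proof -
          have "h i \<in> Y i" using h B(2) that by (auto simp: PiE_iff)
          then show ?thesis using that by (simp add: Y_def)
        qed
        then have "{i \<in> L. h i} \<inter> B = U \<inter> B" by (auto simp: U_def)
        then have "{i \<in> L. h i} \<in> \<U>" by (intro B(3)) auto
        then show "h \<in> W" using h by (auto simp: W_def PiE_iff)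
      qed
      ultimately show "\<exists>Y. finite {i \<in> L. Y i \<noteq> topspace (discrete_topology UNIV)} \<and>
          (\<forall>i\<in>L. openin (discrete_topology UNIV) (Y i)) \<and> g \<in> Pi\<^sub>E L Y \<and> Pi\<^sub>E L Y \<subseteq> W" by auto
    qed
    moreover have "\<U> = ?f -` W \<inter> Pow L"
    proof -
      have mem: "?f U \<in> W \<longleftrightarrow> U \<in> \<U>" if "U \<subseteq> L" for U
      proof -
        have "?f U \<in> Pi\<^sub>E L (\<lambda>_. UNIV)" by simp
        moreover have "{i \<in> L. ?f U i} = U" using that by auto
        ultimately show ?thesis unfolding W_def by (simp only: mem_Collect_eq simp_thms)
      qed
      show ?thesis
      proof (rule Set.set_eqI)
        fix U show "U \<in> \<U> \<longleftrightarrow> U \<in> ?f -` W \<inter> Pow L" using mem[of U] R by blast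
      qed
    qed
    ultimately show "openin (config_topology L) \<U>"
      unfolding config_topology_def openin_pullback_topology by blast
  qed
qed

lemma openin_config_window:
  assumes "openin (config_topology L) T" "U \<in> T"
  obtains B where "finite B" "B \<subseteq> L" "\<forall>U'. U' \<subseteq> L \<longrightarrow> U' \<inter> B = U \<inter> B \<longrightarrow> U' \<in> T"
  using assms unfolding openin_config by blast

lemma openin_cylinder:
  assumes "finite B" "B \<subseteq> L"
  shows "openin (config_topology L) {U' \<in> Pow L. U' \<inter> B = U \<inter> B}"
  unfolding openin_config using assms by (auto intro!: exI[of _ B])

lemma in_config_closure:
  assumes "\<S> \<subseteq> Pow L"
  shows "U \<in> config_topology L closure_of \<S> \<longleftrightarrow>
    U \<subseteq> L \<and> (\<forall>B. finite B \<longrightarrow> B \<subseteq> L \<longrightarrow> (\<exists>V\<in>\<S>. V \<inter> B = U \<inter> B))"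
proof
  assume U: "U \<in> config_topology L closure_of \<S>"
  have UL: "U \<subseteq> L" using U by (simp add: in_closure_of)
  have "\<exists>V\<in>\<S>. V \<inter> B = U \<inter> B" if B: "finite B" "B \<subseteq> L" for B
  proof -
    have "U \<in> {U' \<in> Pow L. U' \<inter> B = U \<inter> B}" using UL by simp
    then have "\<exists>y. y \<in> \<S> \<and> y \<in> {U' \<in> Pow L. U' \<inter> B = U \<inter> B}"
      by (rule conjunct2[OF U[unfolded in_closure_of], rule_format, OF conjI[OF _ openin_cylinder[OF B]]])
    then show ?thesis by (elim exE conjE CollectE) (rule bexI)
  qed
  moreover note UL
  ultimately show "U \<subseteq> L \<and> (\<forall>B. finite B \<longrightarrow> B \<subseteq> L \<longrightarrow> (\<exists>V\<in>\<S>. V \<inter> B = U \<inter> B))"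
    by (intro conjI allI impI)
next
  assume U: "U \<subseteq> L \<and> (\<forall>B. finite B \<longrightarrow> B \<subseteq> L \<longrightarrow> (\<exists>V\<in>\<S>. V \<inter> B = U \<inter> B))"
  show "U \<in> config_topology L closure_of \<S>"
    unfolding in_closure_of
  proof (intro conjI allI impI)
    fix T assume T: "U \<in> T \<and> openin (config_topology L) T"
    obtain B where B: "finite B" "B \<subseteq> L" "\<forall>U'. U' \<subseteq> L \<longrightarrow> U' \<inter> B = U \<inter> B \<longrightarrow> U' \<in> T"
      using openin_config_window[OF conjunct2[OF T] conjunct1[OF T]] .
    then obtain V where V: "V \<in> \<S>" "V \<inter> B = U \<inter> B" using conjunct2[OF U, rule_format, OF B(1,2)] by (elim bexE)
    have "V \<subseteq> L" using V(1) assms by blast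
    then have "V \<in> T" using B(3) V(2) by simp
    then show "\<exists>y. y \<in> \<S> \<and> y \<in> T" using V(1) by (intro exI[of _ V] conjI)
  qed (use U in simp)
qed

lemma continuous_map_config:
  assumes S: "S \<subseteq> Pow L"
  shows "continuous_map (subtopology (config_topology L) S) (subtopology (config_topology L) S) f \<longleftrightarrow>
    f ` S \<subseteq> S \<and> (\<forall>U\<in>S. \<forall>x\<in>L. \<exists>B. finite B \<and> B \<subseteq> L \<and>
      (\<forall>U'\<in>S. U' \<inter> B = U \<inter> B \<longrightarrow> (x \<in> f U' \<longleftrightarrow> x \<in> f U)))"
proof -
  let ?Y = "subtopology (config_topology L) S"
  have top: "topspace ?Y = S" using S by (auto simp: topspace_subtopology)
  show ?thesis
  proof
    assume c: "continuous_map ?Y ?Y f"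
    then have fS: "f ` S \<subseteq> S" using continuous_map_image_subset_topspace top by metis
    have "\<exists>B. finite B \<and> B \<subseteq> L \<and> (\<forall>U'\<in>S. U' \<inter> B = U \<inter> B \<longrightarrow> (x \<in> f U' \<longleftrightarrow> x \<in> f U))"
      if U: "U \<in> S" and x: "x \<in> L" for U x
    proof -
      let ?C = "{U' \<in> Pow L. U' \<inter> {x} = f U \<inter> {x}}"
      have "openin ?Y (?C \<inter> S)"
        using openin_cylinder[of "{x}" L "f U"] x by (auto simp: openin_subtopology)
      from openin_continuous_map_preimage[OF c this]
      have "openin ?Y {U' \<in> S. f U' \<in> ?C \<inter> S}" unfolding top .
      then obtain T where T: "openin (config_topology L) T" "{U' \<in> S. f U' \<in> ?C \<inter> S} = T \<inter> S"
        by (auto simp: openin_subtopology)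
      have "U \<in> {U' \<in> S. f U' \<in> ?C \<inter> S}" using U fS S by auto
      then have "U \<in> T" using T(2) by blast
      from openin_config_window[OF T(1) this] obtain B
        where B: "finite B" "B \<subseteq> L" "\<forall>U'. U' \<subseteq> L \<longrightarrow> U' \<inter> B = U \<inter> B \<longrightarrow> U' \<in> T" .
      have "x \<in> f U' \<longleftrightarrow> x \<in> f U" if "U' \<in> S" "U' \<inter> B = U \<inter> B" for U'
      proof -
        have "U' \<subseteq> L" using that(1) S by blast
        then have "U' \<in> T \<inter> S" using B(3) that by blast
        then have "f U' \<in> ?C" using T(2) by blast
        then show ?thesis by auto
      qed
      then show ?thesis using B by blast
    qed
    then show "f ` S \<subseteq> S \<and> (\<forall>U\<in>S. \<forall>x\<in>L. \<exists>B. finite B \<and> B \<subseteq> L \<and>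
      (\<forall>U'\<in>S. U' \<inter> B = U \<inter> B \<longrightarrow> (x \<in> f U' \<longleftrightarrow> x \<in> f U)))" using fS by blast
  next
    assume R: "f ` S \<subseteq> S \<and> (\<forall>U\<in>S. \<forall>x\<in>L. \<exists>B. finite B \<and> B \<subseteq> L \<and>
      (\<forall>U'\<in>S. U' \<inter> B = U \<inter> B \<longrightarrow> (x \<in> f U' \<longleftrightarrow> x \<in> f U)))"
    show "continuous_map ?Y ?Y f"
      unfolding continuous_map_def top
    proof (intro conjI allI impI)
      show "f \<in> S \<rightarrow> S" using R by blast
      fix T assume "openin ?Y T"
      then obtain T' where T': "openin (config_topology L) T'" "T = T' \<inter> S" by (auto simp: openin_subtopology)
      show "openin ?Y {U \<in> S. f U \<in> T}"
      proof (subst openin_subopen, intro ballI)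
        fix U assume "U \<in> {U \<in> S. f U \<in> T}"
        then have U: "U \<in> S" "f U \<in> T" by auto
        then have "f U \<in> T'" using T'(2) by blast
        from openin_config_window[OF T'(1) this] obtain B0
          where B0: "finite B0" "B0 \<subseteq> L" "\<forall>U'. U' \<subseteq> L \<longrightarrow> U' \<inter> B0 = f U \<inter> B0 \<longrightarrow> U' \<in> T'" .
        have "\<forall>x\<in>B0. \<exists>B. finite B \<and> B \<subseteq> L \<and> (\<forall>U'\<in>S. U' \<inter> B = U \<inter> B \<longrightarrow> (x \<in> f U' \<longleftrightarrow> x \<in> f U))"
        proof
          fix x assume "x \<in> B0"
          then have "x \<in> L" using B0(2) by (rule subsetD[rotated])
          then show "\<exists>B. finite B \<and> B \<subseteq> L \<and> (\<forall>U'\<in>S. U' \<inter> B = U \<inter> B \<longrightarrow> (x \<in> f U' \<longleftrightarrow> x \<in> f U))"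
            by (rule bspec[OF bspec[OF conjunct2[OF R] U(1)]])
        qed
        then obtain W where W: "\<And>x. x \<in> B0 \<Longrightarrow> finite (W x) \<and> W x \<subseteq> L"
          "\<And>x U'. x \<in> B0 \<Longrightarrow> U' \<in> S \<Longrightarrow> U' \<inter> W x = U \<inter> W x \<Longrightarrow> (x \<in> f U' \<longleftrightarrow> x \<in> f U)" by metis
        let ?B = "\<Union>x\<in>B0. W x"
        let ?C = "{U' \<in> Pow L. U' \<inter> ?B = U \<inter> ?B} \<inter> S"
        have "openin (config_topology L) {U' \<in> Pow L. U' \<inter> ?B = U \<inter> ?B}"
          by (rule openin_cylinder) (use W(1) B0(1) in auto)
        then have "openin ?Y ?C" by (auto simp: openin_subtopology)
        moreover have "U \<in> ?C" using U S by blast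
        moreover have "?C \<subseteq> {U \<in> S. f U \<in> T}"
        proof
          fix U' assume U': "U' \<in> ?C"
          have "x \<in> f U' \<longleftrightarrow> x \<in> f U" if x: "x \<in> B0" for x
          proof (rule W(2)[OF x])
            show "U' \<in> S" using U' by blast
            have "U' \<inter> ?B = U \<inter> ?B" using U' by blast
            then show "U' \<inter> W x = U \<inter> W x" using x by blast
          qed
          then have "f U' \<inter> B0 = f U \<inter> B0" by blast
          moreover have fU': "f U' \<in> S" using R U' by blast
          moreover have "f U' \<subseteq> L" using fU' S by blast
          ultimately have "f U' \<in> T'" using B0(3) by blast
          then show "U' \<in> {U \<in> S. f U \<in> T}" using U' fU' T'(2) by blast
        qed
        ultimately show "\<exists>T'. openin ?Y T' \<and> U \<in> T' \<and> T' \<subseteq> {U \<in> S. f U \<in> T}" by blast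
      qed
    qed
  qed
qed

text \<open>The shift space is the image of \<open>hull_of_kfree k\<close> under the embedding; from here
on its points are handled as sets of type \<open>eis\<close>.\<close>

lemma eis_shift_as_subtopology:
  "eis_shift k = subtopology (config_topology eis_ints) ((`) to_complex ` hull_of_kfree k)"
  "topspace (eis_shift k) = (`) to_complex ` hull_of_kfree k"
proof -
  define \<O> where "\<O> = {(\<lambda>v. t + v) ` kfree_eis k |t. t \<in> eis_ints}"
  have orbit: "\<O> = range (\<lambda>s. to_complex ` (\<lambda>v. s + v) ` kfree k)"
  proof -
    have "\<O> = (\<lambda>t. (\<lambda>v. t + v) ` kfree_eis k) ` range to_complex"
      unfolding range_to_complex \<O>_def by (rule Setcompr_eq_image)
    then show ?thesis by (simp only: image_image kfree_eis_eq to_complex_add)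
  qed
  have sub: "\<O> \<subseteq> Pow eis_ints" unfolding orbit by auto
  have "config_topology eis_ints closure_of \<O> = (`) to_complex ` hull_of_kfree k"
  proof (intro Set.set_eqI)
    fix U
    have shift: "b \<in> (\<lambda>v. t + v) ` kfree k \<longleftrightarrow> b - t \<in> kfree k" for b t
      by (auto simp: image_iff intro!: bexI[of _ "b - t"])
    have "(to_complex ` U \<in> config_topology eis_ints closure_of \<O>) \<longleftrightarrow> U \<in> hull_of_kfree k" for U
    proof
      assume c: "to_complex ` U \<in> config_topology eis_ints closure_of \<O>"
      show "U \<in> hull_of_kfree k"
        unfolding hull_of_kfree_def
      proof (intro CollectI allI impI)
        fix B :: "eis set" assume "finite B"
        then have "finite (to_complex ` B)" "to_complex ` B \<subseteq> eis_ints" by auto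
        then have "\<exists>V\<in>\<O>. V \<inter> to_complex ` B = to_complex ` U \<inter> to_complex ` B"
          by (rule conjunct2[OF c[unfolded in_config_closure[OF sub]], rule_format])
        then obtain V where V: "V \<in> \<O>" "V \<inter> to_complex ` B = to_complex ` U \<inter> to_complex ` B"
          by (rule bexE)
        obtain t where "V = to_complex ` (\<lambda>v. t + v) ` kfree k"
          using V(1) unfolding orbit by (rule rangeE)
        with V(2) have "to_complex ` (\<lambda>v. t + v) ` kfree k \<inter> to_complex ` B = to_complex ` U \<inter> to_complex ` B"
          by simp
        then have "(\<lambda>v. t + v) ` kfree k \<inter> B = U \<inter> B"
          by (simp only: image_Int[OF inj_to_complex, symmetric] inj_image_eq_iff[OF inj_to_complex])
        then show "\<exists>t. \<forall>b\<in>B. b \<in> U \<longleftrightarrow> b - t \<in> kfree k" using shift by blast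
      qed
    next
      assume U: "U \<in> hull_of_kfree k"
      show "to_complex ` U \<in> config_topology eis_ints closure_of \<O>"
        unfolding in_config_closure[OF sub]
      proof (intro conjI allI impI)
        show "to_complex ` U \<subseteq> eis_ints" by auto
        fix B :: "complex set" assume B: "finite B" "B \<subseteq> eis_ints"
        define B' where "B' = to_complex -` B"
        have B': "B = to_complex ` B'" using B(2) unfolding B'_def range_to_complex[symmetric] by auto
        have "finite B'" using B(1) unfolding B'_def by (rule finite_vimageI[OF _ inj_to_complex])
        then obtain t where "\<forall>b\<in>B'. b \<in> U \<longleftrightarrow> b - t \<in> kfree k" using U unfolding hull_of_kfree_def by blast
        then have "(\<lambda>v. t + v) ` kfree k \<inter> B' = U \<inter> B'" using shift by blast
        then have "to_complex ` (\<lambda>v. t + v) ` kfree k \<inter> B = to_complex ` U \<inter> B"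
          unfolding B' by (simp only: image_Int[OF inj_to_complex, symmetric])
        then show "\<exists>V\<in>\<O>. V \<inter> B = to_complex ` U \<inter> B" unfolding orbit by (rule bexI[OF _ rangeI])
      qed
    qed
    note iff = this
    show "U \<in> config_topology eis_ints closure_of \<O> \<longleftrightarrow> U \<in> (`) to_complex ` hull_of_kfree k"
    proof
      assume c: "U \<in> config_topology eis_ints closure_of \<O>"
      then have "U \<subseteq> range to_complex" unfolding in_config_closure[OF sub] range_to_complex by blast
      then have "U = to_complex ` (to_complex -` U)" by auto
      then show "U \<in> (`) to_complex ` hull_of_kfree k" using c iff by (metis imageI)
    next
      assume "U \<in> (`) to_complex ` hull_of_kfree k"
      then show "U \<in> config_topology eis_ints closure_of \<O>" using iff by blast
    qed
  qed
  then show 1: "eis_shift k = subtopology (config_topology eis_ints) ((`) to_complex ` hull_of_kfree k)"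
    by (simp add: eis_shift_def orbit_closure_def \<O>_def)
  show "topspace (eis_shift k) = (`) to_complex ` hull_of_kfree k"
    unfolding 1 by (auto simp: topspace_subtopology)
qed

section \<open>Affine homeomorphisms of the shift space\<close>

text \<open>Inverses in \<open>BijGroup\<close> are restrictions of \<open>inv_into\<close>, and these agree on the
space with the continuous inverse.\<close>

lemma group_homeo_group: "group (homeo_group Y)"
proof -
  interpret B: group "BijGroup (topspace Y)" by (rule group_BijGroup)
  let ?H = "{f \<in> Bij (topspace Y). homeomorphic_map Y Y f}"
  have "subgroup ?H (BijGroup (topspace Y))"
  proof (rule B.subgroupI)
    show "?H \<subseteq> carrier (BijGroup (topspace Y))" by (auto simp: BijGroup_def)
    have "homeomorphic_map Y Y (\<lambda>x\<in>topspace Y. x)"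
      by (rule homeomorphic_map_eq[of Y Y id]) simp_all
    then show "?H \<noteq> {}" using id_Bij by blast
  next
    fix f assume "f \<in> ?H"
    then have f: "f \<in> Bij (topspace Y)" "homeomorphic_map Y Y f" by auto
    let ?g = "\<lambda>x\<in>topspace Y. inv_into (topspace Y) f x"
    obtain g where g: "homeomorphic_maps Y Y f g" using f(2) homeomorphic_map_maps by blast
    have "g x = ?g x" if x: "x \<in> topspace Y" for x
    proof -
      have "g x \<in> topspace Y" "f (g x) = x"
        using g x unfolding homeomorphic_maps_def continuous_map_def by auto
      then show ?thesis using f(1) x unfolding Bij_def bij_betw_def by (auto intro: inv_into_f_eq[symmetric])
    qed
    moreover have "homeomorphic_map Y Y g"
      using g homeomorphic_maps_sym homeomorphic_map_maps by blast
    ultimately have "homeomorphic_map Y Y ?g" using homeomorphic_map_eq by blast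
    then show "inv\<^bsub>BijGroup (topspace Y)\<^esub> f \<in> ?H"
      using inv_BijGroup[OF f(1)] restrict_inv_into_Bij[OF f(1)] by simp
  next
    fix f g assume "f \<in> ?H" "g \<in> ?H"
    then have fg: "f \<in> Bij (topspace Y)" "homeomorphic_map Y Y f" "g \<in> Bij (topspace Y)" "homeomorphic_map Y Y g"
      by auto
    have "homeomorphic_map Y Y (f \<circ> g)" using homeomorphic_map_compose fg by blast
    then have "homeomorphic_map Y Y (compose (topspace Y) f g)"
      by (rule homeomorphic_map_eq) (simp add: compose_def)
    then show "f \<otimes>\<^bsub>BijGroup (topspace Y)\<^esub> g \<in> ?H"
      using fg compose_Bij by (simp add: BijGroup_def)
  qed
  then show ?thesis unfolding homeo_group_def by (rule B.subgroup_imp_group)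
qed

lemma homeo_group_mult:
  assumes "f \<in> carrier (homeo_group Y)" "g \<in> carrier (homeo_group Y)"
  shows "f \<otimes>\<^bsub>homeo_group Y\<^esub> g = compose (topspace Y) f g"
  using assms by (simp add: homeo_group_def BijGroup_def)

lemma homeo_group_one: "\<one>\<^bsub>homeo_group Y\<^esub> = (\<lambda>x\<in>topspace Y. x)"
  by (simp add: homeo_group_def BijGroup_def)

lemma homeo_group_eqI:
  assumes "f \<in> carrier (homeo_group Y)" "g \<in> carrier (homeo_group Y)" "\<And>x. x \<in> topspace Y \<Longrightarrow> f x = g x"
  shows "f = g"
  using assms by (intro extensionalityI[of _ "topspace Y"]) (auto simp: homeo_group_def Bij_def)

definition hex_group :: "(eis \<Rightarrow> eis) monoid" where
  "hex_group = \<lparr>carrier = {A. hexagonal A}, monoid.mult = (\<lambda>A B z. A (B z)), one = (\<lambda>z. z)\<rparr>"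

lemma hexagonal_comp:
  assumes "hexagonal A" "hexagonal B"
  shows "hexagonal (\<lambda>z. A (B z))"
proof -
  obtain e f where e: "e dvd 1" "A = (\<lambda>z. e * z) \<or> A = (\<lambda>z. e * eis_cnj z)"
    and f: "f dvd 1" "B = (\<lambda>z. f * z) \<or> B = (\<lambda>z. f * eis_cnj z)"
    using assms unfolding hexagonal_def by blast
  have "eis_cnj f dvd 1" using f(1) by (metis eis_cnj_1 eis_cnj_dvd)
  then have u: "e * f dvd 1" "e * eis_cnj f dvd 1" using e(1) f(1) by (simp_all add: eis_unit_iff eis_norm_mult)
  have "(\<lambda>z. A (B z)) = (\<lambda>z. (e * f) * z) \<or> (\<lambda>z. A (B z)) = (\<lambda>z. (e * f) * eis_cnj z) \<or>
    (\<lambda>z. A (B z)) = (\<lambda>z. (e * eis_cnj f) * z) \<or> (\<lambda>z. A (B z)) = (\<lambda>z. (e * eis_cnj f) * eis_cnj z)"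
    using e(2) f(2) by (auto simp: eis_cnj_mult mult.assoc)
  then show ?thesis using u unfolding hexagonal_def by blast
qed

lemma group_hex_group: "group hex_group"
proof (rule groupI)
  fix A assume "A \<in> carrier hex_group"
  then have "hexagonal A" by (simp add: hex_group_def)
  then obtain B where "hexagonal B" "\<And>x. A (B x) = x" "\<And>x. B (A x) = x"
    using hexagonal_inverse by blast
  then show "\<exists>B\<in>carrier hex_group. B \<otimes>\<^bsub>hex_group\<^esub> A = \<one>\<^bsub>hex_group\<^esub>"
    by (intro bexI[of _ B]) (simp_all add: hex_group_def)
qed (simp_all add: hex_group_def hexagonal_comp hexagonal_id)

definition from_complex :: "complex \<Rightarrow> eis" where "from_complex = inv_into UNIV to_complex"

lemma from_to_complex [simp]: "from_complex (to_complex x) = x"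
  by (simp add: from_complex_def inj_to_complex)

lemma to_from_complex [simp]: "z \<in> eis_ints \<Longrightarrow> to_complex (from_complex z) = z"
  by (metis eis_intsE from_to_complex)

definition lift :: "(eis \<Rightarrow> eis) \<Rightarrow> complex \<Rightarrow> complex" where
  "lift A = (\<lambda>x\<in>eis_ints. to_complex (A (from_complex x)))"

lemma lift_apply [simp]: "lift A (to_complex x) = to_complex (A x)"
  by (simp add: lift_def)

lemma lift_inject: "lift A = lift B \<Longrightarrow> A = B"
  by (rule ext) (metis lift_apply to_complex_eq_iff)

lemma lift_extensional: "lift A \<in> extensional eis_ints" by (simp add: lift_def)

lemma lift_Bij: assumes "hexagonal A" shows "lift A \<in> Bij eis_ints"
proof -
  obtain B where B: "hexagonal B" "\<And>x. A (B x) = x" "\<And>x. B (A x) = x" using hexagonal_inverse assms by blast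
  have "bij_betw (lift A) eis_ints eis_ints"
    by (rule bij_betw_byWitness[of _ "lift B"]) (auto simp: lift_def B)
  then show ?thesis by (simp add: Bij_def lift_extensional)
qed

lemma lift_compose: "compose eis_ints (lift A) (lift B) = lift (\<lambda>z. A (B z))"
  by (rule ext) (auto simp: compose_def lift_def)

lemma D6_eq: "D6 = lift ` carrier hex_group"
proof -
  have 1: "(\<lambda>x\<in>eis_ints. to_complex e * id x) = lift (\<lambda>z. e * z)"
    "(\<lambda>x\<in>eis_ints. to_complex e * cnj x) = lift (\<lambda>z. e * eis_cnj z)" for e
    by (auto simp: lift_def fun_eq_iff to_complex_mult to_complex_cnj)
  show ?thesis
  proof (intro equalityI subsetI)
    fix f assume "f \<in> D6"
    then obtain e s where "f = (\<lambda>x\<in>eis_ints. to_complex e * s x)" "e dvd 1" "s \<in> {id, cnj}"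
      unfolding D6_def Units_eis_ring by blast
    then have "f = lift (\<lambda>z. e * z) \<or> f = lift (\<lambda>z. e * eis_cnj z)" using 1 by blast
    moreover have "hexagonal (\<lambda>z. e * z)" "hexagonal (\<lambda>z. e * eis_cnj z)"
      using \<open>e dvd 1\<close> unfolding hexagonal_def by blast+
    ultimately show "f \<in> lift ` carrier hex_group" by (auto simp: hex_group_def)
  next
    fix f assume "f \<in> lift ` carrier hex_group"
    then obtain e where "e dvd 1" "f = lift (\<lambda>z. e * z) \<or> f = lift (\<lambda>z. e * eis_cnj z)"
      by (auto simp: hex_group_def hexagonal_def)
    then show "f \<in> D6" unfolding 1[symmetric] D6_def Units_eis_ring by blast
  qed
qed

lemma lift_hom: "lift \<in> hom hex_group (BijGroup eis_ints)"
  by (rule homI) (auto simp: hex_group_def BijGroup_def lift_Bij lift_compose)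

lemma subgroup_D6: "subgroup D6 (BijGroup eis_ints)"
proof -
  interpret group_hom hex_group "BijGroup eis_ints" lift
    by (simp add: group_hom_def group_hom_axioms_def group_hex_group group_BijGroup lift_hom)
  show ?thesis unfolding D6_eq by (rule img_is_subgroup)
qed

lemma group_D6: "group D6_group"
  unfolding D6_group_def by (rule group.subgroup_imp_group[OF group_BijGroup subgroup_D6])

lemma D6_group_simps: "carrier D6_group = D6" "\<one>\<^bsub>D6_group\<^esub> = (\<lambda>x\<in>eis_ints. x)"
  by (simp_all add: D6_group_def BijGroup_def)

lemma D6_group_mult: "hexagonal A \<Longrightarrow> hexagonal B \<Longrightarrow> lift A \<otimes>\<^bsub>D6_group\<^esub> lift B = lift (\<lambda>z. A (B z))"
  by (simp add: D6_group_def BijGroup_def lift_Bij lift_compose)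

lemma lift_iso: "lift \<in> iso hex_group D6_group"
proof -
  have "lift \<in> hom hex_group D6_group"
    by (rule homI) (auto simp: D6_group_simps D6_eq D6_group_mult hex_group_def)
  moreover have "bij_betw lift (carrier hex_group) (carrier D6_group)"
    unfolding D6_group_simps D6_eq by (intro bij_betw_imageI inj_onI refl lift_inject)
  ultimately show ?thesis by (simp add: iso_def)
qed

text \<open>The homeomorphism U \<mapsto> A(U) + c of the shift space. The translations T_t are the case
A = id, c = -t, and the action of D6 is the case c = 0.\<close>

definition aff :: "nat \<Rightarrow> (eis \<Rightarrow> eis) \<Rightarrow> eis \<Rightarrow> complex set \<Rightarrow> complex set" where
  "aff k A c = (\<lambda>U\<in>topspace (eis_shift k). to_complex ` (\<lambda>u. A u + c) ` (to_complex -` U))"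

lemma vimage_to_complex [simp]: "to_complex -` to_complex ` W = W"
  by (simp add: inj_vimage_image_eq inj_to_complex)

lemma topspace_shiftE:
  assumes "U \<in> topspace (eis_shift k)" obtains W where "W \<in> hull_of_kfree k" "U = to_complex ` W"
  using assms unfolding eis_shift_as_subtopology(2) by blast

lemma in_topspace_shift: "to_complex ` W \<in> topspace (eis_shift k) \<longleftrightarrow> W \<in> hull_of_kfree k"
  unfolding eis_shift_as_subtopology(2) by (metis (no_types, lifting) image_iff vimage_to_complex)

lemma aff_apply: "W \<in> hull_of_kfree k \<Longrightarrow> aff k A c (to_complex ` W) = to_complex ` (\<lambda>u. A u + c) ` W"
  by (simp add: aff_def in_topspace_shift)

lemma continuous_map_shift:
  assumes f: "\<And>W. W \<in> hull_of_kfree k \<Longrightarrow> f (to_complex ` W) = to_complex ` \<Phi> W"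
    and \<Phi>: "\<And>W. W \<in> hull_of_kfree k \<Longrightarrow> \<Phi> W \<in> hull_of_kfree k"
  shows "continuous_map (eis_shift k) (eis_shift k) f \<longleftrightarrow> continuous_on_hull k \<Phi>"
proof -
  let ?X = "hull_of_kfree k"
  have sub: "(`) to_complex ` ?X \<subseteq> Pow eis_ints" by auto
  have fS: "f ` (`) to_complex ` ?X \<subseteq> (`) to_complex ` ?X" using f \<Phi> by auto
  have mem: "to_complex x \<in> to_complex ` W \<longleftrightarrow> x \<in> W" for x W by auto
  define P where "P U y \<longleftrightarrow> (\<exists>B. finite B \<and> B \<subseteq> eis_ints \<and>
      (\<forall>U'\<in>(`) to_complex ` ?X. U' \<inter> B = U \<inter> B \<longrightarrow> (y \<in> f U' \<longleftrightarrow> y \<in> f U)))" for U y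
  have fx: "to_complex x \<in> f (to_complex ` W) \<longleftrightarrow> x \<in> \<Phi> W" if "W \<in> ?X" for W x
    by (simp only: f[OF that] mem)
  have win: "P (to_complex ` W) (to_complex x) \<longleftrightarrow>
      (\<exists>B. finite B \<and> (\<forall>W'\<in>?X. W' \<inter> B = W \<inter> B \<longrightarrow> (x \<in> \<Phi> W' \<longleftrightarrow> x \<in> \<Phi> W)))" (is "_ \<longleftrightarrow> ?r")
    if W: "W \<in> ?X" for W x
  proof
    assume "P (to_complex ` W) (to_complex x)"
    then obtain B where B: "finite B" "B \<subseteq> eis_ints" "\<forall>U'\<in>(`) to_complex ` ?X. U' \<inter> B = to_complex ` W \<inter> B \<longrightarrow>
        (to_complex x \<in> f U' \<longleftrightarrow> to_complex x \<in> f (to_complex ` W))" unfolding P_def by (elim exE conjE)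
    define B' where "B' = to_complex -` B"
    have B': "B = to_complex ` B'" using B(2) unfolding B'_def range_to_complex[symmetric] by auto
    have "finite B'" using B(1) unfolding B'_def by (rule finite_vimageI[OF _ inj_to_complex])
    moreover have "x \<in> \<Phi> W' \<longleftrightarrow> x \<in> \<Phi> W" if W': "W' \<in> ?X" "W' \<inter> B' = W \<inter> B'" for W'
    proof -
      have "to_complex ` W' \<inter> B = to_complex ` W \<inter> B"
        unfolding B' image_Int[OF inj_to_complex, symmetric] W'(2) ..
      then have "to_complex x \<in> f (to_complex ` W') \<longleftrightarrow> to_complex x \<in> f (to_complex ` W)"
        using B(3) W'(1) by (simp only: ball_simps simp_thms)
      then show ?thesis by (simp only: fx[OF W] fx[OF W'(1)])
    qed
    ultimately show ?r by (intro exI[of _ B'] conjI ballI impI)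
  next
    assume ?r
    then obtain B where B: "finite B" "\<forall>W'\<in>?X. W' \<inter> B = W \<inter> B \<longrightarrow> (x \<in> \<Phi> W' \<longleftrightarrow> x \<in> \<Phi> W)"
      by (elim exE conjE)
    show "P (to_complex ` W) (to_complex x)"
      unfolding P_def
    proof (intro exI conjI ballI impI)
      show "finite (to_complex ` B)" using B(1) by simp
      show "to_complex ` B \<subseteq> eis_ints" by auto
      fix U' assume U': "U' \<in> (`) to_complex ` ?X" "U' \<inter> to_complex ` B = to_complex ` W \<inter> to_complex ` B"
      then obtain W' where W': "W' \<in> ?X" "U' = to_complex ` W'" by blast
      have "W' \<inter> B = W \<inter> B"
        using U'(2) unfolding W'(2) image_Int[OF inj_to_complex, symmetric] inj_image_eq_iff[OF inj_to_complex] .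
      then have "x \<in> \<Phi> W' \<longleftrightarrow> x \<in> \<Phi> W" using B(2) W'(1) by blast
      then show "to_complex x \<in> f U' \<longleftrightarrow> to_complex x \<in> f (to_complex ` W)"
        by (simp only: W'(2) fx[OF W] fx[OF W'(1)])
    qed
  qed
  have "continuous_map (eis_shift k) (eis_shift k) f \<longleftrightarrow> (\<forall>U\<in>(`) to_complex ` ?X. \<forall>x\<in>range to_complex. P U x)"
    unfolding eis_shift_as_subtopology(1) continuous_map_config[OF sub] range_to_complex P_def
    by (rule iffI, erule conjunct2, rule conjI[OF fS])
  also have "\<dots> \<longleftrightarrow> (\<forall>W\<in>?X. \<forall>x. P (to_complex ` W) (to_complex x))" by blast
  also have "\<dots> \<longleftrightarrow> continuous_on_hull k \<Phi>"
    unfolding continuous_on_hull_def by (intro ball_cong refl all_cong1 win)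
  finally show ?thesis .
qed

lemma compose_aff:
  assumes "hexagonal A" "hexagonal B"
  shows "compose (topspace (eis_shift k)) (aff k A c) (aff k B d) = aff k (\<lambda>z. A (B z)) (A d + c)"
proof
  fix U
  show "compose (topspace (eis_shift k)) (aff k A c) (aff k B d) U = aff k (\<lambda>z. A (B z)) (A d + c) U"
  proof (cases "U \<in> topspace (eis_shift k)")
    case True
    then obtain W where W: "W \<in> hull_of_kfree k" "U = to_complex ` W" by (rule topspace_shiftE)
    have "(\<lambda>u. B u + d) ` W \<in> hull_of_kfree k"
      using equivariant_affine[OF assms(2), of k d] W(1) by (simp add: equivariant_endo_def)
    then have "aff k A c (aff k B d U) = to_complex ` (\<lambda>u. A u + c) ` (\<lambda>u. B u + d) ` W"
      using W by (simp add: aff_apply)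
    also have "\<dots> = to_complex ` (\<lambda>u. A (B u) + (A d + c)) ` W"
      by (simp add: image_image hexagonal_add[OF assms(1)] add.assoc)
    finally show ?thesis using True W by (simp add: compose_def aff_apply)
  qed (simp add: compose_def aff_def)
qed

lemma aff_id: "aff k (\<lambda>z. z) 0 = (\<lambda>x\<in>topspace (eis_shift k). x)"
proof
  fix U
  show "aff k (\<lambda>z. z) 0 U = (\<lambda>x\<in>topspace (eis_shift k). x) U"
  proof (cases "U \<in> topspace (eis_shift k)")
    case True
    then obtain W where W: "W \<in> hull_of_kfree k" "U = to_complex ` W" by (rule topspace_shiftE)
    then show ?thesis using True by (simp add: aff_apply)
  qed (simp add: aff_def)
qed

lemma aff_in_homeo_group:
  assumes A: "hexagonal A"
  shows "aff k A c \<in> carrier (homeo_group (eis_shift k))"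
proof -
  let ?Y = "eis_shift k"
  obtain B where B: "hexagonal B" "\<And>x. A (B x) = x" "\<And>x. B (A x) = x" using hexagonal_inverse[OF A] by blast
  have cont: "continuous_map ?Y ?Y (aff k A c)" if "hexagonal A" for A c
  proof -
    note eq = equivariant_affine[OF that, of k c, unfolded equivariant_endo_def]
    have "aff k A c (to_complex ` W) = to_complex ` (\<lambda>u. A u + c) ` W" "(\<lambda>u. A u + c) ` W \<in> hull_of_kfree k"
      if "W \<in> hull_of_kfree k" for W
      using aff_apply[OF that] bspec[OF conjunct1[OF eq] that] by blast+
    from continuous_map_shift[of k "aff k A c" "\<lambda>U. (\<lambda>u. A u + c) ` U", OF this]
    show ?thesis using conjunct1[OF conjunct2[OF eq]] by simp
  qed
  have inv: "compose (topspace ?Y) (aff k B (- B c)) (aff k A c) = (\<lambda>x\<in>topspace ?Y. x)"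
    "compose (topspace ?Y) (aff k A c) (aff k B (- B c)) = (\<lambda>x\<in>topspace ?Y. x)"
    unfolding compose_aff[OF A B(1)] compose_aff[OF B(1) A] aff_id[symmetric]
    using B hexagonal_diff[OF A, of 0 "B c"] hexagonal_0[OF A] by simp_all
  have "aff k B (- B c) (aff k A c x) = x" "aff k A c (aff k B (- B c) x) = x" if "x \<in> topspace ?Y" for x
    using fun_cong[OF inv(1), of x] fun_cong[OF inv(2), of x] that by (simp_all add: compose_def)
  then have "homeomorphic_maps ?Y ?Y (aff k A c) (aff k B (- B c))"
    unfolding homeomorphic_maps_def using cont[OF A] cont[OF B(1)] by blast
  then have "homeomorphic_map ?Y ?Y (aff k A c)" using homeomorphic_map_maps by blast
  moreover have "aff k A c \<in> extensional (topspace ?Y)" by (simp add: aff_def)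
  ultimately show ?thesis
    by (simp add: homeo_group_def Bij_def bij_betw_def
        homeomorphic_imp_injective_map homeomorphic_imp_surjective_map)
qed

lemma mult_aff:
  assumes "hexagonal A" "hexagonal B"
  shows "aff k A c \<otimes>\<^bsub>homeo_group (eis_shift k)\<^esub> aff k B d = aff k (\<lambda>z. A (B z)) (A d + c)"
  using assms by (simp add: homeo_group_mult aff_in_homeo_group compose_aff)

lemma aff_inject:
  assumes k: "k \<ge> 2" and "aff k A c = aff k B d" "hexagonal A" "hexagonal B"
  shows "A = B" "c = d"
proof -
  have *: "A x + c = B x + d" for x
  proof -
    have "to_complex ` (\<lambda>u. A u + c) ` {x} = to_complex ` (\<lambda>u. B u + d) ` {x}"
      using aff_apply[OF singleton_in_hull[OF k]] assms(2) by metis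
    then show ?thesis by simp
  qed
  show "c = d" using *[of 0] assms(3,4) by (simp add: hexagonal_0)
  then show "A = B" using * by (simp add: fun_eq_iff)
qed

lemma shift_map_eq: "shift_map (eis_shift k) (to_complex t) = aff k (\<lambda>z. z) (- t)"
proof
  fix U
  show "shift_map (eis_shift k) (to_complex t) U = aff k (\<lambda>z. z) (- t) U"
  proof (cases "U \<in> topspace (eis_shift k)")
    case True
    then obtain W where W: "W \<in> hull_of_kfree k" "U = to_complex ` W" by (rule topspace_shiftE)
    then show ?thesis using True by (simp add: aff_apply shift_map_def image_image to_complex_diff)
  qed (simp add: aff_def shift_map_def)
qed

lemma shifts_eq: "shift_map (eis_shift k) ` eis_ints = range (aff k (\<lambda>z. z))"
proof -
  have "shift_map (eis_shift k) ` eis_ints = range (\<lambda>t. aff k (\<lambda>z. z) (- t))"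
    unfolding range_to_complex[symmetric] image_image shift_map_eq ..
  also have "\<dots> = range (aff k (\<lambda>z. z))"
  proof (intro equalityI subsetI)
    fix x assume "x \<in> range (aff k (\<lambda>z. z))"
    then obtain t where "x = aff k (\<lambda>z. z) (- (- t))" by auto
    then show "x \<in> range (\<lambda>t. aff k (\<lambda>z. z) (- t))" by (rule range_eqI)
  qed blast
  finally show ?thesis .
qed

lemma induced_map_lift: "induced_map (eis_shift k) (lift A) = aff k A 0"
proof
  fix U
  show "induced_map (eis_shift k) (lift A) U = aff k A 0 U"
  proof (cases "U \<in> topspace (eis_shift k)")
    case True
    then obtain W where W: "W \<in> hull_of_kfree k" "U = to_complex ` W" by (rule topspace_shiftE)
    then show ?thesis using True by (simp add: aff_apply induced_map_def image_image)
  qed (simp add: aff_def induced_map_def)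
qed

section \<open>The symmetry groups\<close>

definition transport :: "(complex set \<Rightarrow> complex set) \<Rightarrow> eis set \<Rightarrow> eis set" where
  "transport f W = to_complex -` f (to_complex ` W)"

lemma homeo_shift_maps:
  assumes "f \<in> carrier (homeo_group (eis_shift k))" "U \<in> topspace (eis_shift k)"
  shows "f U \<in> topspace (eis_shift k)"
  using assms unfolding homeo_group_def Bij_def bij_betw_def by auto

lemma transport_apply:
  assumes "f \<in> carrier (homeo_group (eis_shift k))" "W \<in> hull_of_kfree k"
  shows "f (to_complex ` W) = to_complex ` transport f W" "transport f W \<in> hull_of_kfree k"
proof -
  have "f (to_complex ` W) \<in> topspace (eis_shift k)"
    using homeo_shift_maps assms in_topspace_shift by blast
  then obtain V where "V \<in> hull_of_kfree k" "f (to_complex ` W) = to_complex ` V" by (rule topspace_shiftE)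
  then show "f (to_complex ` W) = to_complex ` transport f W" "transport f W \<in> hull_of_kfree k"
    by (simp_all add: transport_def)
qed

lemma equivariant_transport:
  assumes f: "f \<in> carrier (homeo_group (eis_shift k))"
    and comm: "\<And>t. f \<otimes>\<^bsub>homeo_group (eis_shift k)\<^esub> aff k (\<lambda>z. z) (- t) =
      aff k (\<lambda>z. z) (- a t) \<otimes>\<^bsub>homeo_group (eis_shift k)\<^esub> f"
  shows "equivariant_endo k a (transport f)"
  unfolding equivariant_endo_def
proof (intro conjI ballI allI)
  note aff_id_in = aff_in_homeo_group[OF hexagonal_id, of k]
  show "transport f W \<in> hull_of_kfree k" if "W \<in> hull_of_kfree k" for W
    using transport_apply f that by blast
  have "continuous_map (eis_shift k) (eis_shift k) f"
    using f homeomorphic_imp_continuous_map by (auto simp: homeo_group_def)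
  then show "continuous_on_hull k (transport f)"
    using continuous_map_shift[of k f "transport f", OF transport_apply[OF f]] by simp
  show "transport f ((\<lambda>u. u - t) ` W) = (\<lambda>u. u - a t) ` transport f W" if W: "W \<in> hull_of_kfree k" for W t
  proof -
    have Wt: "(\<lambda>u. u - t) ` W \<in> hull_of_kfree k" using shift_in_hull W .
    have "compose (topspace (eis_shift k)) f (aff k (\<lambda>z. z) (- t)) (to_complex ` W) =
      compose (topspace (eis_shift k)) (aff k (\<lambda>z. z) (- a t)) f (to_complex ` W)"
      using comm[of t] by (simp add: homeo_group_mult f aff_id_in)
    then have "f (to_complex ` (\<lambda>u. u - t) ` W) = aff k (\<lambda>z. z) (- a t) (f (to_complex ` W))"
      using W by (simp add: compose_def in_topspace_shift aff_apply)
    then have "to_complex ` transport f ((\<lambda>u. u - t) ` W) = to_complex ` (\<lambda>u. u - a t) ` transport f W"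
      using transport_apply[OF f W] transport_apply[OF f Wt] by (simp add: aff_apply)
    then show ?thesis by (simp only: inj_image_eq_iff[OF inj_to_complex])
  qed
qed

lemma shift_eq_imp: "(\<lambda>u. u - s) ` {x} = (\<lambda>u. u - t) ` {x :: eis} \<Longrightarrow> s = t"
  by simp

text \<open>The commutation rules say that conjugation by f and by its inverse g acts on the
translations through a and b. These maps are additive and inverse to each other because the
translations act faithfully, which is tested on a configuration whose image is {0}.\<close>

lemma homeomorphism_normal_form:
  assumes k: "k \<ge> 2"
    and f: "f \<in> carrier (homeo_group (eis_shift k))" and g: "g \<in> carrier (homeo_group (eis_shift k))"
    and fg: "f \<otimes>\<^bsub>homeo_group (eis_shift k)\<^esub> g = \<one>\<^bsub>homeo_group (eis_shift k)\<^esub>"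
      "g \<otimes>\<^bsub>homeo_group (eis_shift k)\<^esub> f = \<one>\<^bsub>homeo_group (eis_shift k)\<^esub>"
    and comm_f: "\<And>t. f \<otimes>\<^bsub>homeo_group (eis_shift k)\<^esub> aff k (\<lambda>z. z) (- t) =
      aff k (\<lambda>z. z) (- a t) \<otimes>\<^bsub>homeo_group (eis_shift k)\<^esub> f"
    and comm_g: "\<And>t. g \<otimes>\<^bsub>homeo_group (eis_shift k)\<^esub> aff k (\<lambda>z. z) (- t) =
      aff k (\<lambda>z. z) (- b t) \<otimes>\<^bsub>homeo_group (eis_shift k)\<^esub> g"
  obtains c where "hexagonal a" "f = aff k a c"
proof -
  let ?Y = "eis_shift k" and ?X = "hull_of_kfree k"
  have f_endo: "equivariant_endo k a (transport f)" by (rule equivariant_transport[OF f comm_f])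
  have g_endo: "equivariant_endo k b (transport g)" by (rule equivariant_transport[OF g comm_g])
  have inv: "transport f (transport g W) = W" "transport g (transport f W) = W" if W: "W \<in> ?X" for W
  proof -
    have "f (g (to_complex ` W)) = to_complex ` W" "g (f (to_complex ` W)) = to_complex ` W"
      using fun_cong[OF fg(1), of "to_complex ` W"] fun_cong[OF fg(2), of "to_complex ` W"] W
      by (simp_all add: homeo_group_mult f g homeo_group_one compose_def in_topspace_shift)
    then show "transport f (transport g W) = W" "transport g (transport f W) = W"
      using transport_apply[OF f] transport_apply[OF g] W by (metis vimage_to_complex)+
  qed
  have eqf: "transport f ((\<lambda>u. u - t) ` W) = (\<lambda>u. u - a t) ` transport f W" if "W \<in> ?X" for W t
    using f_endo that unfolding equivariant_endo_def by blast
  have eqg: "transport g ((\<lambda>u. u - t) ` W) = (\<lambda>u. u - b t) ` transport g W" if "W \<in> ?X" for W t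
    using g_endo that unfolding equivariant_endo_def by blast
  \<comment> \<open>A configuration with image {0} makes the translation vector visible.\<close>
  define W0 where "W0 = transport g {0}"
  have W0: "W0 \<in> ?X" "transport f W0 = {0}"
    using transport_apply(2)[OF g] inv(1) singleton_in_hull[OF k] by (simp_all add: W0_def)
  have add: "a (x + y) = a x + a y" for x y
  proof -
    have "(\<lambda>u. u - (x + y)) ` W0 = (\<lambda>u. u - x) ` (\<lambda>u. u - y) ` W0"
      by (simp add: image_image algebra_simps)
    then have "(\<lambda>u. u - a (x + y)) ` {0} = (\<lambda>u. u - a x) ` (\<lambda>u. u - a y) ` {0}"
      using eqf[OF W0(1)] eqf[OF shift_in_hull[OF W0(1)]] W0(2) by metis
    then have "0 - a (x + y) = 0 - a y - a x" by (simp only: image_insert image_empty singleton_inject)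
    then show ?thesis by (simp add: algebra_simps eq_diff_eq diff_eq_eq minus_equation_iff)
  qed
  have ab: "a (b x) = x" for x
  proof -
    have s0: "{0} \<in> ?X" using singleton_in_hull[OF k] .
    have "transport f (transport g ((\<lambda>u. u - x) ` {0})) = (\<lambda>u. u - a (b x)) ` {0}"
      using eqg[OF s0] eqf[OF W0(1)] W0(2) by (simp only: W0_def)
    then have "(\<lambda>u. u - x) ` {0} = (\<lambda>u. u - a (b x)) ` {0}" using inv(1)[OF shift_in_hull[OF s0]] by metis
    then show ?thesis by (metis shift_eq_imp)
  qed
  have ba: "b (a x) = x" for x
  proof -
    have s0: "{0} \<in> ?X" using singleton_in_hull[OF k] .
    define V where "V = transport f {0}"
    have V: "V \<in> ?X" "transport g V = {0}"
      using transport_apply(2)[OF f] inv(2) singleton_in_hull[OF k] by (simp_all add: V_def)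
    have "transport g (transport f ((\<lambda>u. u - x) ` {0})) = (\<lambda>u. u - b (a x)) ` {0}"
      using eqf[OF s0] eqg[OF V(1)] V(2) by (simp only: V_def)
    then have "(\<lambda>u. u - x) ` {0} = (\<lambda>u. u - b (a x)) ` {0}" using inv(2)[OF shift_in_hull[OF s0]] by metis
    then show ?thesis by (metis shift_eq_imp)
  qed
  obtain c where c: "hexagonal a" "\<And>U. U \<in> ?X \<Longrightarrow> transport f U = (\<lambda>u. a u + c) ` U"
    using equivariant_homeomorphism_affine[OF k f_endo g_endo inv add ab ba] by blast
  have "f = aff k a c"
  proof (rule homeo_group_eqI[OF f aff_in_homeo_group[OF c(1)]])
    fix U assume "U \<in> topspace ?Y"
    then obtain W where W: "W \<in> ?X" "U = to_complex ` W" by (rule topspace_shiftE)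
    then show "f U = aff k a c U" using transport_apply(1)[OF f W(1)] c(2)[OF W(1)] by (simp add: aff_apply)
  qed
  then show ?thesis using that c(1) by blast
qed

lemma symmetries_eq:
  assumes k: "k \<ge> 2"
  shows "symmetries eis_ints (eis_shift k) = shift_map (eis_shift k) ` eis_ints"
proof -
  let ?G = "homeo_group (eis_shift k)"
  interpret G: group ?G by (rule group_homeo_group)
  note aff_id_in = aff_in_homeo_group[OF hexagonal_id, of k]
  show ?thesis
    unfolding symmetries_def centraliser_def shifts_eq
  proof (intro equalityI subsetI)
    fix f assume "f \<in> {g \<in> carrier ?G. \<forall>h\<in>range (aff k (\<lambda>z. z)). g \<otimes>\<^bsub>?G\<^esub> h = h \<otimes>\<^bsub>?G\<^esub> g}"
    then have f: "f \<in> carrier ?G" and comm: "\<And>c. f \<otimes>\<^bsub>?G\<^esub> aff k (\<lambda>z. z) c = aff k (\<lambda>z. z) c \<otimes>\<^bsub>?G\<^esub> f" by auto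
    let ?g = "inv\<^bsub>?G\<^esub> f"
    have g: "?g \<in> carrier ?G" using f by simp
    have commg: "?g \<otimes>\<^bsub>?G\<^esub> aff k (\<lambda>z. z) c = aff k (\<lambda>z. z) c \<otimes>\<^bsub>?G\<^esub> ?g" for c
    proof -
      have "?g \<otimes>\<^bsub>?G\<^esub> aff k (\<lambda>z. z) c = ?g \<otimes>\<^bsub>?G\<^esub> (aff k (\<lambda>z. z) c \<otimes>\<^bsub>?G\<^esub> f) \<otimes>\<^bsub>?G\<^esub> ?g"
        using f aff_id_in by (simp add: G.m_assoc)
      also have "\<dots> = ?g \<otimes>\<^bsub>?G\<^esub> (f \<otimes>\<^bsub>?G\<^esub> aff k (\<lambda>z. z) c) \<otimes>\<^bsub>?G\<^esub> ?g" by (simp only: comm)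
      also have "\<dots> = aff k (\<lambda>z. z) c \<otimes>\<^bsub>?G\<^esub> ?g"
        using f aff_id_in by (simp add: G.m_assoc[symmetric])
      finally show ?thesis .
    qed
    obtain c where "f = aff k (\<lambda>z. z) c"
      by (rule homeomorphism_normal_form[OF k f g, where a = "\<lambda>t. t" and b = "\<lambda>t. t"])
        (use f comm commg in simp_all)
    then show "f \<in> range (aff k (\<lambda>z. z))" by blast
  next
    fix f assume "f \<in> range (aff k (\<lambda>z. z))"
    then obtain c where c: "f = aff k (\<lambda>z. z) c" by blast
    show "f \<in> {g \<in> carrier ?G. \<forall>h\<in>range (aff k (\<lambda>z. z)). g \<otimes>\<^bsub>?G\<^esub> h = h \<otimes>\<^bsub>?G\<^esub> g}"
      unfolding c using aff_id_in by (auto simp: mult_aff[OF hexagonal_id hexagonal_id] add.commute)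
  qed
qed

lemma in_normalizer_iff:
  fixes G (structure)
  assumes "group G" "H \<subseteq> carrier G"
  shows "g \<in> normalizer G H \<longleftrightarrow> g \<in> carrier G \<and> (\<lambda>h. g \<otimes> h \<otimes> inv g) ` H = H"
proof -
  have "g <#\<^bsub>G\<^esub> H #>\<^bsub>G\<^esub> inv g = (\<lambda>h. g \<otimes> h \<otimes> inv g) ` H" by (auto simp: l_coset_def r_coset_def)
  then show ?thesis using assms by (simp add: normalizer_def stabilizer_def)
qed

text \<open>Conjugation by an element of the normaliser permutes the translations and so defines the map
a to which \<open>homeomorphism_normal_form\<close> applies; conversely, conjugating a translation by an
affine map applies its linear part to the translation vector.\<close>

lemma extended_symmetries_eq:
  assumes k: "k \<ge> 2"
  shows "extended_symmetries eis_ints (eis_shift k) = {aff k A c |A c. hexagonal A}"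
proof -
  let ?G = "homeo_group (eis_shift k)" and ?H = "range (aff k (\<lambda>z. z))"
  interpret G: group ?G by (rule group_homeo_group)
  note aff_id_in = aff_in_homeo_group[OF hexagonal_id, of k]
  have H: "?H \<subseteq> carrier ?G" using aff_id_in by blast
  note norm_iff = in_normalizer_iff[OF group_homeo_group H]
  have sub: "subgroup (normalizer ?G ?H) ?G" by (rule G.normalizer_imp_subgroup[OF H])
  have intertwine: "\<exists>a. \<forall>t. f \<otimes>\<^bsub>?G\<^esub> aff k (\<lambda>z. z) (- t) = aff k (\<lambda>z. z) (- a t) \<otimes>\<^bsub>?G\<^esub> f"
    if f: "f \<in> normalizer ?G ?H" for f
  proof -
    have fG: "f \<in> carrier ?G" and fH: "(\<lambda>h. f \<otimes>\<^bsub>?G\<^esub> h \<otimes>\<^bsub>?G\<^esub> inv\<^bsub>?G\<^esub> f) ` ?H = ?H"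
      using f norm_iff by blast+
    have "\<exists>s. f \<otimes>\<^bsub>?G\<^esub> aff k (\<lambda>z. z) (- t) = aff k (\<lambda>z. z) (- s) \<otimes>\<^bsub>?G\<^esub> f" for t
    proof -
      have "f \<otimes>\<^bsub>?G\<^esub> aff k (\<lambda>z. z) (- t) \<otimes>\<^bsub>?G\<^esub> inv\<^bsub>?G\<^esub> f \<in> ?H" using fH by blast
      then obtain c where "f \<otimes>\<^bsub>?G\<^esub> aff k (\<lambda>z. z) (- t) \<otimes>\<^bsub>?G\<^esub> inv\<^bsub>?G\<^esub> f = aff k (\<lambda>z. z) c" by blast
      then have "f \<otimes>\<^bsub>?G\<^esub> aff k (\<lambda>z. z) (- t) = aff k (\<lambda>z. z) c \<otimes>\<^bsub>?G\<^esub> f"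
        using fG aff_id_in by (metis G.inv_solve_right G.m_closed)
      then show ?thesis by (intro exI[of _ "- c"]) simp
    qed
    then show ?thesis by metis
  qed
  show ?thesis
    unfolding extended_symmetries_def shifts_eq
  proof (intro equalityI subsetI)
    fix f assume f: "f \<in> normalizer ?G ?H"
    then have fG: "f \<in> carrier ?G" using norm_iff by blast
    let ?g = "inv\<^bsub>?G\<^esub> f"
    have gG: "?g \<in> carrier ?G" using fG by simp
    have g: "?g \<in> normalizer ?G ?H" using subgroup.m_inv_closed[OF sub f] .
    obtain a b where a: "\<And>t. f \<otimes>\<^bsub>?G\<^esub> aff k (\<lambda>z. z) (- t) = aff k (\<lambda>z. z) (- a t) \<otimes>\<^bsub>?G\<^esub> f"
      and b: "\<And>t. ?g \<otimes>\<^bsub>?G\<^esub> aff k (\<lambda>z. z) (- t) = aff k (\<lambda>z. z) (- b t) \<otimes>\<^bsub>?G\<^esub> ?g"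
      using intertwine[OF f] intertwine[OF g] by metis
    obtain c where "hexagonal a" "f = aff k a c"
      using homeomorphism_normal_form[OF k fG gG G.r_inv[OF fG] G.l_inv[OF fG] a b] by blast
    then show "f \<in> {aff k A c |A c. hexagonal A}" by blast
  next
    fix f assume "f \<in> {aff k A c |A c. hexagonal A}"
    then obtain A c where A: "hexagonal A" and f: "f = aff k A c" by blast
    obtain B where B: "hexagonal B" "\<And>x. A (B x) = x" "\<And>x. B (A x) = x" using hexagonal_inverse[OF A] by blast
    have fG: "f \<in> carrier ?G" unfolding f by (rule aff_in_homeo_group[OF A])
    have conj: "f \<otimes>\<^bsub>?G\<^esub> aff k (\<lambda>z. z) d \<otimes>\<^bsub>?G\<^esub> inv\<^bsub>?G\<^esub> f = aff k (\<lambda>z. z) (A d)" for d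
    proof -
      have "f \<otimes>\<^bsub>?G\<^esub> aff k (\<lambda>z. z) d = aff k (\<lambda>z. z) (A d) \<otimes>\<^bsub>?G\<^esub> f"
        unfolding f using A by (simp add: mult_aff hexagonal_id add.commute)
      then show ?thesis using fG aff_id_in by (simp add: G.m_assoc)
    qed
    have "(\<lambda>h. f \<otimes>\<^bsub>?G\<^esub> h \<otimes>\<^bsub>?G\<^esub> inv\<^bsub>?G\<^esub> f) ` ?H = range (\<lambda>d. aff k (\<lambda>z. z) (A d))"
      unfolding image_image conj ..
    also have "\<dots> = ?H"
    proof (intro equalityI subsetI)
      fix x assume "x \<in> ?H"
      then obtain d where "x = aff k (\<lambda>z. z) (A (B d))" using B(2) by auto
      then show "x \<in> range (\<lambda>d. aff k (\<lambda>z. z) (A d))" by (rule range_eqI)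
    qed blast
    finally show "f \<in> normalizer ?G ?H" using norm_iff fG by blast
  qed
qed

lemma add_eis_ring [simp]:
  "carrier (add_monoid eis_ring) = eis_ints" "monoid.mult (add_monoid eis_ring) = (+)"
  by (simp_all add: eis_ring_def complex_ring_def)

lemma eis_ints_add: "x \<in> eis_ints \<Longrightarrow> y \<in> eis_ints \<Longrightarrow> x + y \<in> eis_ints"
  by (metis eis_intsE to_complex_add to_complex_in)

lemma group_add_eis: "group (add_monoid eis_ring)"
proof (rule groupI)
  have "(0::complex) \<in> eis_ints" by (metis to_complex_0 to_complex_in)
  then show "\<one>\<^bsub>add_monoid eis_ring\<^esub> \<in> carrier (add_monoid eis_ring)" by simp
  fix x assume "x \<in> carrier (add_monoid eis_ring)"
  then obtain z where "x = to_complex z" using eis_intsE by auto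
  then show "\<exists>y\<in>carrier (add_monoid eis_ring). y \<otimes>\<^bsub>add_monoid eis_ring\<^esub> x = \<one>\<^bsub>add_monoid eis_ring\<^esub>"
  proof (intro bexI[of _ "to_complex (- z)"])
    show "to_complex (- z) \<otimes>\<^bsub>add_monoid eis_ring\<^esub> x = \<one>\<^bsub>add_monoid eis_ring\<^esub>"
      using \<open>x = to_complex z\<close> by (simp add: to_complex_minus)
  qed simp
qed (simp_all add: eis_ints_add add.assoc)

lemma shift_map_iso:
  assumes k: "k \<ge> 2"
  shows "shift_map (eis_shift k) \<in> iso (add_monoid eis_ring) (symmetry_group eis_ints (eis_shift k))"
proof -
  have "shift_map (eis_shift k) \<in> hom (add_monoid eis_ring) (symmetry_group eis_ints (eis_shift k))"
  proof (rule homI)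
    fix x assume "x \<in> carrier (add_monoid eis_ring)"
    then show "shift_map (eis_shift k) x \<in> carrier (symmetry_group eis_ints (eis_shift k))"
      by (simp add: symmetry_group_def symmetries_eq[OF k])
  next
    fix x y assume "x \<in> carrier (add_monoid eis_ring)" "y \<in> carrier (add_monoid eis_ring)"
    then have "x \<in> range to_complex" "y \<in> range to_complex" unfolding range_to_complex by simp_all
    then obtain u v where uv: "x = to_complex u" "y = to_complex v" by blast
    show "shift_map (eis_shift k) (x \<otimes>\<^bsub>add_monoid eis_ring\<^esub> y) =
      shift_map (eis_shift k) x \<otimes>\<^bsub>symmetry_group eis_ints (eis_shift k)\<^esub> shift_map (eis_shift k) y"
      by (simp add: uv to_complex_add[symmetric] shift_map_eq symmetry_group_def
          mult_aff[OF hexagonal_id hexagonal_id] add.commute)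
  qed
  moreover have "inj_on (shift_map (eis_shift k)) eis_ints"
  proof (rule inj_onI)
    fix x y assume xy: "x \<in> eis_ints" "y \<in> eis_ints" "shift_map (eis_shift k) x = shift_map (eis_shift k) y"
    then obtain u v where uv: "x = to_complex u" "y = to_complex v" unfolding range_to_complex[symmetric] by blast
    have "- u = - v" using aff_inject(2)[OF k _ hexagonal_id hexagonal_id] xy(3) unfolding uv shift_map_eq by blast
    then show "x = y" by (simp add: uv)
  qed
  ultimately show ?thesis
    by (simp add: iso_def bij_betw_def symmetry_group_def symmetries_eq[OF k])
qed

lemma monoid_carrier_update:
  "monoid.mult (G\<lparr>carrier := H\<rparr>) = monoid.mult G" "one (G\<lparr>carrier := H\<rparr>) = one G" "carrier (G\<lparr>carrier := H\<rparr>) = H"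
  by simp_all

lemma extended_symmetry_group_simps:
  "carrier (extended_symmetry_group L Y) = extended_symmetries L Y"
  "monoid.mult (extended_symmetry_group L Y) = monoid.mult (homeo_group Y)"
  "one (extended_symmetry_group L Y) = one (homeo_group Y)"
  by (simp_all add: extended_symmetry_group_def)

lemma induced_D6: "induced_map (eis_shift k) ` D6 = (\<lambda>A. aff k A 0) ` carrier hex_group"
  unfolding D6_eq image_image induced_map_lift ..

lemma shifts_normal:
  assumes k: "k \<ge> 2"
  shows "symmetries eis_ints (eis_shift k) \<lhd> extended_symmetry_group eis_ints (eis_shift k)"
proof -
  let ?G = "homeo_group (eis_shift k)"
  interpret G: group ?G by (rule group_homeo_group)
  have shift_mult: "shift_map (eis_shift k) (x \<otimes>\<^bsub>add_monoid eis_ring\<^esub> y) =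
      shift_map (eis_shift k) x \<otimes>\<^bsub>?G\<^esub> shift_map (eis_shift k) y"
    if "x \<in> carrier (add_monoid eis_ring)" "y \<in> carrier (add_monoid eis_ring)" for x y
  proof -
    have "shift_map (eis_shift k) \<in> hom (add_monoid eis_ring) (symmetry_group eis_ints (eis_shift k))"
      using shift_map_iso[OF k] unfolding iso_def by blast
    from hom_mult[OF this that] show ?thesis unfolding symmetry_group_def by (simp only: monoid.simps monoid_carrier_update)
  qed
  have "shift_map (eis_shift k) \<in> hom (add_monoid eis_ring) ?G"
  proof (rule homI)
    fix x assume "x \<in> carrier (add_monoid eis_ring)"
    then have "shift_map (eis_shift k) x \<in> range (aff k (\<lambda>z. z))" using shifts_eq[of k] by auto
    then obtain c where "shift_map (eis_shift k) x = aff k (\<lambda>z. z) c" by (rule rangeE)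
    then show "shift_map (eis_shift k) x \<in> carrier ?G" by (simp add: aff_in_homeo_group hexagonal_id)
  next
    fix x y assume "x \<in> carrier (add_monoid eis_ring)" "y \<in> carrier (add_monoid eis_ring)"
    with shift_mult show "shift_map (eis_shift k) (x \<otimes>\<^bsub>add_monoid eis_ring\<^esub> y) =
      shift_map (eis_shift k) x \<otimes>\<^bsub>?G\<^esub> shift_map (eis_shift k) y" by blast
  qed
  then have "group_hom (add_monoid eis_ring) ?G (shift_map (eis_shift k))"
    by (intro group_hom.intro group_add_eis group_homeo_group group_hom_axioms.intro)
  from group_hom.img_is_subgroup[OF this]
  have "subgroup (shift_map (eis_shift k) ` eis_ints) ?G" by simp
  from G.subgroup_in_normalizer[OF this] show ?thesis
    by (simp add: symmetries_eq[OF k] extended_symmetry_group_def extended_symmetries_def)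
qed

lemma aff_linear_hom:
  assumes k: "k \<ge> 2"
  shows "(\<lambda>A. aff k A 0) \<in> hom hex_group (extended_symmetry_group eis_ints (eis_shift k))"
  by (rule homI) (auto simp: extended_symmetry_group_simps extended_symmetries_eq[OF k] hex_group_def mult_aff hexagonal_0)

lemma group_extended:
  assumes k: "k \<ge> 2"
  shows "group (extended_symmetry_group eis_ints (eis_shift k))"
  using shifts_normal[OF k] by (simp add: normal_def)

lemma semidirect_extended:
  assumes k: "k \<ge> 2"
  shows "semidirect_product (extended_symmetry_group eis_ints (eis_shift k))
       (symmetries eis_ints (eis_shift k)) (induced_map (eis_shift k) ` D6)"
  unfolding semidirect_product_def
proof (intro conjI)
  let ?E = "extended_symmetry_group eis_ints (eis_shift k)"
  show "symmetries eis_ints (eis_shift k) \<lhd> ?E" by (rule shifts_normal[OF k])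
  have "group_hom hex_group ?E (\<lambda>A. aff k A 0)"
    unfolding group_hom_def group_hom_axioms_def
    using group_hex_group group_extended[OF k] aff_linear_hom[OF k] by blast
  from group_hom.img_is_subgroup[OF this]
  show "subgroup (induced_map (eis_shift k) ` D6) ?E" unfolding induced_D6 .
  show "symmetries eis_ints (eis_shift k) \<inter> induced_map (eis_shift k) ` D6 = {\<one>\<^bsub>?E\<^esub>}"
  proof (intro equalityI subsetI)
    fix f assume f: "f \<in> symmetries eis_ints (eis_shift k) \<inter> induced_map (eis_shift k) ` D6"
    then obtain A c where A: "hexagonal A" "f = aff k A 0" "f = aff k (\<lambda>z. z) c"
      unfolding symmetries_eq[OF k] shifts_eq induced_D6 by (auto simp: hex_group_def)
    then have "A = (\<lambda>z. z)" using aff_inject(1)[OF k _ A(1) hexagonal_id] by metis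
    then show "f \<in> {\<one>\<^bsub>?E\<^esub>}" using A(2) by (simp add: extended_symmetry_group_simps homeo_group_one aff_id)
  next
    fix f assume "f \<in> {\<one>\<^bsub>?E\<^esub>}"
    then have f: "f = aff k (\<lambda>z. z) 0" by (simp add: extended_symmetry_group_simps homeo_group_one aff_id)
    then show "f \<in> symmetries eis_ints (eis_shift k) \<inter> induced_map (eis_shift k) ` D6"
      unfolding symmetries_eq[OF k] shifts_eq induced_D6
      using hexagonal_id by (auto simp: hex_group_def)
  qed
  show "symmetries eis_ints (eis_shift k) <#>\<^bsub>?E\<^esub> (induced_map (eis_shift k) ` D6) = carrier ?E"
  proof -
    have "aff k (\<lambda>z. z) c \<otimes>\<^bsub>?E\<^esub> aff k A 0 = aff k A c" if "hexagonal A" for A c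
      using that by (simp add: extended_symmetry_group_simps mult_aff hexagonal_id)
    note m = this
    show ?thesis
      unfolding symmetries_eq[OF k] shifts_eq induced_D6 extended_symmetry_group_simps(1) extended_symmetries_eq[OF k] set_mult_def
    proof (intro equalityI subsetI)
      fix f assume "f \<in> (\<Union>h\<in>range (aff k (\<lambda>z. z)). \<Union>x\<in>(\<lambda>A. aff k A 0) ` carrier hex_group. {h \<otimes>\<^bsub>?E\<^esub> x})"
      then obtain c A where "hexagonal A" "f = aff k (\<lambda>z. z) c \<otimes>\<^bsub>?E\<^esub> aff k A 0"
        by (auto simp: hex_group_def)
      then show "f \<in> {aff k A c |A c. hexagonal A}" using m by blast
    next
      fix f assume "f \<in> {aff k A c |A c. hexagonal A}"
      then obtain A c where A: "hexagonal A" "f = aff k A c" by blast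
      then have "f = aff k (\<lambda>z. z) c \<otimes>\<^bsub>?E\<^esub> aff k A 0" using m by simp
      then show "f \<in> (\<Union>h\<in>range (aff k (\<lambda>z. z)). \<Union>x\<in>(\<lambda>A. aff k A 0) ` carrier hex_group. {h \<otimes>\<^bsub>?E\<^esub> x})"
        using A(1) by (auto simp: hex_group_def)
    qed
  qed
qed

lemma induced_map_iso:
  assumes k: "k \<ge> 2"
  shows "induced_map (eis_shift k) \<in> iso D6_group
       ((extended_symmetry_group eis_ints (eis_shift k))\<lparr>carrier := induced_map (eis_shift k) ` D6\<rparr>)"
    (is "_ \<in> iso _ ?H")
proof -
  have "induced_map (eis_shift k) \<in> hom D6_group ?H"
  proof (rule homI)
    fix x assume "x \<in> carrier D6_group"
    then show "induced_map (eis_shift k) x \<in> carrier ?H" by (simp add: D6_group_simps)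
  next
    fix x y assume "x \<in> carrier D6_group" "y \<in> carrier D6_group"
    then obtain A B where AB: "hexagonal A" "hexagonal B" "x = lift A" "y = lift B"
      by (auto simp: D6_group_simps D6_eq hex_group_def)
    then show "induced_map (eis_shift k) (x \<otimes>\<^bsub>D6_group\<^esub> y) =
      induced_map (eis_shift k) x \<otimes>\<^bsub>?H\<^esub> induced_map (eis_shift k) y"
      by (simp add: D6_group_mult induced_map_lift extended_symmetry_group_simps mult_aff hexagonal_0)
  qed
  moreover have "inj_on (induced_map (eis_shift k)) D6"
  proof (rule inj_onI)
    fix x y assume xy: "x \<in> D6" "y \<in> D6" "induced_map (eis_shift k) x = induced_map (eis_shift k) y"
    then obtain A B where AB: "hexagonal A" "hexagonal B" "x = lift A" "y = lift B"
      by (auto simp: D6_eq hex_group_def)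
    then have "A = B" using xy(3) aff_inject(1)[OF k _ AB(1,2)] unfolding AB(3,4) induced_map_lift by blast
    then show "x = y" using AB by simp
  qed
  ultimately show ?thesis by (simp add: iso_def bij_betw_def D6_group_simps)
qed

section \<open>The additive group, the units and the dihedral group\<close>

lemma eis_add_group_iso: "add_monoid eis_ring \<cong> integer_group \<times>\<times> integer_group"
proof -
  let ?f = "\<lambda>z. (eis_fst (from_complex z), eis_snd (from_complex z))"
  have "?f \<in> hom (add_monoid eis_ring) (integer_group \<times>\<times> integer_group)"
  proof (rule homI)
    fix x y assume "x \<in> carrier (add_monoid eis_ring)" "y \<in> carrier (add_monoid eis_ring)"
    then have "x \<in> range to_complex" "y \<in> range to_complex" unfolding range_to_complex by simp_all
    then obtain u v where uv: "x = to_complex u" "y = to_complex v" by blast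
    show "?f (x \<otimes>\<^bsub>add_monoid eis_ring\<^esub> y) = ?f x \<otimes>\<^bsub>integer_group \<times>\<times> integer_group\<^esub> ?f y"
      unfolding uv by (cases u; cases v) (simp add: to_complex_add[symmetric] integer_group_def del: to_complex.simps)
  qed (simp add: integer_group_def)
  moreover have "bij_betw ?f eis_ints UNIV"
    by (rule bij_betw_byWitness[of _ "\<lambda>(a, b). to_complex (Eis a b)"])
      (auto simp del: to_complex.simps)
  ultimately show ?thesis unfolding is_iso_def iso_def by (auto simp: integer_group_def)
qed

text \<open>Units have norm 1, and 4 N(a + b\<rho>) = (2a - b)^2 + 3 b^2 = (2b - a)^2 + 3 a^2
bounds both coordinates by 1.\<close>

lemma eis_units:
  "{e :: eis. e dvd 1} = {Eis 1 0, Eis 0 (- 1), Eis (- 1) (- 1), Eis (- 1) 0, Eis 0 1, Eis 1 1}"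
proof (intro equalityI subsetI)
  fix e :: eis assume "e \<in> {e. e dvd 1}"
  then have n: "eis_norm e = 1" by (simp add: eis_unit_iff)
  obtain a b where e: "e = Eis a b" by (cases e)
  have "(2 * a - b)\<^sup>2 + 3 * b\<^sup>2 = 4" "(2 * b - a)\<^sup>2 + 3 * a\<^sup>2 = 4"
    using n unfolding e by (simp_all add: power2_eq_square algebra_simps)
  moreover have "(2 * a - b)\<^sup>2 \<ge> 0" "(2 * b - a)\<^sup>2 \<ge> 0" by simp_all
  ultimately have "b\<^sup>2 \<le> 1" "a\<^sup>2 \<le> 1" by linarith+
  then have "\<bar>a\<bar> \<le> 1" "\<bar>b\<bar> \<le> 1" using abs_le_square_iff[of a 1] abs_le_square_iff[of b 1] by simp_all
  then have "a \<in> {- 1, 0, 1}" "b \<in> {- 1, 0, 1}" by auto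
  then show "e \<in> {Eis 1 0, Eis 0 (- 1), Eis (- 1) (- 1), Eis (- 1) 0, Eis 0 1, Eis 1 1}"
    using n unfolding e by auto
qed (auto simp: eis_unit_iff)

lemma card_eis_units: "card {e :: eis. e dvd 1} = 6"
  by (simp add: eis_units)

lemma minus_omega_powers:
  "(- eis_omega) ^ 0 = Eis 1 0" "(- eis_omega) ^ 1 = Eis 0 (- 1)" "(- eis_omega) ^ 2 = Eis (- 1) (- 1)"
  "(- eis_omega) ^ 3 = Eis (- 1) 0" "(- eis_omega) ^ 4 = Eis 0 1" "(- eis_omega) ^ 5 = Eis 1 1"
  by (simp_all add: eis_omega_def one_eis_def eval_nat_numeral)

lemma eis_units_powers: "{e :: eis. e dvd 1} = {(- eis_omega) ^ m |m. m \<le> 5}"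
proof -
  have "{(- eis_omega) ^ m |m::nat. m \<le> 5} = (\<lambda>m. (- eis_omega) ^ m) ` {0, 1, 2, 3, 4, 5}"
  proof -
    have "m \<le> 5 \<longleftrightarrow> m \<in> {0, 1, 2, 3, 4, 5}" for m :: nat by auto
    then show ?thesis by blast
  qed
  also have "\<dots> = {e. e dvd 1}"
    unfolding eis_units by (simp only: image_insert image_empty minus_omega_powers)
  finally show ?thesis by simp
qed

lemma to_complex_omega: "to_complex (- eis_omega) = - eis_rho"
  by (simp add: eis_omega_def)

lemma Units_powers: "Units eis_ring = {(- eis_rho) ^ m |m. m \<le> 5}"
  unfolding Units_eis_ring eis_units_powers
  by (auto simp: to_complex_power to_complex_omega intro!: image_eqI[OF _ CollectI])

lemma monoid_eis_ring: "monoid eis_ring"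
proof
  fix x y assume "x \<in> carrier eis_ring" "y \<in> carrier eis_ring"
  then obtain u v where "x = to_complex u" "y = to_complex v" by (metis eis_intsE eis_ring_simps(1))
  then show "x \<otimes>\<^bsub>eis_ring\<^esub> y \<in> carrier eis_ring" by (simp add: to_complex_mult[symmetric])
next
  have "(1::complex) \<in> eis_ints" by (metis to_complex_1 to_complex_in)
  then show "\<one>\<^bsub>eis_ring\<^esub> \<in> carrier eis_ring" by simp
qed simp_all

lemma group_units_eis: "group (units_of eis_ring)"
  by (rule monoid.units_group[OF monoid_eis_ring])

lemma units_of_simps: "carrier (units_of eis_ring) = to_complex ` {e. e dvd 1}"
  "monoid.mult (units_of eis_ring) = (*)" "one (units_of eis_ring) = 1"
  by (simp_all add: units_of_def Units_eis_ring)

lemma order_units: "order (units_of eis_ring) = 6"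
  unfolding order_def units_of_simps
  by (subst card_image) (auto simp: inj_on_def card_eis_units)

lemma cyclic_units: "cyclic_group (units_of eis_ring)"
proof -
  interpret U: group "units_of eis_ring" by (rule group_units_eis)
  have pow: "x [^]\<^bsub>units_of eis_ring\<^esub> (n::nat) = x ^ n" for x n
    by (induction n) (simp_all add: nat_pow_def units_of_simps mult.commute)
  have mem: "- eis_rho \<in> carrier (units_of eis_ring)"
    unfolding units_of_def Units_powers by (auto intro!: exI[of _ 1])
  have "carrier (units_of eis_ring) \<subseteq> range (\<lambda>n::int. (- eis_rho) [^]\<^bsub>units_of eis_ring\<^esub> n)"
  proof
    fix x assume "x \<in> carrier (units_of eis_ring)"
    then obtain m where "x = (- eis_rho) ^ m" unfolding units_of_def Units_powers by auto
    then have "x = (- eis_rho) [^]\<^bsub>units_of eis_ring\<^esub> (int m)" by (simp add: int_pow_int pow)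
    then show "x \<in> range (\<lambda>n::int. (- eis_rho) [^]\<^bsub>units_of eis_ring\<^esub> n)" by blast
  qed
  moreover have "range (\<lambda>n::int. (- eis_rho) [^]\<^bsub>units_of eis_ring\<^esub> n) \<subseteq> carrier (units_of eis_ring)"
    using U.int_pow_closed[OF mem] by blast
  ultimately show ?thesis unfolding U.cyclic_group using mem by blast
qed

text \<open>A pair of a unit and a flag for conjugation names each of the twelve maps once.\<close>

definition hex_map :: "eis \<times> bool \<Rightarrow> eis \<Rightarrow> eis" where
  "hex_map = (\<lambda>(e, s) z. e * (if s then eis_cnj z else z))"

lemma hex_map_simps: "hex_map (e, False) = (\<lambda>z. e * z)" "hex_map (e, True) = (\<lambda>z. e * eis_cnj z)"
  by (simp_all add: hex_map_def)

lemma carrier_hex_group: "carrier hex_group = hex_map ` ({e. e dvd 1} \<times> UNIV)"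
proof (intro equalityI subsetI)
  fix A assume "A \<in> carrier hex_group"
  then obtain e where "e dvd 1" "A = hex_map (e, False) \<or> A = hex_map (e, True)"
    unfolding hex_map_simps by (auto simp: hex_group_def hexagonal_def)
  then show "A \<in> hex_map ` ({e. e dvd 1} \<times> UNIV)" by blast
next
  fix A assume "A \<in> hex_map ` ({e. e dvd 1} \<times> UNIV)"
  then obtain e s where "e dvd 1" "A = hex_map (e, s)" by blast
  then show "A \<in> carrier hex_group"
    unfolding hex_group_def hexagonal_def by (cases s) (auto simp: hex_map_simps)
qed

lemma inj_hex_map: "inj_on hex_map ({e. e dvd 1} \<times> UNIV)"
proof (rule inj_onI)
  fix x y assume "x \<in> {e. e dvd 1} \<times> UNIV" "y \<in> {e. e dvd 1} \<times> UNIV" and eq: "hex_map x = hex_map y"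
  then obtain e s f t where xy: "x = (e, s)" "y = (f, t)" "e dvd 1" by auto
  have "e = f" using fun_cong[OF eq, of 1] by (simp add: xy hex_map_def split: if_splits)
  moreover have "e \<noteq> 0" using xy(3) by auto
  ultimately have "(if s then eis_cnj eis_omega else eis_omega) = (if t then eis_cnj eis_omega else eis_omega)"
    using fun_cong[OF eq, of eis_omega] by (simp only: xy hex_map_def prod.case mult_cancel_left simp_thms)
  moreover have "eis_cnj eis_omega \<noteq> eis_omega" by (simp add: eis_omega_def)
  ultimately have "s = t" by (metis (full_types))
  then show "x = y" using \<open>e = f\<close> xy by simp
qed

lemma order_D6: "order D6_group = 12"
proof -
  have "order D6_group = card (lift ` carrier hex_group)" by (simp add: order_def D6_group_simps D6_eq)
  also have "\<dots> = card (carrier hex_group)" by (rule card_image) (auto intro!: inj_onI lift_inject)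
  also have "\<dots> = card ({e :: eis. e dvd 1} \<times> (UNIV :: bool set))"
    unfolding carrier_hex_group by (rule card_image[OF inj_hex_map])
  also have "\<dots> = 12" by (simp add: card_cartesian_product card_eis_units)
  finally show ?thesis .
qed

lemma unit_mult_eq: "unit_mult (to_complex e) = lift (\<lambda>z. e * z)"
  by (auto simp: unit_mult_def lift_def fun_eq_iff to_complex_mult)

lemma C6_eq: "C6 = (\<lambda>e. lift (\<lambda>z. e * z)) ` {e. e dvd 1}"
  unfolding C6_def Units_eis_ring image_image unit_mult_eq ..

lemma C2_eq: "C2 = {lift (\<lambda>z. z), lift eis_cnj}"
proof -
  have "(\<lambda>x\<in>eis_ints. x) = lift (\<lambda>z. z)" "(\<lambda>x\<in>eis_ints. cnj x) = lift eis_cnj"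
    by (auto simp: lift_def fun_eq_iff to_complex_cnj)
  then show ?thesis by (simp add: C2_def)
qed

lemma hexagonal_mult: "e dvd 1 \<Longrightarrow> hexagonal (\<lambda>z. e * z)"
  unfolding hexagonal_def by blast

lemma hexagonal_cnj: "hexagonal eis_cnj"
proof -
  have "eis_cnj = (\<lambda>z. 1 * eis_cnj z)" by (rule ext) simp
  then show ?thesis unfolding hexagonal_def using one_dvd by blast
qed

lemma D6_one: "\<one>\<^bsub>D6_group\<^esub> = lift (\<lambda>z. z)"
  by (auto simp: D6_group_simps lift_def fun_eq_iff)

lemma D6_inv:
  assumes "hexagonal A" "hexagonal B" "\<And>x. B (A x) = x"
  shows "inv\<^bsub>D6_group\<^esub> (lift A) = lift B"
proof -
  interpret group D6_group by (rule group_D6)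
  have "lift B \<otimes>\<^bsub>D6_group\<^esub> lift A = \<one>\<^bsub>D6_group\<^esub>" using assms by (simp add: D6_group_mult D6_one)
  then show ?thesis
    using assms by (intro inv_equality) (auto simp: D6_group_simps D6_eq hex_group_def)
qed

lemma unit_inverse:
  assumes "(e :: eis) dvd 1" obtains f where "f dvd 1" "f * e = 1"
proof -
  obtain f where f: "1 = e * f" using assms by blast
  then have "f dvd 1" by (metis dvd_triv_right)
  then show ?thesis using that f by (metis mult.commute)
qed

lemma lift_in_D6: "hexagonal A \<Longrightarrow> lift A \<in> carrier D6_group"
  by (auto simp: D6_group_simps D6_eq hex_group_def)

lemma unit_mult_iso: "unit_mult \<in> iso (units_of eis_ring) (D6_group\<lparr>carrier := C6\<rparr>)"
proof -
  have "unit_mult \<in> hom (units_of eis_ring) (D6_group\<lparr>carrier := C6\<rparr>)"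
  proof (rule homI)
    fix x y assume "x \<in> carrier (units_of eis_ring)" "y \<in> carrier (units_of eis_ring)"
    then obtain e f where ef: "e dvd 1" "f dvd 1" "x = to_complex e" "y = to_complex f"
      unfolding units_of_simps by blast
    then show "unit_mult (x \<otimes>\<^bsub>units_of eis_ring\<^esub> y) = unit_mult x \<otimes>\<^bsub>D6_group\<lparr>carrier := C6\<rparr>\<^esub> unit_mult y"
      by (simp add: units_of_simps to_complex_mult[symmetric] unit_mult_eq D6_group_mult hexagonal_mult mult.assoc)
  qed (simp add: C6_def units_of_def)
  moreover have "inj_on unit_mult (Units eis_ring)"
  proof (rule inj_onI)
    fix x y assume "x \<in> Units eis_ring" "y \<in> Units eis_ring" and eq: "unit_mult x = unit_mult y"
    then obtain e f where ef: "x = to_complex e" "y = to_complex f" unfolding Units_eis_ring by blast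
    then have "(\<lambda>z. e * z) = (\<lambda>z. f * z)" using eq by (simp add: unit_mult_eq lift_inject)
    from fun_cong[OF this, of 1] show "x = y" using ef by simp
  qed
  ultimately show ?thesis by (simp add: iso_def bij_betw_def C6_def units_of_def)
qed

lemma semidirect_D6: "semidirect_product D6_group C6 C2"
proof -
  interpret D: group D6_group by (rule group_D6)
  have C6_sub: "subgroup C6 D6_group"
  proof (rule D.subgroupI)
    show "C6 \<subseteq> carrier D6_group" unfolding C6_eq using lift_in_D6 hexagonal_mult by blast
    show "C6 \<noteq> {}" unfolding C6_eq using one_dvd by blast
  next
    fix x assume "x \<in> C6"
    then obtain e where e: "e dvd 1" "x = lift (\<lambda>z. e * z)" unfolding C6_eq by blast
    obtain f where f: "f dvd 1" "f * e = 1" using unit_inverse e(1) by blast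
    have "inv\<^bsub>D6_group\<^esub> x = lift (\<lambda>z. f * z)"
      unfolding e(2) by (rule D6_inv) (use e f in \<open>simp_all add: hexagonal_mult mult.assoc[symmetric]\<close>)
    then show "inv\<^bsub>D6_group\<^esub> x \<in> C6" unfolding C6_eq using f(1) by blast
  next
    fix x y assume "x \<in> C6" "y \<in> C6"
    then obtain e f where ef: "e dvd 1" "f dvd 1" "x = lift (\<lambda>z. e * z)" "y = lift (\<lambda>z. f * z)"
      unfolding C6_eq by blast
    then have "x \<otimes>\<^bsub>D6_group\<^esub> y = lift (\<lambda>z. (e * f) * z)"
      by (simp add: D6_group_mult hexagonal_mult mult.assoc)
    moreover have "e * f dvd 1" using ef(1,2) by (simp add: eis_unit_iff eis_norm_mult)
    ultimately show "x \<otimes>\<^bsub>D6_group\<^esub> y \<in> C6" unfolding C6_eq by blast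
  qed
  have normal: "C6 \<lhd> D6_group"
    unfolding D.normal_inv_iff
  proof (intro conjI ballI C6_sub)
    fix x h assume "x \<in> carrier D6_group" "h \<in> C6"
    then obtain A e where A: "hexagonal A" "x = lift A" and e: "e dvd 1" "h = lift (\<lambda>z. e * z)"
      unfolding C6_eq D6_group_simps D6_eq hex_group_def by auto
    obtain B where B: "hexagonal B" "\<And>z. A (B z) = z" "\<And>z. B (A z) = z" using hexagonal_inverse[OF A(1)] by blast
    have eq: "x \<otimes>\<^bsub>D6_group\<^esub> h \<otimes>\<^bsub>D6_group\<^esub> inv\<^bsub>D6_group\<^esub> x = lift (\<lambda>z. A (e * B z))"
    proof -
      have i: "inv\<^bsub>D6_group\<^esub> x = lift B"
        unfolding A(2) by (rule D6_inv[OF A(1) B(1) B(3)])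
      have "x \<otimes>\<^bsub>D6_group\<^esub> h = lift (\<lambda>z. A (e * z))"
        unfolding A(2) e(2) by (rule D6_group_mult[OF A(1) hexagonal_mult[OF e(1)]])
      then show ?thesis
        unfolding i using D6_group_mult[OF hexagonal_comp[OF A(1) hexagonal_mult[OF e(1)]] B(1)] by simp
    qed
    have ce: "eis_cnj e dvd 1" using e(1) by (simp add: eis_unit_iff)
    obtain u where u: "A = (\<lambda>z. u * z) \<or> A = (\<lambda>z. u * eis_cnj z)" using A(1) unfolding hexagonal_def by blast
    then have "(\<lambda>z. A (e * B z)) = (\<lambda>z. e * z) \<or> (\<lambda>z. A (e * B z)) = (\<lambda>z. eis_cnj e * z)"
    proof
      assume Au: "A = (\<lambda>z. u * z)"
      have "A (e * B z) = e * A (B z)" for z by (simp add: Au)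
      then show ?thesis using B(2) by simp
    next
      assume Au: "A = (\<lambda>z. u * eis_cnj z)"
      have "A (e * B z) = eis_cnj e * A (B z)" for z by (simp add: Au eis_cnj_mult)
      then show ?thesis using B(2) by simp
    qed
    then show "x \<otimes>\<^bsub>D6_group\<^esub> h \<otimes>\<^bsub>D6_group\<^esub> inv\<^bsub>D6_group\<^esub> x \<in> C6"
      unfolding eq C6_eq using e(1) ce by auto
  qed
  have C2_sub: "subgroup C2 D6_group"
  proof (rule D.subgroupI)
    show "C2 \<subseteq> carrier D6_group" unfolding C2_eq using lift_in_D6 hexagonal_id hexagonal_cnj by blast
    show "C2 \<noteq> {}" unfolding C2_eq by blast
    have "inv\<^bsub>D6_group\<^esub> (lift (\<lambda>z. z)) = lift (\<lambda>z. z)" "inv\<^bsub>D6_group\<^esub> (lift eis_cnj) = lift eis_cnj"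
      by (intro D6_inv hexagonal_id hexagonal_cnj; simp)+
    then show "inv\<^bsub>D6_group\<^esub> x \<in> C2" if "x \<in> C2" for x using that unfolding C2_eq by auto
    show "x \<otimes>\<^bsub>D6_group\<^esub> y \<in> C2" if "x \<in> C2" "y \<in> C2" for x y
      using that unfolding C2_eq by (auto simp: D6_group_mult hexagonal_id hexagonal_cnj)
  qed
  have "C6 \<inter> C2 = {\<one>\<^bsub>D6_group\<^esub>}"
  proof -
    have eq: "(\<lambda>z :: eis. 1 * z) = (\<lambda>z. z)" by (rule ext) simp
    have "lift (\<lambda>z. 1 * z) \<in> C6" unfolding C6_eq using one_dvd by blast
    then have "lift (\<lambda>z. z) \<in> C6" unfolding eq .
    moreover have "lift eis_cnj \<notin> C6"
    proof
      assume "lift eis_cnj \<in> C6"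
      then obtain e where "eis_cnj = (\<lambda>z. e * z)" unfolding C6_eq using lift_inject by blast
      from fun_cong[OF this, of 1] fun_cong[OF this, of eis_omega] show False
        by (simp add: eis_omega_def)
    qed
    ultimately show ?thesis unfolding C2_eq D6_one by auto
  qed
  moreover have "C6 <#>\<^bsub>D6_group\<^esub> C2 = carrier D6_group"
  proof (intro equalityI subsetI)
    fix x assume "x \<in> C6 <#>\<^bsub>D6_group\<^esub> C2"
    then show "x \<in> carrier D6_group"
      using C6_sub C2_sub D.m_closed unfolding set_mult_def by (auto dest: subgroup.mem_carrier)
  next
    fix x assume "x \<in> carrier D6_group"
    then obtain e where e: "e dvd 1" "x = lift (\<lambda>z. e * z) \<or> x = lift (\<lambda>z. e * eis_cnj z)"
      by (auto simp: D6_group_simps D6_eq hex_group_def hexagonal_def)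
    have "lift (\<lambda>z. e * z) \<in> C6" unfolding C6_eq using e(1) by blast
    moreover have "lift (\<lambda>z. e * z) = lift (\<lambda>z. e * z) \<otimes>\<^bsub>D6_group\<^esub> lift (\<lambda>z. z)"
      "lift (\<lambda>z. e * eis_cnj z) = lift (\<lambda>z. e * z) \<otimes>\<^bsub>D6_group\<^esub> lift eis_cnj"
      using e(1) by (simp_all add: D6_group_mult hexagonal_mult hexagonal_id hexagonal_cnj)
    ultimately have "\<exists>h\<in>C6. \<exists>k\<in>C2. x = h \<otimes>\<^bsub>D6_group\<^esub> k" using e(2) unfolding C2_eq by blast
    then show "x \<in> C6 <#>\<^bsub>D6_group\<^esub> C2" unfolding set_mult_def by blast
  qed
  ultimately show ?thesis unfolding semidirect_product_def using normal C2_sub by blast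
qed

section \<open>Isometries of the regular hexagon\<close>

lemma sixth_roots: "{z :: complex. z ^ 6 = 1} = to_complex ` {e. e dvd 1}"
proof (intro equalityI subsetI)
  fix z :: complex assume "z \<in> {z. z ^ 6 = 1}"
  then have z: "z ^ 6 = 1" by simp
  let ?r = eis_rho
  have fac: "(z - ?r) * (z - (- 1 - ?r)) = z * z + z + 1" "(z - - ?r) * (z - (1 + ?r)) = z * z - z + 1"
    using eis_rho_square by (simp_all add: algebra_simps)
  have "(z - 1) * (z - - 1) * ((z - ?r) * (z - (- 1 - ?r))) * ((z - - ?r) * (z - (1 + ?r))) = z ^ 6 - 1"
    unfolding fac by (simp add: algebra_simps eval_nat_numeral)
  also have "\<dots> = 0" using z by simp
  finally have "z = 1 \<or> z = - 1 \<or> z = ?r \<or> z = - 1 - ?r \<or> z = - ?r \<or> z = 1 + ?r"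
    by (simp only: mult_eq_0_iff right_minus_eq disj_assoc)
  then have "z \<in> to_complex ` {Eis 1 0, Eis 0 (- 1), Eis (- 1) (- 1), Eis (- 1) 0, Eis 0 1, Eis 1 1}"
    by auto
  then show "z \<in> to_complex ` {e. e dvd 1}" unfolding eis_units .
next
  fix z assume "z \<in> to_complex ` {e. e dvd 1}"
  then obtain m where "z = to_complex ((- eis_omega) ^ m)" unfolding eis_units_powers by blast
  then have "z ^ 6 = to_complex (((- eis_omega) ^ 6) ^ m)"
    by (simp add: to_complex_power[symmetric] power_mult[symmetric] mult.commute)
  also have "(- eis_omega) ^ 6 = 1"
    by (simp add: eis_omega_def one_eis_def eval_nat_numeral)
  finally show "z \<in> {z. z ^ 6 = 1}" by simp
qed

lemma norm_sixth_root: "z ^ 6 = 1 \<Longrightarrow> norm (z :: complex) = 1"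
  by (metis norm_ge_zero norm_one norm_power power_eq_1_iff zero_neq_numeral)

text \<open>A point z of norm 1 is separated from all other points of the unit circle by the
half-plane {y : \<langle> z, y \<rangle> < 1}, so it is in the convex hull of a subset of the
circle only if it belongs to the subset.\<close>

lemma hexagon_vertex:
  assumes "z \<in> regular_hexagon" "norm z = 1"
  shows "z ^ 6 = 1"
proof (rule ccontr)
  assume nz: "z ^ 6 \<noteq> 1"
  have "{z. z ^ 6 = 1} \<subseteq> {y. z \<bullet> y < 1}"
  proof
    fix y assume "y \<in> {z :: complex. z ^ 6 = 1}"
    then have y: "norm y = 1" "y \<noteq> z" using norm_sixth_root nz by auto
    then have "0 < (norm (z - y))\<^sup>2" by simp
    also have "\<dots> = 2 - 2 * (z \<bullet> y)"
      using y(1) assms(2) by (simp add: power2_norm_eq_inner inner_diff inner_commute norm_eq_1)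
    finally show "y \<in> {y. z \<bullet> y < 1}" by simp
  qed
  then have "regular_hexagon \<subseteq> {y. z \<bullet> y < 1}"
    unfolding regular_hexagon_def by (rule hull_minimal) (rule convex_halfspace_lt)
  then have "z \<bullet> z < 1" using assms(1) by blast
  then show False using assms(2) by (simp add: norm_eq_1)
qed

lemma hexagon_norm: "z \<in> regular_hexagon \<Longrightarrow> norm z \<le> 1"
proof -
  have "regular_hexagon \<subseteq> cball 0 1"
    unfolding regular_hexagon_def by (rule hull_minimal) (auto simp: norm_sixth_root)
  then show "z \<in> regular_hexagon \<Longrightarrow> norm z \<le> 1" by auto
qed

definition complex_hex_map :: "eis \<times> bool \<Rightarrow> complex \<Rightarrow> complex" where
  "complex_hex_map = (\<lambda>(e, s) z. to_complex e * (if s then cnj z else z))"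

lemma complex_hex_map_hexagon:
  assumes "e dvd 1"
  shows "complex_hex_map (e, s) ` regular_hexagon = regular_hexagon"
proof -
  have lin: "linear (complex_hex_map (e, s))"
    by (rule linearI) (auto simp: complex_hex_map_def algebra_simps scaleR_conv_of_real)
  have six: "to_complex e ^ 6 = 1" using assms sixth_roots by blast
  have "complex_hex_map (e, s) ` {z. z ^ 6 = 1} = {z. z ^ 6 = 1}"
  proof (intro equalityI subsetI)
    fix y assume "y \<in> complex_hex_map (e, s) ` {z. z ^ 6 = 1}"
    then show "y \<in> {z. z ^ 6 = 1}"
      using six by (auto simp: complex_hex_map_def power_mult_distrib simp flip: complex_cnj_power)
  next
    fix y :: complex assume y: "y \<in> {z. z ^ 6 = 1}"
    have e0: "to_complex e \<noteq> 0" using six by auto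
    let ?x = "if s then cnj (y / to_complex e) else y / to_complex e"
    have "y = complex_hex_map (e, s) ?x" using e0 by (simp add: complex_hex_map_def)
    moreover have "?x ^ 6 = 1" using y six by (simp add: power_divide flip: complex_cnj_power)
    ultimately show "y \<in> complex_hex_map (e, s) ` {z. z ^ 6 = 1}" by blast
  qed
  then show ?thesis unfolding regular_hexagon_def convex_hull_linear_image[OF lin] by simp
qed

lemma complex_hex_map_isometry:
  assumes "e dvd 1"
  shows "dist (complex_hex_map (e, s) x) (complex_hex_map (e, s) y) = dist x y"
proof -
  have n: "norm (to_complex e) = 1" using assms sixth_roots norm_sixth_root by blast
  have "complex_hex_map (e, s) x - complex_hex_map (e, s) y = to_complex e * (if s then cnj (x - y) else x - y)"
    by (simp add: complex_hex_map_def algebra_simps)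
  then show ?thesis unfolding dist_norm by (simp add: norm_mult n del: complex_cnj_diff)
qed

lemma complex_hex_map_bij:
  assumes "e dvd 1"
  shows "bij (complex_hex_map (e, s))"
proof (rule o_bij)
  have e0: "to_complex e \<noteq> 0" using assms by (auto simp flip: to_complex_0)
  let ?g = "\<lambda>y. if s then cnj (y / to_complex e) else y / to_complex e"
  show "?g \<circ> complex_hex_map (e, s) = id" "complex_hex_map (e, s) \<circ> ?g = id"
    using e0 by (auto simp: complex_hex_map_def fun_eq_iff)
qed

text \<open>The origin is fixed: all points of the hexagon, in particular 1 and -1, lie within
distance 1 of the image of the origin, and only the origin itself is that close to both. So f is an orthogonal
map; it is determined by the vertex f(1) and by its orientation.\<close>

lemma hexagon_isometry:
  assumes iso: "\<And>x y. dist (f x) (f y) = dist x (y :: complex)" and P: "f ` regular_hexagon = regular_hexagon"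
  obtains e s where "e dvd 1" "f = complex_hex_map (e, s)"
proof -
  have vert: "z \<in> regular_hexagon" if "z ^ 6 = 1" for z
    unfolding regular_hexagon_def using that by (simp add: hull_inc)
  have one: "1 \<in> regular_hexagon" "- 1 \<in> regular_hexagon" by (simp_all add: vert)
  have near: "dist y (f 0) \<le> 1" if "y \<in> regular_hexagon" for y
  proof -
    have "y \<in> f ` regular_hexagon" unfolding P by (rule that)
    then obtain x where x: "y = f x" "x \<in> regular_hexagon" by (rule imageE)
    then have "dist y (f 0) = norm x" by (simp add: iso)
    then show ?thesis using hexagon_norm x(2) by simp
  qed
  have f0: "f 0 = 0"
  proof -
    have "norm (1 - f 0) \<le> 1" "norm (- 1 - f 0) \<le> 1" using near one by (simp_all add: dist_norm)
    then have "(norm (1 - f 0))\<^sup>2 \<le> 1" "(norm (- 1 - f 0))\<^sup>2 \<le> 1" by (simp_all add: power_le_one)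
    then have "(norm (f 0))\<^sup>2 \<le> 0"
      unfolding cmod_power2 by (simp add: power2_eq_square algebra_simps)
    then show ?thesis by simp
  qed
  have orth: "orthogonal_transformation f"
    unfolding orthogonal_transformation_isometry using iso f0 by blast
  then have lin: "linear f" and inner: "\<And>v w. f v \<bullet> f w = v \<bullet> w"
    by (auto simp: orthogonal_transformation_def)
  have n1: "norm (f 1) = 1" using inner[of 1 1] by (simp add: norm_eq_1)
  have "f 1 \<in> regular_hexagon" using imageI[OF one(1), of f] unfolding P .
  then have "f 1 ^ 6 = 1" using n1 by (rule hexagon_vertex)
  then obtain e where e: "e dvd 1" "f 1 = to_complex e" using sixth_roots by blast
  have fz: "f z = of_real (Re z) * f 1 + of_real (Im z) * f \<i>" for z
  proof -
    have "z = Re z *\<^sub>R 1 + Im z *\<^sub>R \<i>" by (simp add: complex_eq_iff)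
    then have "f z = f (Re z *\<^sub>R 1 + Im z *\<^sub>R \<i>)" by simp
    also have "\<dots> = Re z *\<^sub>R f 1 + Im z *\<^sub>R f \<i>" using lin by (simp add: linear_add linear_scale)
    finally show ?thesis by (simp add: scaleR_conv_of_real)
  qed
  \<comment> \<open>The quotient of f(i) by f(1), which has norm 1.\<close>
  define c where "c = f \<i> * cnj (f 1)"
  have ca: "f \<i> = c * f 1"
  proof -
    have "f 1 * cnj (f 1) = 1" using complex_norm_square[of "f 1"] n1 by simp
    then have "f \<i> * (f 1 * cnj (f 1)) = f \<i>" by simp
    then show ?thesis unfolding c_def by (simp add: ac_simps)
  qed
  have "Re c = 0" using inner[of \<i> 1] by (simp add: c_def inner_complex_def)
  moreover have "norm (f \<i>) = 1" using inner[of \<i> \<i>] by (simp add: norm_eq_1)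
  then have "(norm c)\<^sup>2 = 1" by (simp add: c_def norm_mult n1)
  ultimately have "(Im c)\<^sup>2 = 1" by (simp add: cmod_power2)
  then have "Im c = 1 \<or> Im c = - 1" by (simp add: power2_eq_1_iff)
  then have "c = \<i> \<or> c = - \<i>" using \<open>Re c = 0\<close> by (simp add: complex_eq_iff)
  then show ?thesis
  proof
    assume "c = \<i>"
    have "f z = complex_hex_map (e, False) z" for z
    proof -
      have "f z = (of_real (Re z) + \<i> * of_real (Im z)) * f 1"
        unfolding fz[of z] ca \<open>c = \<i>\<close> by (simp add: algebra_simps)
      then show ?thesis by (simp add: complex_hex_map_def e(2) complex_eq[symmetric] mult.commute)
    qed
    then show ?thesis using that[OF e(1)] by blast
  next
    assume "c = - \<i>"
    have "f z = complex_hex_map (e, True) z" for z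
    proof -
      have "f z = (of_real (Re z) - \<i> * of_real (Im z)) * f 1"
        unfolding fz[of z] ca \<open>c = - \<i>\<close> by (simp add: algebra_simps)
      moreover have "of_real (Re z) - \<i> * of_real (Im z) = cnj z" by (simp add: complex_eq_iff)
      ultimately show ?thesis by (simp add: complex_hex_map_def e(2) mult.commute)
    qed
    then show ?thesis using that[OF e(1)] by blast
  qed
qed

lemma isometry_group_carrier:
  "carrier (isometry_group_of regular_hexagon) = complex_hex_map ` ({e. e dvd 1} \<times> UNIV)"
proof (intro equalityI subsetI)
  fix f assume "f \<in> carrier (isometry_group_of regular_hexagon)"
  then have "\<And>x y. dist (f x) (f y) = dist x y" "f ` regular_hexagon = regular_hexagon"
    by (auto simp: isometry_group_of_def)
  then obtain e s where "e dvd 1" "f = complex_hex_map (e, s)" using hexagon_isometry by metis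
  then show "f \<in> complex_hex_map ` ({e. e dvd 1} \<times> UNIV)" by blast
next
  fix f assume "f \<in> complex_hex_map ` ({e. e dvd 1} \<times> UNIV)"
  then obtain e s where "e dvd 1" "f = complex_hex_map (e, s)" by blast
  then show "f \<in> carrier (isometry_group_of regular_hexagon)"
    using complex_hex_map_hexagon complex_hex_map_isometry complex_hex_map_bij
    by (simp add: isometry_group_of_def Bij_def)
qed

lemma restrict_complex_hex_map: "restrict (complex_hex_map x) eis_ints = lift (hex_map x)"
  by (cases x) (auto simp: complex_hex_map_def hex_map_def lift_def fun_eq_iff to_complex_mult to_complex_cnj)

lemma isometry_group_iso: "(\<lambda>f. restrict f eis_ints) \<in> iso (isometry_group_of regular_hexagon) D6_group"
proof -
  let ?G = "isometry_group_of regular_hexagon"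
  have bij: "f \<in> Bij UNIV" if "f \<in> carrier ?G" for f using that by (simp add: isometry_group_of_def)
  have "(\<lambda>f. restrict f eis_ints) \<in> hom ?G D6_group"
  proof (rule homI)
    fix f assume "f \<in> carrier ?G"
    then show "restrict f eis_ints \<in> carrier D6_group"
      unfolding isometry_group_carrier D6_group_simps D6_eq carrier_hex_group by (auto simp: restrict_complex_hex_map)
  next
    fix f g assume f: "f \<in> carrier ?G" and g: "g \<in> carrier ?G"
    then obtain x y where xy0: "f = complex_hex_map x" "g = complex_hex_map y"
      "x \<in> {e. e dvd 1} \<times> UNIV" "y \<in> {e. e dvd 1} \<times> UNIV"
      unfolding isometry_group_carrier by blast
    then have "hex_map x \<in> carrier hex_group" "hex_map y \<in> carrier hex_group"
      unfolding carrier_hex_group by blast+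
    then have xy: "f = complex_hex_map x" "g = complex_hex_map y" "hexagonal (hex_map x)" "hexagonal (hex_map y)"
      using xy0 by (simp_all add: hex_group_def)
    have "f \<otimes>\<^bsub>?G\<^esub> g = compose UNIV f g"
      using bij[OF f] bij[OF g] by (simp add: isometry_group_of_def BijGroup_def)
    then have "restrict (f \<otimes>\<^bsub>?G\<^esub> g) eis_ints = compose eis_ints (restrict f eis_ints) (restrict g eis_ints)"
    proof -
      have "g z \<in> eis_ints" if "z \<in> eis_ints" for z
      proof -
        have "g z = lift (hex_map y) z" using that by (simp add: restrict_complex_hex_map[symmetric] xy)
        then show ?thesis using that by (simp add: lift_def)
      qed
      then show ?thesis using \<open>f \<otimes>\<^bsub>?G\<^esub> g = compose UNIV f g\<close> by (auto simp: compose_def fun_eq_iff)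
    qed
    then show "restrict (f \<otimes>\<^bsub>?G\<^esub> g) eis_ints = restrict f eis_ints \<otimes>\<^bsub>D6_group\<^esub> restrict g eis_ints"
      using xy by (simp add: restrict_complex_hex_map lift_compose D6_group_mult)
  qed
  moreover have "inj_on (\<lambda>f. restrict f eis_ints) (carrier ?G)"
    unfolding isometry_group_carrier
  proof (rule inj_onI)
    fix f g assume f: "f \<in> complex_hex_map ` ({e. e dvd 1} \<times> UNIV)" and g: "g \<in> complex_hex_map ` ({e. e dvd 1} \<times> UNIV)"
      and eq: "restrict f eis_ints = restrict g eis_ints"
    obtain x y where xy: "f = complex_hex_map x" "g = complex_hex_map y" "x \<in> {e. e dvd 1} \<times> UNIV" "y \<in> {e. e dvd 1} \<times> UNIV"
      using f g by blast
    have "hex_map x = hex_map y" using eq unfolding xy restrict_complex_hex_map by (rule lift_inject)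
    then have "x = y" using inj_hex_map xy(3,4) by (auto dest: inj_onD)
    then show "f = g" using xy by simp
  qed
  moreover have "(\<lambda>f. restrict f eis_ints) ` carrier ?G = carrier D6_group"
    unfolding isometry_group_carrier D6_group_simps D6_eq carrier_hex_group image_image restrict_complex_hex_map ..
  ultimately show ?thesis by (simp add: iso_def bij_betw_def)
qed

section \<open>Automorphisms of the number field\<close>

lemma complex_ring_simps [simp]:
  "carrier complex_ring = UNIV" "monoid.mult complex_ring = (*)" "one complex_ring = 1"
  "ring.zero complex_ring = 0" "ring.add complex_ring = (+)"
  by (simp_all add: complex_ring_def)

lemma cring_complex_ring: "cring complex_ring"
proof (rule cringI)
  show "abelian_group complex_ring"
  proof (rule abelian_groupI)
    fix x :: complex
    show "\<exists>y\<in>carrier complex_ring. y \<oplus>\<^bsub>complex_ring\<^esub> x = \<zero>\<^bsub>complex_ring\<^esub>"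
      by (intro bexI[of _ "- x"]) simp_all
  qed (simp_all add: algebra_simps)
  show "comm_monoid complex_ring" by (rule comm_monoidI) (simp_all add: algebra_simps)
qed (simp_all add: algebra_simps)

lemma a_inv_complex_ring: "\<ominus>\<^bsub>complex_ring\<^esub> x = - x"
proof -
  interpret cring complex_ring by (rule cring_complex_ring)
  show ?thesis by (rule minus_equality) simp_all
qed

lemma m_inv_complex_ring: "x \<noteq> 0 \<Longrightarrow> inv\<^bsub>complex_ring\<^esub> x = inverse x"
proof -
  assume "x \<noteq> 0"
  interpret cring complex_ring by (rule cring_complex_ring)
  show ?thesis by (rule comm_inv_char) (use \<open>x \<noteq> 0\<close> in simp_all)
qed

text \<open>The field Q(\<rho>), as shown by \<open>carrier_Q_rho\<close>.\<close>

definition rational_span :: "complex set" where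
  "rational_span = {of_rat a + of_rat b * eis_rho |a b. True}"

lemma rational_spanI: "of_rat a + of_rat b * eis_rho \<in> rational_span"
  unfolding rational_span_def by blast

lemma rational_span_mult:
  "(of_rat a + of_rat b * eis_rho) * (of_rat c + of_rat d * eis_rho) =
    of_rat (a * c - b * d) + of_rat (a * d + b * c - b * d) * eis_rho"
proof -
  have "(of_rat a + of_rat b * eis_rho) * (of_rat c + of_rat d * eis_rho) =
    of_rat a * of_rat c + (of_rat a * of_rat d + of_rat b * of_rat c) * eis_rho + of_rat b * of_rat d * (eis_rho * eis_rho)"
    by (simp add: algebra_simps)
  then show ?thesis unfolding eis_rho_square by (simp add: of_rat_add of_rat_diff of_rat_mult algebra_simps)
qed

lemma cnj_of_rat: "cnj (of_rat q) = of_rat q"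
  by (cases q) (simp add: of_rat_rat)

lemma rational_span_inverse:
  assumes "x \<in> rational_span" "x \<noteq> 0" shows "inverse x \<in> rational_span"
proof -
  obtain a b where x: "x = of_rat a + of_rat b * eis_rho" using assms(1) unfolding rational_span_def by blast
  define y where "y = (of_rat (a - b) + of_rat (- b) * eis_rho :: complex)"
  define n where "n = a * a - a * b + b * b"
  have yc: "y = cnj x"
    by (simp add: x y_def cnj_of_rat cnj_eis_rho of_rat_diff of_rat_minus algebra_simps)
  have "x * y = of_rat n"
    unfolding x y_def rational_span_mult by (simp add: n_def algebra_simps)
  moreover have "y \<noteq> 0" using yc assms(2) by simp
  ultimately have n0: "(of_rat n :: complex) \<noteq> 0" using assms(2) by auto
  then have "n \<noteq> 0" by auto
  have "x * (of_rat (inverse n) * y) = of_rat (inverse n) * (x * y)" by (simp only: ac_simps)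
  also have "\<dots> = of_rat (inverse n * n)" by (simp only: \<open>x * y = of_rat n\<close> of_rat_mult)
  also have "\<dots> = 1" using \<open>n \<noteq> 0\<close> by simp
  finally have "inverse x = of_rat (inverse n) * y" by (rule inverse_unique)
  also have "\<dots> = of_rat (inverse n * (a - b)) + of_rat (inverse n * (- b)) * eis_rho"
    by (simp only: y_def of_rat_mult distrib_left mult.assoc)
  finally show ?thesis using rational_spanI by simp
qed

lemma carrier_Q_rho: "carrier Q_rho = rational_span"
proof -
  let ?K = "generate_field complex_ring (\<rat> \<union> {eis_rho})"
  have "x \<in> rational_span" if "x \<in> ?K" for x
    using that
  proof (induction rule: generate_field.induct)
    case one
    show ?case using rational_spanI[of 1 0] by simp
  next
    case (incl h)
    then consider q where "h = of_rat q" | "h = eis_rho" by (auto simp: Rats_def)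
    then show ?case
    proof cases
      case 1
      then show ?thesis using rational_spanI[of q 0] by simp
    next
      case 2
      then show ?thesis using rational_spanI[of 0 1] by simp
    qed
  next
    case (a_inv h)
    then obtain a b where "h = of_rat a + of_rat b * eis_rho" unfolding rational_span_def by blast
    then have "- h = of_rat (- a) + of_rat (- b) * eis_rho" by (simp add: of_rat_minus)
    then show ?case unfolding a_inv_complex_ring using rational_spanI by metis
  next
    case (m_inv h)
    then show ?case using rational_span_inverse by (simp add: m_inv_complex_ring)
  next
    case (eng_add x y)
    then obtain a b c d where "x = of_rat a + of_rat b * eis_rho" "y = of_rat c + of_rat d * eis_rho"
      unfolding rational_span_def by blast
    then have "x + y = of_rat (a + c) + of_rat (b + d) * eis_rho" by (simp add: of_rat_add algebra_simps)
    then show ?case using rational_spanI by (metis complex_ring_simps(5))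
  next
    case (eng_mult x y)
    then obtain a b c d where "x = of_rat a + of_rat b * eis_rho" "y = of_rat c + of_rat d * eis_rho"
      unfolding rational_span_def by blast
    then show ?case using rational_spanI by (simp add: rational_span_mult del: of_rat_add of_rat_diff)
  qed
  moreover have "x \<in> ?K" if x_in: "x \<in> rational_span" for x
  proof -
    obtain a b where x: "x = of_rat a + of_rat b * eis_rho" using x_in unfolding rational_span_def by blast
    have r: "of_rat q \<in> ?K" for q by (rule generate_field.incl) simp
    have rho: "eis_rho \<in> ?K" by (rule generate_field.incl) simp
    show ?thesis unfolding x
      using generate_field.eng_add[OF r generate_field.eng_mult[OF r rho], of a b] by simp
  qed
  ultimately show ?thesis by (auto simp: Q_rho_def)
qed

lemma Q_rho_simps [simp]: "monoid.mult Q_rho = (*)" "one Q_rho = 1" "ring.add Q_rho = (+)"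
  by (simp_all add: Q_rho_def complex_ring_def)

lemma rational_span_cnj: "x \<in> rational_span \<Longrightarrow> cnj x \<in> rational_span"
proof -
  assume "x \<in> rational_span"
  then obtain a b where x: "x = of_rat a + of_rat b * eis_rho" unfolding rational_span_def by blast
  have "cnj x = of_rat (a - b) + of_rat (- b) * eis_rho"
    by (simp add: x cnj_of_rat cnj_eis_rho of_rat_diff of_rat_minus algebra_simps)
  then show ?thesis using rational_spanI by metis
qed

lemma of_rat_in_span: "of_rat q \<in> rational_span"
  using rational_spanI[of q 0] by simp

lemma rho_in_span: "eis_rho \<in> rational_span"
  using rational_spanI[of 0 1] by simp

lemma span_mult: "x \<in> rational_span \<Longrightarrow> y \<in> rational_span \<Longrightarrow> x * y \<in> rational_span"
  unfolding rational_span_def using rational_span_mult by blast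

lemma span_add: "x \<in> rational_span \<Longrightarrow> y \<in> rational_span \<Longrightarrow> x + y \<in> rational_span"
proof -
  assume "x \<in> rational_span" "y \<in> rational_span"
  then obtain a b c d where "x = of_rat a + of_rat b * eis_rho" "y = of_rat c + of_rat d * eis_rho"
    unfolding rational_span_def by blast
  then have "x + y = of_rat (a + c) + of_rat (b + d) * eis_rho" by (simp add: of_rat_add algebra_simps)
  then show ?thesis using rational_spanI by metis
qed

text \<open>Rational numbers are fixed, and the image of \<rho> is a root of x^2 + x + 1.\<close>

lemma rational_span_endomorphism:
  assumes hom: "f \<in> ring_hom Q_rho Q_rho" and x: "x \<in> rational_span"
    and rho: "f eis_rho = r"
  shows "r = eis_rho \<or> r = cnj eis_rho"
    and "\<And>a b. f (of_rat a + of_rat b * eis_rho) = of_rat a + of_rat b * r"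
proof -
  have mult: "f (x * y) = f x * f y" and add: "f (x + y) = f x + f y"
    if "x \<in> rational_span" "y \<in> rational_span" for x y
    using hom that unfolding ring_hom_def carrier_Q_rho by auto
  have one: "f 1 = 1" using hom unfolding ring_hom_def by simp
  have int_in: "of_int n \<in> rational_span" for n using of_rat_in_span[of "of_int n"] by simp
  have f0: "f 0 = 0" using add[OF of_rat_in_span[of 0] of_rat_in_span[of 0]] by simp
  have nat: "f (of_nat n) = of_nat n" for n
  proof (induction n)
    case (Suc n)
    show ?case using add[OF int_in[of "int n"] int_in[of 1]] Suc one by (simp add: add.commute)
  qed (simp add: f0)
  have int: "f (of_int n) = of_int n" for n
  proof (cases "n \<ge> 0")
    case True
    then show ?thesis using nat[of "nat n"] by simp
  next
    case False
    have "f (of_int n + of_int (- n)) = f (of_int n) + f (of_int (- n))" by (rule add[OF int_in int_in])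
    moreover have "f (of_int (- n)) = of_int (- n)" using nat[of "nat (- n)"] False by simp
    moreover have "of_int n + of_int (- n) = (0 :: complex)" by simp
    ultimately have "0 = f (of_int n) + of_int (- n)" using f0 by (simp only:)
    then show ?thesis by simp
  qed
  have rat: "f (of_rat q) = of_rat q" for q
  proof -
    obtain a b where q: "q = Fract a b" "b > 0" by (cases q) auto
    have "f (of_rat q) * of_int b = f (of_rat q * of_int b)"
      using mult[OF of_rat_in_span int_in] int by metis
    also have "of_rat q * of_int b = (of_int a :: complex)" using q by (simp add: of_rat_rat)
    also have "f \<dots> = of_int a" by (rule int)
    finally show ?thesis using q by (simp add: of_rat_rat field_simps)
  qed
  have "eis_rho * eis_rho + (1 + eis_rho) = 0" using eis_rho_square by simp
  moreover have "f (eis_rho * eis_rho + (1 + eis_rho)) = r * r + (1 + r)"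
    using add[OF span_mult[OF rho_in_span rho_in_span] span_add[OF int_in[of 1] rho_in_span]]
      add[OF int_in[of 1] rho_in_span] mult[OF rho_in_span rho_in_span] rho one by simp
  ultimately have r: "r * r + (1 + r) = 0" using f0 by simp
  have "(r - eis_rho) * (r - (- 1 - eis_rho)) = r * r + r - (eis_rho * eis_rho + eis_rho)"
    by (simp add: algebra_simps)
  also have "\<dots> = 0" using r unfolding eis_rho_square by (simp add: algebra_simps)
  finally show "r = eis_rho \<or> r = cnj eis_rho" unfolding cnj_eis_rho by (simp only: mult_eq_0_iff right_minus_eq)
  show "f (of_rat a + of_rat b * eis_rho) = of_rat a + of_rat b * r" for a b
    using add[OF of_rat_in_span span_mult[OF of_rat_in_span rho_in_span]]
      mult[OF of_rat_in_span rho_in_span] rat rho by simp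
qed

definition aut_id :: "complex \<Rightarrow> complex" where "aut_id = (\<lambda>x\<in>rational_span. x)"
definition aut_cnj :: "complex \<Rightarrow> complex" where "aut_cnj = (\<lambda>x\<in>rational_span. cnj x)"

lemma aut_Bij: "aut_id \<in> Bij rational_span" "aut_cnj \<in> Bij rational_span"
proof -
  have "bij_betw aut_id rational_span rational_span"
    by (rule bij_betw_byWitness[of _ "\<lambda>x. x"]) (auto simp: aut_id_def)
  then show "aut_id \<in> Bij rational_span" by (simp add: Bij_def aut_id_def)
  have "bij_betw aut_cnj rational_span rational_span"
    by (rule bij_betw_byWitness[of _ cnj]) (auto simp: aut_cnj_def rational_span_cnj)
  then show "aut_cnj \<in> Bij rational_span" by (simp add: Bij_def aut_cnj_def)
qed

lemma aut_ring_iso: "aut_id \<in> ring_iso Q_rho Q_rho" "aut_cnj \<in> ring_iso Q_rho Q_rho"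
proof -
  have one: "1 \<in> rational_span" using of_rat_in_span[of 1] by simp
  show "aut_id \<in> ring_iso Q_rho Q_rho" "aut_cnj \<in> ring_iso Q_rho Q_rho"
    using aut_Bij one unfolding ring_iso_def ring_hom_def carrier_Q_rho Bij_def
    by (auto simp: aut_id_def aut_cnj_def span_mult span_add rational_span_cnj)
qed

lemma carrier_aut: "carrier (ring_aut_group Q_rho) = {aut_id, aut_cnj}"
proof (intro equalityI subsetI)
  fix f assume "f \<in> carrier (ring_aut_group Q_rho)"
  then have f: "f \<in> Bij rational_span" "f \<in> ring_hom Q_rho Q_rho"
    by (auto simp: ring_aut_group_def carrier_Q_rho ring_iso_def)
  note aut = rational_span_endomorphism[OF f(2) rho_in_span refl]
  have ext: "f = g" if "\<And>x. x \<in> rational_span \<Longrightarrow> f x = g x" "g \<in> Bij rational_span" for g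
    using f(1) that by (intro extensionalityI[of _ rational_span]) (auto simp: Bij_def)
  from aut(1) show "f \<in> {aut_id, aut_cnj}"
  proof
    assume r: "f eis_rho = eis_rho"
    have "f = aut_id"
    proof (rule ext[OF _ aut_Bij(1)])
      fix x assume x: "x \<in> rational_span"
      then obtain a b where "x = of_rat a + of_rat b * eis_rho" unfolding rational_span_def by blast
      then show "f x = aut_id x" using aut(2) r x by (simp add: aut_id_def)
    qed
    then show ?thesis by simp
  next
    assume r: "f eis_rho = cnj eis_rho"
    have "f = aut_cnj"
    proof (rule ext[OF _ aut_Bij(2)])
      fix x assume x: "x \<in> rational_span"
      then obtain a b where ab: "x = of_rat a + of_rat b * eis_rho" unfolding rational_span_def by blast
      show "f x = aut_cnj x" using aut(2)[of a b] r x ab by (simp add: aut_cnj_def cnj_of_rat)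
    qed
    then show ?thesis by simp
  qed
next
  fix f assume "f \<in> {aut_id, aut_cnj}"
  then show "f \<in> carrier (ring_aut_group Q_rho)"
    using aut_Bij aut_ring_iso by (auto simp: ring_aut_group_def carrier_Q_rho)
qed

lemma aut_mult:
  "aut_id \<otimes>\<^bsub>ring_aut_group Q_rho\<^esub> aut_id = aut_id" "aut_id \<otimes>\<^bsub>ring_aut_group Q_rho\<^esub> aut_cnj = aut_cnj"
  "aut_cnj \<otimes>\<^bsub>ring_aut_group Q_rho\<^esub> aut_id = aut_cnj" "aut_cnj \<otimes>\<^bsub>ring_aut_group Q_rho\<^esub> aut_cnj = aut_id"
  "\<one>\<^bsub>ring_aut_group Q_rho\<^esub> = aut_id"
  using aut_Bij
  by (auto simp: ring_aut_group_def BijGroup_def carrier_Q_rho compose_def aut_id_def aut_cnj_def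
      rational_span_cnj fun_eq_iff)

lemma aut_distinct: "aut_id \<noteq> aut_cnj"
proof
  assume "aut_id = aut_cnj"
  from fun_cong[OF this, of eis_rho] show False
    using rho_in_span by (simp add: aut_id_def aut_cnj_def complex_eq_iff)
qed

lemma group_aut: "group (ring_aut_group Q_rho)"
proof (rule groupI)
  fix x assume "x \<in> carrier (ring_aut_group Q_rho)"
  then show "\<exists>y\<in>carrier (ring_aut_group Q_rho). y \<otimes>\<^bsub>ring_aut_group Q_rho\<^esub> x = \<one>\<^bsub>ring_aut_group Q_rho\<^esub>"
    unfolding carrier_aut by (auto simp: aut_mult)
qed (auto simp: carrier_aut aut_mult)

lemma order_aut: "order (ring_aut_group Q_rho) = 2"
  by (simp add: order_def carrier_aut aut_distinct)

lemma aut_generate: "carrier (ring_aut_group Q_rho)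
       = generate (ring_aut_group Q_rho) {\<lambda>x \<in> carrier Q_rho. cnj x}"
proof -
  interpret group "ring_aut_group Q_rho" by (rule group_aut)
  have c: "(\<lambda>x \<in> carrier Q_rho. cnj x) = aut_cnj" by (simp add: carrier_Q_rho aut_cnj_def)
  have "generate (ring_aut_group Q_rho) {aut_cnj} \<subseteq> carrier (ring_aut_group Q_rho)"
    by (rule generate_incl) (simp add: carrier_aut)
  moreover have "aut_id \<in> generate (ring_aut_group Q_rho) {aut_cnj}"
    using generate.one[of "ring_aut_group Q_rho" "{aut_cnj}"] by (simp add: aut_mult)
  moreover have "aut_cnj \<in> generate (ring_aut_group Q_rho) {aut_cnj}" by (rule generate.incl) simp
  ultimately show ?thesis unfolding c carrier_aut by blast
qed

lemma eis_ints_in_span: "eis_ints \<subseteq> rational_span"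
proof
  fix x assume "x \<in> eis_ints"
  then obtain a b where "x = of_int a + of_int b * eis_rho" unfolding eis_ints_def by blast
  then have "x = of_rat (of_int a) + of_rat (of_int b) * eis_rho" by simp
  then show "x \<in> rational_span" using rational_spanI by metis
qed

lemma restrict_aut: "restrict aut_id eis_ints = lift (\<lambda>z. z)" "restrict aut_cnj eis_ints = lift eis_cnj"
  using eis_ints_in_span by (auto simp: aut_id_def aut_cnj_def lift_def fun_eq_iff to_complex_cnj)

lemma aut_iso: "(\<lambda>f. restrict f eis_ints) \<in> iso (ring_aut_group Q_rho) (D6_group\<lparr>carrier := C2\<rparr>)"
proof -
  have "(\<lambda>f. restrict f eis_ints) \<in> hom (ring_aut_group Q_rho) (D6_group\<lparr>carrier := C2\<rparr>)"
  proof (rule homI)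
    show "restrict f eis_ints \<in> carrier (D6_group\<lparr>carrier := C2\<rparr>)" if "f \<in> carrier (ring_aut_group Q_rho)" for f
      using that unfolding carrier_aut by (auto simp: restrict_aut C2_eq)
    show "restrict (f \<otimes>\<^bsub>ring_aut_group Q_rho\<^esub> g) eis_ints =
      restrict f eis_ints \<otimes>\<^bsub>D6_group\<lparr>carrier := C2\<rparr>\<^esub> restrict g eis_ints"
      if "f \<in> carrier (ring_aut_group Q_rho)" "g \<in> carrier (ring_aut_group Q_rho)" for f g
      using that unfolding carrier_aut
      by (auto simp: restrict_aut aut_mult D6_group_mult hexagonal_id hexagonal_cnj)
  qed
  moreover have "inj_on (\<lambda>f. restrict f eis_ints) {aut_id, aut_cnj}"
  proof -
    have "lift (\<lambda>z. z) \<noteq> lift eis_cnj"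
    proof
      assume "lift (\<lambda>z. z) = lift eis_cnj"
      from fun_cong[OF lift_inject[OF this], of eis_omega] show False by (simp add: eis_omega_def)
    qed
    then show ?thesis by (auto simp: restrict_aut)
  qed
  ultimately show ?thesis by (simp add: iso_def bij_betw_def carrier_aut C2_eq restrict_aut)
qed

section \<open>Maximality among the finite matrix groups\<close>

definition to_vec :: "eis \<Rightarrow> int ^ 2" where
  "to_vec z = (\<chi> i. if i = 1 then eis_fst z else eis_snd z)"

definition from_vec :: "int ^ 2 \<Rightarrow> eis" where
  "from_vec v = Eis (v $ 1) (v $ 2)"

lemma from_to_vec [simp]: "from_vec (to_vec z) = z"
  by (simp add: from_vec_def to_vec_def)

lemma to_from_vec [simp]: "to_vec (from_vec v) = v"
  unfolding from_vec_def to_vec_def by (simp add: vec_eq_iff forall_2)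

definition mat_act :: "int ^ 2 ^ 2 \<Rightarrow> eis \<Rightarrow> eis" where
  "mat_act M z = from_vec (M *v to_vec z)"

lemma mat_act_Eis: "mat_act M (Eis a b) = Eis (M $ 1 $ 1 * a + M $ 1 $ 2 * b) (M $ 2 $ 1 * a + M $ 2 $ 2 * b)"
  by (simp add: mat_act_def from_vec_def to_vec_def matrix_vector_mult_def sum_2)

lemma mat_act_mult: "mat_act (M ** N) z = mat_act M (mat_act N z)"
  by (simp add: mat_act_def matrix_vector_mul_assoc)

lemma mat_act_one: "mat_act (mat 1) z = z"
  by (simp add: mat_act_def)

lemma mat_act_inject: "mat_act M = mat_act N \<Longrightarrow> M = N"
proof -
  assume eq: "mat_act M = mat_act N"
  have "M *v v = N *v v" for v
    using fun_cong[OF eq, of "from_vec v"] unfolding mat_act_def by (metis to_from_vec)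
  then show "M = N" using matrix_eq by blast
qed

lemma mat_act_add: "mat_act M (x + y) = mat_act M x + mat_act M y"
  by (cases x; cases y) (simp add: mat_act_Eis algebra_simps)

definition hexmat :: "(eis \<Rightarrow> eis) \<Rightarrow> int ^ 2 ^ 2" where
  "hexmat A = (\<chi> i j. to_vec (A (if j = 1 then 1 else eis_omega)) $ i)"

lemma additive_Eis:
  fixes A :: "eis \<Rightarrow> eis"
  assumes "\<And>x y. A (x + y) = A x + A (y :: eis)"
  shows "A (Eis a b) = of_int a * A 1 + of_int b * A eis_omega"
proof -
  have "Eis a b = of_int a * 1 + of_int b * eis_omega" by (simp add: eis_of_int eis_omega_def)
  then show ?thesis using assms additive_of_int_mult[OF assms] by metis
qed

lemma mat_act_hexmat:
  assumes "\<And>x y. A (x + y) = A x + A (y :: eis)"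
  shows "mat_act (hexmat A) = A"
proof
  fix z
  obtain a b where z: "z = Eis a b" by (cases z)
  obtain p q r s where *: "A 1 = Eis p q" "A eis_omega = Eis r s" by (cases "A 1"; cases "A eis_omega")
  show "mat_act (hexmat A) z = A z"
    unfolding z mat_act_Eis additive_Eis[OF assms] *
    by (simp add: hexmat_def to_vec_def * eis_of_int algebra_simps)
qed

lemma group_GL2Z: "group GL2Z"
proof (rule groupI)
  fix A assume "A \<in> carrier GL2Z"
  then obtain B where "A ** B = mat 1" "B ** A = mat 1" by (auto simp: GL2Z_def invertible_def)
  then show "\<exists>B\<in>carrier GL2Z. B \<otimes>\<^bsub>GL2Z\<^esub> A = \<one>\<^bsub>GL2Z\<^esub>"
    by (intro bexI[of _ B]) (auto simp: GL2Z_def invertible_def)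
next
  show "\<one>\<^bsub>GL2Z\<^esub> \<in> carrier GL2Z"
    unfolding GL2Z_def invertible_def by (auto intro!: exI[of _ "mat 1"])
next
  fix A B assume "A \<in> carrier GL2Z" "B \<in> carrier GL2Z"
  then obtain A' B' where *: "A ** A' = mat 1" "A' ** A = mat 1" "B ** B' = mat 1" "B' ** B = mat 1"
    by (auto simp: GL2Z_def invertible_def)
  have "(A ** B) ** (B' ** A') = A ** (B ** B') ** A'" by (simp only: matrix_mul_assoc)
  moreover have "(B' ** A') ** (A ** B) = B' ** (A' ** A) ** B" by (simp only: matrix_mul_assoc)
  ultimately show "A \<otimes>\<^bsub>GL2Z\<^esub> B \<in> carrier GL2Z"
    using * by (auto simp: GL2Z_def invertible_def intro!: exI[of _ "B' ** A'"])
qed (simp_all add: GL2Z_def matrix_mul_assoc)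

lemma hexmat_hom: "hexmat \<in> hom hex_group GL2Z"
proof (rule homI)
  have mult: "hexmat (\<lambda>z. A (B z)) = hexmat A ** hexmat B" if "hexagonal A" "hexagonal B" for A B
  proof (rule mat_act_inject, rule ext)
    fix z
    show "mat_act (hexmat (\<lambda>z. A (B z))) z = mat_act (hexmat A ** hexmat B) z"
      using that hexagonal_comp[OF that] by (simp add: mat_act_mult mat_act_hexmat hexagonal_add)
  qed
  have one: "hexmat (\<lambda>z. z) = mat 1"
    by (rule mat_act_inject) (simp add: mat_act_hexmat fun_eq_iff mat_act_one)
  show "hexmat A \<in> carrier GL2Z" if "A \<in> carrier hex_group" for A
  proof -
    have A: "hexagonal A" using that by (simp add: hex_group_def)
    obtain B where B: "hexagonal B" "\<And>z. A (B z) = z" "\<And>z. B (A z) = z" using hexagonal_inverse[OF A] by blast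
    then have "hexmat A ** hexmat B = mat 1" "hexmat B ** hexmat A = mat 1"
      using mult[OF A B(1)] mult[OF B(1) A] one by simp_all
    then show ?thesis unfolding GL2Z_def invertible_def by auto
  qed
  show "hexmat (A \<otimes>\<^bsub>hex_group\<^esub> B) = hexmat A \<otimes>\<^bsub>GL2Z\<^esub> hexmat B"
    if "A \<in> carrier hex_group" "B \<in> carrier hex_group" for A B
    using that mult by (simp add: hex_group_def GL2Z_def)
qed

lemma inj_hexmat: "inj_on hexmat (carrier hex_group)"
proof (rule inj_onI)
  fix A B assume "A \<in> carrier hex_group" "B \<in> carrier hex_group" "hexmat A = hexmat B"
  then show "A = B" using mat_act_hexmat hexagonal_add by (metis hex_group_def mem_Collect_eq partial_object.select_convs(1))
qed

text \<open>The images of 1 and \<rho> are units, and so is the image of 1 + \<rho>. Among the six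
units, the quotient of the first two can then only be \<rho> or cnj \<rho>.\<close>

lemma norm_preserving_hexagonal:
  assumes add: "\<And>x y. A (x + y) = A x + A (y :: eis)" and norm: "\<And>z. eis_norm (A z) = eis_norm z"
  shows "hexagonal A"
proof -
  have e: "A 1 dvd 1" by (simp add: eis_unit_iff norm)
  then obtain u where u: "u dvd 1" "u * A 1 = 1" using unit_inverse by blast
  define g where "g = u * A eis_omega"
  have un: "eis_norm u = 1" using u(1) by (simp add: eis_unit_iff)
  have "eis_norm g = 1" by (simp add: g_def eis_norm_mult un norm) (simp add: eis_omega_def)
  then have "g \<in> {e. e dvd 1}" by (simp add: eis_unit_iff)
  moreover have "eis_norm (1 + g) = 1"
  proof -
    have "1 + g = u * A (1 + eis_omega)" by (simp add: g_def add distrib_left u(2))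
    then show ?thesis by (simp add: eis_norm_mult un norm) (simp add: eis_omega_def one_eis_def)
  qed
  ultimately have "g = Eis 0 1 \<or> g = Eis (- 1) (- 1)"
    unfolding eis_units by (auto simp: one_eis_def)
  then have g: "g = eis_omega \<or> g = eis_cnj eis_omega" by (simp add: eis_omega_def)
  have "A 1 * g = A eis_omega" by (simp add: g_def mult.assoc[symmetric] mult.commute[of "A 1" u] u(2))
  then have w: "A eis_omega = A 1 * eis_omega \<or> A eis_omega = A 1 * eis_cnj eis_omega" using g by metis
  have ezs: "A 1 * Eis a b = of_int a * A 1 + of_int b * (A 1 * eis_omega)"
    "A 1 * eis_cnj (Eis a b) = of_int a * A 1 + of_int b * (A 1 * eis_cnj eis_omega)" for a b
    by (cases "A 1"; simp add: eis_of_int eis_omega_def algebra_simps)+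
  have "A = (\<lambda>z. A 1 * z) \<or> A = (\<lambda>z. A 1 * eis_cnj z)"
    using w
  proof
    assume w: "A eis_omega = A 1 * eis_omega"
    have "A z = A 1 * z" for z by (cases z) (simp only: additive_Eis[of A, OF add] ezs w)
    then show ?thesis by blast
  next
    assume w: "A eis_omega = A 1 * eis_cnj eis_omega"
    have "A z = A 1 * eis_cnj z" for z by (cases z) (simp only: additive_Eis[of A, OF add] ezs w)
    then show ?thesis by blast
  qed
  then show ?thesis unfolding hexagonal_def using e by blast
qed

text \<open>Summing the square of one coordinate over a finite matrix group gives an invariant
quadratic form. Invariance under multiplication by \<rho> determines it up to the factor \<alpha>,
which is positive because the identity matrix contributes 1.\<close>

lemma finite_group_preserves_norm:
  assumes N: "subgroup N GL2Z" "finite N" and sub: "hexmat ` carrier hex_group \<subseteq> N" and h: "h \<in> N"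
  shows "eis_norm (mat_act h z) = eis_norm z"
proof -
  interpret G: group GL2Z by (rule group_GL2Z)
  define F where "F z = (\<Sum>g\<in>N. (eis_fst (mat_act g z))\<^sup>2)" for z
  have inv: "F (mat_act h z) = F z" if h: "h \<in> N" for h z
  proof -
    have hG: "h \<in> carrier GL2Z" using subgroup.mem_carrier[OF N(1)] h by blast
    have closed: "g ** h \<in> N" if "g \<in> N" for g
      using subgroup.m_closed[OF N(1) that h] by (simp add: GL2Z_def)
    have "inj_on (\<lambda>g. g ** h) N"
    proof (rule inj_onI)
      fix g g' assume "g \<in> N" "g' \<in> N" "g ** h = g' ** h"
      then have "g \<otimes>\<^bsub>GL2Z\<^esub> h = g' \<otimes>\<^bsub>GL2Z\<^esub> h" "g \<in> carrier GL2Z" "g' \<in> carrier GL2Z"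
        using subgroup.mem_carrier[OF N(1)] by (simp_all add: GL2Z_def)
      then show "g = g'" using hG by simp
    qed
    then have bij: "bij_betw (\<lambda>g. g ** h) N N"
      using N(2) closed by (simp add: bij_betw_def endo_inj_surj image_subsetI)
    have "F (mat_act h z) = (\<Sum>g\<in>N. (eis_fst (mat_act (g ** h) z))\<^sup>2)" by (simp add: F_def mat_act_mult)
    also have "\<dots> = F z" unfolding F_def by (rule sum.reindex_bij_betw[OF bij])
    finally show ?thesis .
  qed
  define \<alpha> \<beta> \<gamma> where "\<alpha> = (\<Sum>g\<in>N. (g $ 1 $ 1)\<^sup>2)" and "\<beta> = (\<Sum>g\<in>N. 2 * (g $ 1 $ 1 * g $ 1 $ 2))"
    and "\<gamma> = (\<Sum>g\<in>N. (g $ 1 $ 2)\<^sup>2)"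
  have F: "F (Eis a b) = \<alpha> * a\<^sup>2 + \<beta> * (a * b) + \<gamma> * b\<^sup>2" for a b
    unfolding F_def \<alpha>_def \<beta>_def \<gamma>_def sum_distrib_right sum.distrib[symmetric]
    by (rule sum.cong) (simp_all add: mat_act_Eis power2_eq_square algebra_simps)
  let ?R = "\<lambda>z. eis_omega * z"
  have R: "hexagonal ?R" by (rule hexagonal_mult) (simp add: eis_unit_iff eis_omega_def)
  then have RN: "hexmat ?R \<in> N" using sub by (auto simp: hex_group_def)
  have FR: "F (eis_omega * z) = F z" for z
    using inv[OF RN, of z] mat_act_hexmat[of ?R, OF hexagonal_add[OF R]] by simp
  have "F (Eis 0 1) = F (Eis 1 0)" "F (Eis (- 1) (- 1)) = F (Eis 0 1)"
    using FR[of "Eis 1 0"] FR[of "Eis 0 1"] by (simp_all add: eis_omega_def)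
  then have g: "\<gamma> = \<alpha>" "\<beta> = - \<alpha>" unfolding F by simp_all
  have Fn: "F z = \<alpha> * eis_norm z" for z
    by (cases z) (simp add: F g algebra_simps)
  have "mat 1 \<in> N" using subgroup.one_closed[OF N(1)] by (simp add: GL2Z_def)
  then have "((mat 1 :: int ^ 2 ^ 2) $ 1 $ 1)\<^sup>2 \<le> \<alpha>"
    unfolding \<alpha>_def using N(2) member_le_sum[of "mat 1" N "\<lambda>g. (g $ 1 $ 1)\<^sup>2"] by simp
  then have "\<alpha> > 0" by (simp add: mat_def)
  then show ?thesis using inv[OF h, of z] unfolding Fn by simp
qed

lemma D6_maximal_finite:
  "\<exists>M. maximal_finite_subgroup M GL2Z \<and> D6_group \<cong> GL2Z\<lparr>carrier := M\<rparr>"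
proof (intro exI conjI)
  let ?M = "hexmat ` carrier hex_group"
  interpret H: group_hom hex_group GL2Z hexmat
    by (simp add: group_hom_def group_hom_axioms_def group_hex_group group_GL2Z hexmat_hom)
  have sub: "subgroup ?M GL2Z" by (rule H.img_is_subgroup)
  show "maximal_finite_subgroup ?M GL2Z"
    unfolding maximal_finite_subgroup_def
  proof (intro conjI allI impI sub)
    have "finite (carrier hex_group)" unfolding carrier_hex_group by (simp add: eis_units)
    then show "finite ?M" by simp
    fix N assume N: "subgroup N GL2Z \<and> finite N \<and> ?M \<subseteq> N"
    have "h \<in> ?M" if h: "h \<in> N" for h
    proof -
      have "hexagonal (mat_act h)"
        by (rule norm_preserving_hexagonal[OF mat_act_add finite_group_preserves_norm]) (use N h in auto)
      moreover have "hexmat (mat_act h) = h" by (rule mat_act_inject) (rule mat_act_hexmat[OF mat_act_add])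
      ultimately show ?thesis by (metis hex_group_def image_eqI mem_Collect_eq partial_object.select_convs(1))
    qed
    then show "N = ?M" using N by blast
  qed
  have "hexmat \<in> iso hex_group (GL2Z\<lparr>carrier := ?M\<rparr>)"
    using hexmat_hom inj_hexmat by (auto simp: iso_def hom_def bij_betw_def)
  then have "hex_group \<cong> GL2Z\<lparr>carrier := ?M\<rparr>" unfolding is_iso_def by blast
  moreover have "D6_group \<cong> hex_group"
    using group.iso_sym[OF group_hex_group] lift_iso unfolding is_iso_def by blast
  ultimately show "D6_group \<cong> GL2Z\<lparr>carrier := ?M\<rparr>" by (rule iso_trans[rotated])
qed

theorem theorem6p5:
  fixes k :: nat
  assumes "k \<ge> 2"
  shows
    "symmetries eis_ints (eis_shift k) = shift_map (eis_shift k) ` eis_ints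
   \<and> shift_map (eis_shift k) \<in> iso (add_monoid eis_ring) (symmetry_group eis_ints (eis_shift k))
   \<and> add_monoid eis_ring \<cong> integer_group \<times>\<times> integer_group
   \<and> semidirect_product (extended_symmetry_group eis_ints (eis_shift k))
       (symmetries eis_ints (eis_shift k)) (induced_map (eis_shift k) ` D6)
   \<and> induced_map (eis_shift k) \<in> iso D6_group
       ((extended_symmetry_group eis_ints (eis_shift k))
          \<lparr>carrier := induced_map (eis_shift k) ` D6\<rparr>)
   \<and> semidirect_product D6_group C6 C2
   \<and> order D6_group = 12
   \<and> (\<lambda>f. restrict f eis_ints) \<in> iso (isometry_group_of regular_hexagon) D6_group
   \<and> (\<exists>M. maximal_finite_subgroup M GL2Z \<and> D6_group \<cong> GL2Z\<lparr>carrier := M\<rparr>)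
   \<and> Units eis_ring = {(- eis_rho) ^ m | m. m \<le> 5}
   \<and> cyclic_group (units_of eis_ring) \<and> order (units_of eis_ring) = 6
   \<and> unit_mult \<in> iso (units_of eis_ring) (D6_group\<lparr>carrier := C6\<rparr>)
   \<and> (\<lambda>f. restrict f eis_ints) \<in> iso (ring_aut_group Q_rho) (D6_group\<lparr>carrier := C2\<rparr>)
   \<and> carrier (ring_aut_group Q_rho)
       = generate (ring_aut_group Q_rho) {\<lambda>x \<in> carrier Q_rho. cnj x}
   \<and> order (ring_aut_group Q_rho) = 2"
  using symmetries_eq[OF assms] shift_map_iso[OF assms] eis_add_group_iso semidirect_extended[OF assms]
    induced_map_iso[OF assms] semidirect_D6 order_D6 isometry_group_iso D6_maximal_finite Units_powers
    cyclic_units order_units unit_mult_iso aut_iso aut_generate order_aut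
  by (intro conjI)

end
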